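(* Let $k\ge 2$ and $d\geq 1$ be integers. Let $\mathrm{Emb}^k(S^1,\mathbb{R}^d)$ be the space of $C^k$-embeddings of $S^1$ into $\mathbb{R}^d$, with the Whitney $C^k$-topology, and let $$\Xi=\{\gamma\in \mathrm{Emb}^k(S^1,\mathbb{R}^d) : \mathcal{T}_\gamma \text{ is Morse-supported}\}.$$ Then $\Xi$ is open and dense in $\mathrm{Emb}^k(S^1,\mathbb{R}^d)$ in the Whitney $C^k$-topology. Furthermore, for every $\gamma\in\Xi$ and every homology degree $i$, the $i$-th persistence modules (homology with coefficients in a field) of the sublevel set filtrations of $\mathcal{T}_\gamma$ and of $\mathsf{T}_\gamma$ are pointwise finite dimensional.
   Context: $\mathbf{F}_2(S^1)$ is the set of non-empty subsets $\{z_1,z_2\}\subset S^1$ of cardinality at most $2$, with the quotient topology from $S^1\times S^1\to \mathbf{F}_2(S^1)$, $(z_1,z_2)\mapsto\{z_1,z_2\}$. It is a compact smooth 2-manifold with boundary (a Möbius band): with $e(t)=e^{2\pi \mathrm{i} t}$, the map $(x_1,x_2)\mapsto\{e(x_1),e(x_2)\}$ from the strip $\{(x_1,x_2)\in\mathbb{R}^2: 0\le x_2-x_1\le 1\}$ is its universal covering, with deck group generated by $(x_1,x_2)\mapsto(x_2,x_1+1)$, and the smooth structure is the one making this a local diffeomorphism. Its boundary is the set of singletons $\{z\}$; its interior is the set of two-element subsets. For a continuous $\gamma:S^1\to\mathbb{R}^d$, define $\mathsf{T}_\gamma,\mathcal{T}_\gamma:\mathbf{F}_2(S^1)\to\mathbb{R}$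 by $\mathsf{T}_\gamma(\{z_1,z_2\})=\|\gamma(z_1)-\gamma(z_2)\|_2$ and $\mathcal{T}_\gamma=\tfrac12\mathsf{T}_\gamma^2$. If $\gamma$ is $C^k$ then so is $\mathcal{T}_\gamma$. Morse-supported: let $(M,\partial M)$ be a compact manifold with boundary and $f\in C^k(M,\mathbb{R})$, $k\ge2$, a non-negative function with $f^{-1}(0)=\partial M$. $f$ is Morse-supported if: (M1) all critical points of $f$ in the interior of $M$ are non-degenerate; (M2) $f$ has only finitely many critical points in the interior of $M$; (M3) there is some $a>0$ such that for all $t\in[0,a]$, $\partial M=f^{-1}(0)$ is a deformation retract of $f^{-1}[0,t]$. The $i$-th persistence module of the sublevel set filtration of $f:X\to\mathbb{R}$ is the family of vector spaces $H_i(f^{-1}(-\infty,t])$, $t\in\mathbb{R}$, with maps induced by inclusions; it is pointwise finite dimensional if each of these vector spaces is finite dimensional. A $C^k$-embedding ($k\ge1$) is an injective $C^k$ immersion that is a homeomorphism onto its image. *)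

theory Defs
  imports
    "HOL-Analysis.Analysis"
    "HOL-Homology.Homology"
    "Jordan_Normal_Form.Missing_VectorSpace"
begin

subsection \<open>Functions of class \<open>C\<^sup>k\<close>\<close>

primrec Ck_open :: "nat \<Rightarrow> 'a::euclidean_space set \<Rightarrow> ('a \<Rightarrow> 'b::real_normed_vector) \<Rightarrow> bool" where
  "Ck_open 0 U f \<longleftrightarrow> continuous_on U f"
| "Ck_open (Suc k) U f \<longleftrightarrow>
     (\<forall>x\<in>U. f differentiable (at x)) \<and> (\<forall>v. Ck_open k U (\<lambda>x. frechet_derivative f (at x) v))"

text \<open>On a set that need not be open: local extendability to a \<open>C\<^sup>k\<close> function.\<close>

definition Ck_on :: "nat \<Rightarrow> 'a::euclidean_space set \<Rightarrow> ('a \<Rightarrow> 'b::real_normed_vector) \<Rightarrow> bool" where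
  "Ck_on k D f \<longleftrightarrow>
     (\<forall>x\<in>D. \<exists>U g. open U \<and> x \<in> U \<and> Ck_open k U g \<and> (\<forall>y\<in>D \<inter> U. g y = f y))"

subsection \<open>Morse-supported functions on a manifold with boundary\<close>

text \<open>
  A manifold with boundary is given by a topology \<open>X\<close> and an atlas of local parametrisations
  \<open>(D, \<phi>)\<close>: \<open>D\<close> is a subset of a Euclidean space \<open>'e\<close>, relatively open in a half-space (or in any
  region with smooth boundary, such as a strip), and \<open>\<phi>\<close> maps \<open>D\<close> homeomorphically onto an open
  subset of \<open>X\<close>.
\<close>

type_synonym ('e, 'a) atlas = "('e set \<times> ('e \<Rightarrow> 'a)) set"

definition mfd_interior :: "('e::euclidean_space, 'a) atlas \<Rightarrow> 'a set" where
  "mfd_interior A = (\<Union>(D, \<phi>)\<in>A. \<phi> ` interior D)"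

definition mfd_boundary :: "'a topology \<Rightarrow> ('e::euclidean_space, 'a) atlas \<Rightarrow> 'a set" where
  "mfd_boundary X A = topspace X - mfd_interior A"

definition Ck_function :: "nat \<Rightarrow> ('e::euclidean_space, 'a) atlas \<Rightarrow> ('a \<Rightarrow> real) \<Rightarrow> bool" where
  "Ck_function k A f \<longleftrightarrow> (\<forall>(D, \<phi>)\<in>A. Ck_on k D (f \<circ> \<phi>))"

definition interior_critical_points :: "('e::euclidean_space, 'a) atlas \<Rightarrow> ('a \<Rightarrow> real) \<Rightarrow> 'a set" where
  "interior_critical_points A f =
     {p. \<exists>(D, \<phi>)\<in>A. \<exists>x\<in>interior D. \<phi> x = p \<and> ((f \<circ> \<phi>) has_derivative (\<lambda>_. 0)) (at x)}"

definition hessian :: "('e::euclidean_space \<Rightarrow> real) \<Rightarrow> 'e \<Rightarrow> 'e \<Rightarrow> 'e \<Rightarrow> real" where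
  "hessian g x u v = frechet_derivative (\<lambda>y. frechet_derivative g (at y) u) (at x) v"

definition nondegenerate_at :: "('e::euclidean_space, 'a) atlas \<Rightarrow> ('a \<Rightarrow> real) \<Rightarrow> 'a \<Rightarrow> bool" where
  "nondegenerate_at A f p \<longleftrightarrow>
     (\<forall>(D, \<phi>)\<in>A. \<forall>x\<in>interior D. \<phi> x = p \<longrightarrow>
        (\<forall>u. (\<forall>v. hessian (f \<circ> \<phi>) x u v = 0) \<longrightarrow> u = 0))"

text \<open>The deformation is required to keep \<open>S\<close> pointwise fixed at all times.\<close>

definition deformation_retract_of :: "'a set \<Rightarrow> 'a topology \<Rightarrow> bool"
    (infix \<open>deformation'_retract'_of\<close> 50) where
  "S deformation_retract_of X \<longleftrightarrow>
     (\<exists>r. retraction_maps X (subtopology X S) r id \<and>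
          S \<subseteq> topspace X \<and> homotopic_with (\<lambda>h. \<forall>x\<in>S. h x = x) X X id r)"

definition Morse_supported ::
    "nat \<Rightarrow> 'a topology \<Rightarrow> ('e::euclidean_space, 'a) atlas \<Rightarrow> ('a \<Rightarrow> real) \<Rightarrow> bool" where
  "Morse_supported k X A f \<longleftrightarrow>
     Ck_function k A f \<and>
     (\<forall>p\<in>topspace X. 0 \<le> f p) \<and>
     {p\<in>topspace X. f p = 0} = mfd_boundary X A \<and>
     (\<forall>p\<in>interior_critical_points A f. nondegenerate_at A f p) \<and>
     finite (interior_critical_points A f) \<and>
     (\<exists>a>0. \<forall>t\<in>{0..a}.
        mfd_boundary X A deformation_retract_of subtopology X {p\<in>topspace X. 0 \<le> f p \<and> f p \<le> t})"

subsection \<open>The space \<open>F\<^sub>2(S\<^sup>1)\<close>\<close>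

abbreviation S1 :: "complex set" where
  "S1 \<equiv> sphere 0 1"

definition circle_exp :: "real \<Rightarrow> complex" where
  "circle_exp t = cis (2 * pi * t)"

definition F2_set :: "complex set set" where
  "F2_set = {{z, w} |z w. z \<in> S1 \<and> w \<in> S1}"

definition F2 :: "complex set topology" where
  "F2 = topology (\<lambda>U. U \<subseteq> F2_set \<and>
     openin (prod_topology (top_of_set S1) (top_of_set S1)) {(z, w). z \<in> S1 \<and> w \<in> S1 \<and> {z, w} \<in> U})"

lemma openin_F2:
  "openin F2 U \<longleftrightarrow> U \<subseteq> F2_set \<and>
     openin (prod_topology (top_of_set S1) (top_of_set S1)) {(z, w). z \<in> S1 \<and> w \<in> S1 \<and> {z, w} \<in> U}"
proof -
  let ?P = "prod_topology (top_of_set S1) (top_of_set S1)"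
  let ?pre = "\<lambda>U. {(z, w). z \<in> S1 \<and> w \<in> S1 \<and> {z, w} \<in> U}"
  have "istopology (\<lambda>U. U \<subseteq> F2_set \<and> openin ?P (?pre U))"
    unfolding istopology_def
  proof (intro conjI allI impI)
    fix S T assume "S \<subseteq> F2_set \<and> openin ?P (?pre S)" "T \<subseteq> F2_set \<and> openin ?P (?pre T)"
    moreover have "?pre (S \<inter> T) = ?pre S \<inter> ?pre T" by auto
    ultimately show "S \<inter> T \<subseteq> F2_set" "openin ?P (?pre (S \<inter> T))" by auto
  next
    fix K assume K: "\<forall>S\<in>K. S \<subseteq> F2_set \<and> openin ?P (?pre S)"
    have "?pre (\<Union>K) = \<Union>(?pre ` K)" by auto
    then show "openin ?P (?pre (\<Union>K))" using K by auto
    show "\<Union>K \<subseteq> F2_set" using K by auto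
  qed
  then show ?thesis unfolding F2_def by (simp add: topology_inverse')
qed

lemma F2_setI: "z \<in> S1 \<Longrightarrow> w \<in> S1 \<Longrightarrow> {z, w} \<in> F2_set"
  unfolding F2_set_def by blast

lemma topspace_F2: "topspace F2 = F2_set"
proof
  have "{(z, w). z \<in> S1 \<and> w \<in> S1 \<and> {z, w} \<in> F2_set} = S1 \<times> S1"
    using F2_setI by blast
  moreover have "openin (prod_topology (top_of_set S1) (top_of_set S1)) (S1 \<times> S1)"
    by (simp add: openin_prod_Times_iff)
  ultimately have "openin F2 F2_set" unfolding openin_F2 by simp
  then show "F2_set \<subseteq> topspace F2" by (rule openin_subset)
  show "topspace F2 \<subseteq> F2_set" using openin_topspace[of F2] unfolding openin_F2 by blast
qed

lemma quotient_map_F2: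
  "quotient_map (prod_topology (top_of_set S1) (top_of_set S1)) F2 (\<lambda>(z, w). {z, w})"
proof -
  have pre: "{p \<in> S1 \<times> S1. (case p of (z, w) \<Rightarrow> {z, w}) \<in> U} =
        {(z, w). z \<in> S1 \<and> w \<in> S1 \<and> {z, w} \<in> U}" for U by auto
  have "(\<lambda>(z, w). {z, w}) ` (S1 \<times> S1) = F2_set"
  proof
    show "(\<lambda>(z, w). {z, w}) ` (S1 \<times> S1) \<subseteq> F2_set"
      by (rule image_subsetI) (metis F2_setI SigmaE2 case_prod_conv surj_pair)
    show "F2_set \<subseteq> (\<lambda>(z, w). {z, w}) ` (S1 \<times> S1)"
    proof
      fix P assume "P \<in> F2_set"
      then obtain z w where "z \<in> S1" "w \<in> S1" "P = {z, w}" unfolding F2_set_def by blast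
      then show "P \<in> (\<lambda>(z, w). {z, w}) ` (S1 \<times> S1)" by (intro image_eqI[of _ _ "(z, w)"]) auto
    qed
  qed
  then show ?thesis
    unfolding quotient_map_def topspace_F2 openin_F2 topspace_prod_topology
      topspace_euclidean_subtopology pre by blast
qed

definition strip :: "(real \<times> real) set" where
  "strip = {(x1, x2). 0 \<le> x2 - x1 \<and> x2 - x1 \<le> 1}"

definition F2_cover :: "real \<times> real \<Rightarrow> complex set" where
  "F2_cover = (\<lambda>(x1, x2). {circle_exp x1, circle_exp x2})"

text \<open>
  The covering \<open>strip \<rightarrow> F\<^sub>2(S\<^sup>1)\<close> is a local homeomorphism; its restrictions to the relatively
  open sets on which it is injective are the charts making it a local diffeomorphism.
\<close>

definition F2_atlas :: "(real \<times> real, complex set) atlas" where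
  "F2_atlas = {(D, F2_cover) |D. openin (top_of_set strip) D \<and> inj_on F2_cover D}"

lemma circle_exp_eq_iff: "circle_exp a = circle_exp b \<longleftrightarrow> a - b \<in> \<int>"
proof -
  have "circle_exp a = circle_exp b \<longleftrightarrow> cis (2 * pi * (a - b)) = 1"
    by (simp add: circle_exp_def right_diff_distrib flip: cis_divide)
  also have "\<dots> \<longleftrightarrow> a - b \<in> \<int>"
  proof
    assume "cis (2 * pi * (a - b)) = 1"
    then have "cos (2 * pi * (a - b)) = 1" by (simp add: complex_eq_iff)
    then obtain n :: int where "2 * pi * (a - b) = of_int n * 2 * pi"
      by (auto simp: cos_one_2pi_int)
    then have "a - b = of_int n" by simp
    then show "a - b \<in> \<int>" by simp
  qed simp
  finally show ?thesis .
qed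

lemma circle_exp_in: "circle_exp t \<in> S1"
  by (simp add: circle_exp_def)

lemma circle_exp_surj:
  assumes "z \<in> S1" obtains t where "z = circle_exp t"
proof
  show "z = circle_exp (Arg z / (2 * pi))"
    using assms cis_Arg[of z] by (cases "z = 0") (auto simp: circle_exp_def sgn_eq)
qed

lemma mfd_interior_F2: "mfd_interior F2_atlas = {{z, w} |z w. z \<in> S1 \<and> w \<in> S1 \<and> z \<noteq> w}"
proof (intro equalityI subsetI)
  fix P assume "P \<in> mfd_interior F2_atlas"
  then obtain D x1 x2 where D: "openin (top_of_set strip) D"
    and x: "(x1, x2) \<in> interior D" and P: "P = {circle_exp x1, circle_exp x2}"
    by (auto simp: mfd_interior_def F2_atlas_def F2_cover_def)
  then obtain e where e: "e > 0" "ball (x1, x2) e \<subseteq> D" by (auto simp: mem_interior)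
  with D have sub: "ball (x1, x2) e \<subseteq> strip" by (auto dest: openin_imp_subset)
  have "(x1 + e/2, x2) \<in> ball (x1, x2) e" "(x1 - e/2, x2) \<in> ball (x1, x2) e"
    using e by (auto simp: dist_prod_def dist_real_def)
  with sub have "(x1 + e/2, x2) \<in> strip" "(x1 - e/2, x2) \<in> strip" by blast+
  then have "0 < x2 - x1" "x2 - x1 < 1" using e by (auto simp: strip_def)
  then have "x2 - x1 \<notin> \<int>" by (auto elim: Ints_cases)
  then show "P \<in> {{z, w} |z w. z \<in> S1 \<and> w \<in> S1 \<and> z \<noteq> w}"
    using P circle_exp_eq_iff[of x2 x1] circle_exp_in by (metis (mono_tags, lifting) mem_Collect_eq)
next
  fix P assume "P \<in> {{z, w} |z w. z \<in> S1 \<and> w \<in> S1 \<and> z \<noteq> w}"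
  then obtain z w where zw: "z \<in> S1" "w \<in> S1" "z \<noteq> w" "P = {z, w}" by blast
  then obtain t s0 where t: "z = circle_exp t" and s0: "w = circle_exp s0"
    by (meson circle_exp_surj)
  define s where "s = t + frac (s0 - t)"
  have s: "w = circle_exp s" unfolding s0 circle_exp_eq_iff s_def by (simp add: frac_def)
  have "s - t \<noteq> 0" using zw t s by auto
  then have st: "0 < s - t" "s - t < 1" using frac_ge_0[of "s0 - t"] frac_lt_1[of "s0 - t"]
    by (auto simp: s_def)
  define r where "r = min (s - t) (1 - (s - t)) / 4"
  have r: "0 < r" "4 * r \<le> s - t" "4 * r \<le> 1 - (s - t)" using st by (auto simp: r_def)
  define D where "D = ball t r \<times> ball s r"
  have D: "0 < b - a'" "b - a' < 1" "\<bar>a - a'\<bar> < 1" "\<bar>b - b'\<bar> < 1"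
    if "(a, b) \<in> D" "(a', b') \<in> D" for a b a' b'
    using that r st by (auto simp: D_def dist_real_def abs_if split: if_splits)
  have "open D" by (auto simp: D_def intro: open_Times)
  moreover have "D \<subseteq> strip"
  proof clarify
    fix a b assume "(a, b) \<in> D"
    from D(1,2)[OF this this] show "(a, b) \<in> strip" by (simp add: strip_def)
  qed
  ultimately have "openin (top_of_set strip) D" by (simp add: openin_open_eq open_subset)
  moreover have "inj_on F2_cover D"
  proof (rule inj_onI, clarify)
    fix a b a' b' assume ab: "(a, b) \<in> D" "(a', b') \<in> D"
      and eq: "F2_cover (a, b) = F2_cover (a', b')"
    have nint: "x \<notin> \<int>" if "0 < x" "x < 1" for x :: real using that by (auto elim!: Ints_cases)
    have int0: "x = 0" if "x \<in> \<int>" "\<bar>x\<bar> < 1" for x :: real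
      using that by (auto elim!: Ints_cases)
    have "circle_exp b \<noteq> circle_exp a'"
      unfolding circle_exp_eq_iff using nint D(1,2)[OF ab] by blast
    then have "circle_exp a = circle_exp a'" "circle_exp b = circle_exp b'"
      using eq by (auto simp: F2_cover_def doubleton_eq_iff)
    then have "a - a' = 0" "b - b' = 0"
      using int0 D(3,4)[OF ab] unfolding circle_exp_eq_iff by blast+
    then show "a = a' \<and> b = b'" by simp
  qed
  ultimately have "(D, F2_cover) \<in> F2_atlas" by (auto simp: F2_atlas_def)
  moreover have "(t, s) \<in> interior D" using \<open>open D\<close> r by (simp add: interior_open D_def)
  moreover have "P = F2_cover (t, s)" by (simp add: F2_cover_def zw t flip: s)
  ultimately show "P \<in> mfd_interior F2_atlas" unfolding mfd_interior_def by blast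
qed

lemma mfd_boundary_F2: "mfd_boundary F2 F2_atlas = {{z} |z. z \<in> S1}"
proof (intro equalityI subsetI)
  fix P assume "P \<in> mfd_boundary F2 F2_atlas"
  then obtain z w where zw: "P = {z, w}" "z \<in> S1" "w \<in> S1" and "P \<notin> mfd_interior F2_atlas"
    unfolding mfd_boundary_def topspace_F2 F2_set_def by blast
  then have "z = w" unfolding mfd_interior_F2 by blast
  with zw show "P \<in> {{z} |z. z \<in> S1}" by blast
next
  fix P assume "P \<in> {{z} |z. z \<in> S1}"
  then obtain z where z: "P = {z}" "z \<in> S1" by blast
  have "{z} \<noteq> {u, v}" if "u \<noteq> v" for u v using that by blast
  then have "P \<notin> mfd_interior F2_atlas" unfolding mfd_interior_F2 z by blast
  moreover have "P \<in> F2_set" using F2_setI[of z z] z by simp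
  ultimately show "P \<in> mfd_boundary F2 F2_atlas" unfolding mfd_boundary_def topspace_F2 by blast
qed

definition chord :: "(complex \<Rightarrow> 'v::real_normed_vector) \<Rightarrow> complex set \<Rightarrow> real" where
  "chord \<gamma> P = (THE r. \<exists>z w. P = {z, w} \<and> r = norm (\<gamma> z - \<gamma> w))"

lemma chord_pair: "chord \<gamma> {z, w} = norm (\<gamma> z - \<gamma> w)"
  unfolding chord_def
  by (rule the_equality) (auto simp: doubleton_eq_iff norm_minus_commute)

definition half_sq_chord :: "(complex \<Rightarrow> 'v::real_normed_vector) \<Rightarrow> complex set \<Rightarrow> real" where
  "half_sq_chord \<gamma> P = (chord \<gamma> P)\<^sup>2 / 2"

subsection \<open>Embeddings of the circle and the Whitney topology\<close>

text \<open>
  A map \<open>S\<^sup>1 \<rightarrow> \<real>\<^sup>d\<close> is represented by a function that is \<open>undefined\<close> off the unit circle, and is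
  differentiated through the local diffeomorphism \<open>circle_exp\<close>.
\<close>

definition Ck_curves :: "nat \<Rightarrow> (complex \<Rightarrow> real ^ 'd) set" where
  "Ck_curves k = {\<gamma> \<in> extensional S1. Ck_open k UNIV (\<gamma> \<circ> circle_exp)}"

definition Ck_embeddings :: "nat \<Rightarrow> (complex \<Rightarrow> real ^ 'd) set" where
  "Ck_embeddings k = {\<gamma> \<in> Ck_curves k.
     inj_on \<gamma> S1 \<and>
     (\<forall>t. vector_derivative (\<gamma> \<circ> circle_exp) (at t) \<noteq> 0) \<and>
     embedding_map (top_of_set S1) euclidean \<gamma>}"

definition iterated_derivative :: "nat \<Rightarrow> (real \<Rightarrow> 'v::real_normed_vector) \<Rightarrow> real \<Rightarrow> 'v" where
  "iterated_derivative j = (\<lambda>g t. vector_derivative g (at t)) ^^ j"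

text \<open>
  The jet bundle \<open>J\<^sup>k(S\<^sup>1, \<real>\<^sup>d)\<close>, trivialised by the coordinate \<open>circle_exp\<close>, is
  \<open>S\<^sup>1 \<times> (\<real>\<^sup>d)\<^sup>k\<^sup>+\<^sup>1\<close>. The Whitney \<open>C\<^sup>k\<close>-topology has as basis the sets of all maps whose
  \<open>k\<close>-jet has image in a given open subset of the jet bundle.
\<close>

definition jet_space :: "nat \<Rightarrow> (complex \<times> (nat \<Rightarrow> real ^ 'd)) topology" where
  "jet_space k = prod_topology (top_of_set S1) (product_topology (\<lambda>_. euclidean) {..k})"

definition jet :: "nat \<Rightarrow> (complex \<Rightarrow> real ^ 'd) \<Rightarrow> real \<Rightarrow> complex \<times> (nat \<Rightarrow> real ^ 'd)" where
  "jet k \<gamma> t = (circle_exp t, \<lambda>j\<in>{..k}. iterated_derivative j (\<gamma> \<circ> circle_exp) t)"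

definition Whitney_topology :: "nat \<Rightarrow> (complex \<Rightarrow> real ^ 'd) topology" where
  "Whitney_topology k = topology_generated_by
     {{\<gamma> \<in> Ck_curves k. range (jet k \<gamma>) \<subseteq> U} |U. openin (jet_space k) U}"

definition Embedding_space :: "nat \<Rightarrow> (complex \<Rightarrow> real ^ 'd) topology" where
  "Embedding_space k = subtopology (Whitney_topology k) (Ck_embeddings k)"

lemma topspace_Whitney: "topspace (Whitney_topology k) = Ck_curves k"
proof -
  have "jet k \<gamma> t \<in> topspace (jet_space k)" for \<gamma> :: "complex \<Rightarrow> real ^ 'd" and t
    using circle_exp_in[of t] unfolding jet_def jet_space_def by simp
  then have all: "{\<gamma> \<in> Ck_curves k. range (jet k \<gamma>) \<subseteq> topspace (jet_space k)} =
      (Ck_curves k :: (complex \<Rightarrow> real ^ 'd) set)"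
    by blast
  have "topspace (Whitney_topology k) =
      \<Union>{{\<gamma> \<in> Ck_curves k. range (jet k \<gamma>) \<subseteq> U} |U. openin (jet_space k) U}"
    unfolding Whitney_topology_def by (rule topology_generated_by_topspace)
  also have "\<dots> = (Ck_curves k :: (complex \<Rightarrow> real ^ 'd) set)"
  proof
    show "(Ck_curves k :: (complex \<Rightarrow> real ^ 'd) set) \<subseteq>
        \<Union>{{\<gamma> \<in> Ck_curves k. range (jet k \<gamma>) \<subseteq> U} |U. openin (jet_space k) U}"
      by (rule Union_upper) (use all openin_topspace in \<open>blast\<close>)
  qed blast
  finally show ?thesis .
qed

lemma topspace_Embedding_space: "topspace (Embedding_space k) = Ck_embeddings k"
  unfolding Embedding_space_def topspace_subtopology topspace_Whitney Ck_embeddings_def by blast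

definition Morse_embeddings :: "nat \<Rightarrow> (complex \<Rightarrow> real ^ 'd) set" where
  "Morse_embeddings k = {\<gamma> \<in> Ck_embeddings k. Morse_supported k F2 F2_atlas (half_sq_chord \<gamma>)}"

subsection \<open>Singular homology with field coefficients and persistence modules\<close>

text \<open>
  The homology groups of \<open>HOL-Homology\<close> have integer coefficients; here the same singular simplices
  and face maps are used with coefficients in the field \<open>'k\<close>.
\<close>

type_synonym ('a, 'k) field_chain = "((nat \<Rightarrow> real) \<Rightarrow> 'a) \<Rightarrow>\<^sub>0 'k"

definition field_chains :: "nat \<Rightarrow> 'a topology \<Rightarrow> ('a, 'k::field) field_chain set" where
  "field_chains p X = {c. Poly_Mapping.keys c \<subseteq> singular_simplex_set p X}"

definition scale_chain :: "'k::field \<Rightarrow> ('a, 'k) field_chain \<Rightarrow> ('a, 'k) field_chain" where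
  "scale_chain a c = Poly_Mapping.map ((*) a) c"

definition field_boundary :: "nat \<Rightarrow> ('a, 'k::field) field_chain \<Rightarrow> ('a, 'k) field_chain" where
  "field_boundary p c = (if p = 0 then 0 else
     \<Sum>s\<in>Poly_Mapping.keys c. \<Sum>j\<le>p.
       Poly_Mapping.single (singular_face p j s) ((-1) ^ j * Poly_Mapping.lookup c s))"

definition field_cycles :: "nat \<Rightarrow> 'a topology \<Rightarrow> ('a, 'k::field) field_chain set" where
  "field_cycles p X = {c \<in> field_chains p X. field_boundary p c = 0}"

definition field_boundaries :: "nat \<Rightarrow> 'a topology \<Rightarrow> ('a, 'k::field) field_chain set" where
  "field_boundaries p X = field_boundary (Suc p) ` field_chains (Suc p) X"

definition homology_class ::
    "nat \<Rightarrow> 'a topology \<Rightarrow> ('a, 'k::field) field_chain \<Rightarrow> ('a, 'k) field_chain set" where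
  "homology_class p X z = (\<lambda>b. z + b) ` field_boundaries p X"

definition coefficient_field :: "'k::field ring" where
  "coefficient_field = \<lparr>carrier = UNIV, mult = (*), one = 1, zero = 0, add = (+)\<rparr>"

text \<open>
  The quotient space of cycles by boundaries; its elements are cosets. The ring fields \<open>mult\<close> and
  \<open>one\<close> of the record type \<open>module\<close> play no role.
\<close>

definition field_homology ::
    "nat \<Rightarrow> 'a topology \<Rightarrow> ('k::field, ('a, 'k) field_chain set) module" where
  "field_homology p X =
     \<lparr>carrier = homology_class p X ` field_cycles p X,
      mult = undefined, one = undefined,
      zero = field_boundaries p X,
      add = (\<lambda>C D. {c + d |c d. c \<in> C \<and> d \<in> D}),
      smult = (\<lambda>a C. {scale_chain a c + b |c b. c \<in> C \<and> b \<in> field_boundaries p X})\<rparr>"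

lemma lookup_scale_chain:
  "Poly_Mapping.lookup (scale_chain a c) s = a * Poly_Mapping.lookup c s"
  by (simp add: scale_chain_def Poly_Mapping.map.rep_eq when_def)

lemma scale_chain_simps:
  "scale_chain a (c + d) = scale_chain a c + scale_chain a d"
  "scale_chain (a + b) c = scale_chain a c + scale_chain b c"
  "scale_chain a (scale_chain b c) = scale_chain (a * b) c"
  "scale_chain 1 c = c" "scale_chain a 0 = 0" "scale_chain (- 1) c = - c"
  by (rule poly_mapping_eqI; simp add: lookup_scale_chain lookup_add algebra_simps)+

lemma scale_chain_sum: "scale_chain a (sum f K) = (\<Sum>x\<in>K. scale_chain a (f x))"
  by (induction K rule: infinite_finite_induct) (simp_all add: scale_chain_simps)

lemma scale_chain_single:
  "scale_chain a (Poly_Mapping.single s b) = Poly_Mapping.single s (a * b)"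
  by (rule poly_mapping_eqI) (simp add: lookup_scale_chain lookup_single when_def)

lemma field_boundary_superset:
  assumes "finite K" "Poly_Mapping.keys c \<subseteq> K" "p \<noteq> 0"
  shows "field_boundary p c = (\<Sum>s\<in>K. \<Sum>j\<le>p.
       Poly_Mapping.single (singular_face p j s) ((-1) ^ j * Poly_Mapping.lookup c s))"
  unfolding field_boundary_def using assms
  by (auto intro!: sum.mono_neutral_left simp: in_keys_iff)

lemma field_boundary_add: "field_boundary p (c + d) = field_boundary p c + field_boundary p d"
proof (cases "p = 0")
  case False
  let ?K = "Poly_Mapping.keys c \<union> Poly_Mapping.keys d"
  show ?thesis
    using False Poly_Mapping.keys_add[of c d]
    by (simp add: field_boundary_superset[of ?K] lookup_add distrib_left single_add sum.distrib)
qed (simp add: field_boundary_def)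

lemma field_boundary_scale: "field_boundary p (scale_chain a c) = scale_chain a (field_boundary p c)"
proof (cases "p = 0")
  case False
  have "Poly_Mapping.keys (scale_chain a c) \<subseteq> Poly_Mapping.keys c"
    by (auto simp: in_keys_iff lookup_scale_chain)
  then show ?thesis
    using False
    by (simp add: field_boundary_superset[of "Poly_Mapping.keys c"] lookup_scale_chain
        scale_chain_sum scale_chain_single mult.left_commute)
qed (simp add: field_boundary_def scale_chain_simps)

lemma field_chains_closed:
  "0 \<in> field_chains p X"
  "c \<in> field_chains p X \<Longrightarrow> d \<in> field_chains p X \<Longrightarrow> c + d \<in> field_chains p X"
  "c \<in> field_chains p X \<Longrightarrow> scale_chain a c \<in> field_chains p X"
proof -
  show "0 \<in> field_chains p X" by (simp add: field_chains_def)
  show "c \<in> field_chains p X \<Longrightarrow> d \<in> field_chains p X \<Longrightarrow> c + d \<in> field_chains p X"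
    unfolding field_chains_def using Poly_Mapping.keys_add[of c d] by blast
  have "Poly_Mapping.keys (scale_chain a c) \<subseteq> Poly_Mapping.keys c"
    by (auto simp: in_keys_iff lookup_scale_chain)
  then show "c \<in> field_chains p X \<Longrightarrow> scale_chain a c \<in> field_chains p X"
    unfolding field_chains_def by blast
qed

lemma field_cycles_closed:
  "0 \<in> field_cycles p X"
  "c \<in> field_cycles p X \<Longrightarrow> d \<in> field_cycles p X \<Longrightarrow> c + d \<in> field_cycles p X"
  "c \<in> field_cycles p X \<Longrightarrow> scale_chain a c \<in> field_cycles p X"
  "c \<in> field_cycles p X \<Longrightarrow> - c \<in> field_cycles p X"
proof -
  show "0 \<in> field_cycles p X"
    by (simp add: field_cycles_def field_chains_closed(1)) (simp add: field_boundary_def)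
  show "c \<in> field_cycles p X \<Longrightarrow> d \<in> field_cycles p X \<Longrightarrow> c + d \<in> field_cycles p X"
    by (simp add: field_cycles_def field_chains_closed(2) field_boundary_add)
  show scale: "c \<in> field_cycles p X \<Longrightarrow> scale_chain a c \<in> field_cycles p X" for a
    by (simp add: field_cycles_def field_chains_closed(3) field_boundary_scale scale_chain_simps(5))
  show "c \<in> field_cycles p X \<Longrightarrow> - c \<in> field_cycles p X"
    using scale[of "- 1"] by (simp add: scale_chain_simps(6))
qed

lemma field_boundaries_closed:
  "0 \<in> field_boundaries p X"
  "c \<in> field_boundaries p X \<Longrightarrow> d \<in> field_boundaries p X \<Longrightarrow> c + d \<in> field_boundaries p X"
  "c \<in> field_boundaries p X \<Longrightarrow> scale_chain a c \<in> field_boundaries p X"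
proof -
  show "0 \<in> field_boundaries p X"
    unfolding field_boundaries_def
    by (rule image_eqI[of _ _ 0]) (simp_all add: field_boundary_def field_chains_closed(1))
  show "c + d \<in> field_boundaries p X" if "c \<in> field_boundaries p X" "d \<in> field_boundaries p X"
  proof -
    from that obtain u v where uv: "u \<in> field_chains (Suc p) X" "v \<in> field_chains (Suc p) X"
      and "c = field_boundary (Suc p) u" "d = field_boundary (Suc p) v"
      unfolding field_boundaries_def by blast
    then have "c + d = field_boundary (Suc p) (u + v)" by (simp only: field_boundary_add)
    then show ?thesis
      unfolding field_boundaries_def using field_chains_closed(2)[OF uv] by (rule image_eqI)
  qed
  show "scale_chain a c \<in> field_boundaries p X" if "c \<in> field_boundaries p X"
  proof -
    from that obtain u where u: "u \<in> field_chains (Suc p) X" and "c = field_boundary (Suc p) u"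
      unfolding field_boundaries_def by blast
    then have "scale_chain a c = field_boundary (Suc p) (scale_chain a u)"
      by (simp only: field_boundary_scale)
    then show ?thesis
      unfolding field_boundaries_def using field_chains_closed(3)[OF u] by (rule image_eqI)
  qed
qed

lemma field_homology_add:
  "homology_class p X c \<oplus>\<^bsub>field_homology p X\<^esub> homology_class p X d = homology_class p X (c + d)"
proof (intro equalityI subsetI)
  fix x assume "x \<in> homology_class p X c \<oplus>\<^bsub>field_homology p X\<^esub> homology_class p X d"
  then obtain b1 b2 where b: "b1 \<in> field_boundaries p X" "b2 \<in> field_boundaries p X"
    and x: "x = (c + b1) + (d + b2)"
    by (auto simp: field_homology_def homology_class_def)
  have "x = (c + d) + (b1 + b2)" by (simp add: x ac_simps)
  then show "x \<in> homology_class p X (c + d)"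
    unfolding homology_class_def using field_boundaries_closed(2)[OF b] by blast
next
  fix x assume "x \<in> homology_class p X (c + d)"
  then obtain b where b: "b \<in> field_boundaries p X" and x: "x = (c + d) + b"
    by (auto simp: homology_class_def)
  have "x = (c + 0) + (d + b)" by (simp add: x ac_simps)
  moreover have "c + 0 \<in> homology_class p X c" "d + b \<in> homology_class p X d"
    unfolding homology_class_def using b field_boundaries_closed(1) by blast+
  ultimately show "x \<in> homology_class p X c \<oplus>\<^bsub>field_homology p X\<^esub> homology_class p X d"
    unfolding field_homology_def by (simp, blast)
qed

lemma field_homology_smult:
  "a \<odot>\<^bsub>field_homology p X\<^esub> homology_class p X c = homology_class p X (scale_chain a c)"
proof (intro equalityI subsetI)
  fix x assume "x \<in> a \<odot>\<^bsub>field_homology p X\<^esub> homology_class p X c"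
  then obtain b1 b2 where b: "b1 \<in> field_boundaries p X" "b2 \<in> field_boundaries p X"
    and x: "x = scale_chain a (c + b1) + b2"
    by (auto simp: field_homology_def homology_class_def)
  have "x = scale_chain a c + (scale_chain a b1 + b2)" by (simp add: x scale_chain_simps ac_simps)
  then show "x \<in> homology_class p X (scale_chain a c)"
    unfolding homology_class_def
    using field_boundaries_closed(2)[OF field_boundaries_closed(3)[OF b(1)] b(2)] by blast
next
  fix x assume "x \<in> homology_class p X (scale_chain a c)"
  then obtain b where b: "b \<in> field_boundaries p X" and x: "x = scale_chain a (c + 0) + b"
    by (auto simp: homology_class_def)
  moreover have "c + 0 \<in> homology_class p X c"
    unfolding homology_class_def using field_boundaries_closed(1) by blast
  ultimately show "x \<in> a \<odot>\<^bsub>field_homology p X\<^esub> homology_class p X c"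
    unfolding field_homology_def by (simp, blast)
qed

lemma field_homology_zero: "\<zero>\<^bsub>field_homology p X\<^esub> = homology_class p X 0"
  by (simp add: field_homology_def homology_class_def)

lemma field_coefficient_field: "field coefficient_field"
proof -
  have inv: "\<exists>y. x * y = 1" if "x \<noteq> 0" for x :: "'a::field"
    using that by (intro exI[of _ "inverse x"]) simp
  have neg: "\<exists>y. x + y = 0" for x :: "'a::field"
    by (intro exI[of _ "- x"]) simp
  show ?thesis
    by (unfold_locales; auto simp: coefficient_field_def Units_def distrib_left distrib_right
        add.assoc add.commute mult.assoc mult.commute inv neg)
qed

lemma vectorspace_field_homology: "vectorspace coefficient_field (field_homology p X)"
proof -
  let ?V = "field_homology p X"
  have cls: "carrier ?V = homology_class p X ` field_cycles p X"
    by (simp add: field_homology_def)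
  note simps = field_homology_add field_homology_smult field_homology_zero
  interpret K: field coefficient_field by (rule field_coefficient_field)
  have "module coefficient_field ?V"
  proof (rule module_criteria)
    show "\<forall>v\<in>carrier ?V. \<exists>w\<in>carrier ?V. v \<oplus>\<^bsub>?V\<^esub> w = \<zero>\<^bsub>?V\<^esub>"
    proof
      fix v assume "v \<in> carrier ?V"
      then obtain c where c: "c \<in> field_cycles p X" "v = homology_class p X c"
        unfolding cls by blast
      then have "v \<oplus>\<^bsub>?V\<^esub> homology_class p X (- c) = \<zero>\<^bsub>?V\<^esub>" by (simp add: simps)
      then show "\<exists>w\<in>carrier ?V. v \<oplus>\<^bsub>?V\<^esub> w = \<zero>\<^bsub>?V\<^esub>"
        unfolding cls using field_cycles_closed(4)[OF c(1)] by blast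
    qed
  qed (use K.is_cring in \<open>auto simp: cls simps coefficient_field_def scale_chain_simps
         field_cycles_closed add.assoc add.commute add.left_commute\<close>)
  then show ?thesis by (simp add: vectorspace_def field_coefficient_field)
qed

text \<open>A family \<open>V t\<close> of vector spaces with structure maps \<open>V s \<rightarrow> V t\<close> for \<open>s \<le> t\<close>.\<close>

type_synonym ('k, 'v) persistence_module =
  "(real \<Rightarrow> ('k, 'v) module) \<times> (real \<Rightarrow> real \<Rightarrow> 'v \<Rightarrow> 'v)"

definition sublevel :: "'a topology \<Rightarrow> ('a \<Rightarrow> real) \<Rightarrow> real \<Rightarrow> 'a topology" where
  "sublevel X f t = subtopology X {x \<in> topspace X. f x \<le> t}"

text \<open>The structure maps send the class of a cycle in one sublevel set to its class in the other.\<close>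

definition sublevel_persistence ::
    "nat \<Rightarrow> 'a topology \<Rightarrow> ('a \<Rightarrow> real) \<Rightarrow>
     ('k::field, ('a, 'k) field_chain set) persistence_module" where
  "sublevel_persistence i X f =
     (\<lambda>t. field_homology i (sublevel X f t),
      \<lambda>s t C. \<Union>(homology_class i (sublevel X f t) ` C))"

definition pointwise_finite_dimensional :: "('k::field, 'v) persistence_module \<Rightarrow> bool" where
  "pointwise_finite_dimensional V \<longleftrightarrow> (\<forall>t. vectorspace.fin_dim coefficient_field (fst V t))"

end

theory Submission
  imports Defs
begin

text \<open>
  Pulled back to the strip, \<open>half_sq_chord \<gamma>\<close> becomes \<open>(x, y) \<mapsto> \<parallel>g x - g y\<parallel>\<^sup>2 / 2\<close> with \<open>g = \<gamma> \<circ> circle_exp\<close>.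
  Since \<open>g\<close> is immersed, short chords are never critical, uniformly for curves \<open>C\<^sup>2\<close>-close to \<open>g\<close>; and
  shrinking short chords retracts low sublevel sets to the boundary. Hence \<open>\<gamma>\<close> is Morse-supported if and
  only if no critical chord is degenerate, a condition on a compact set of chords that is open in \<open>C\<^sup>2\<close>.

  For density, curves are perturbed near one chord by \<open>(a \<alpha> + b \<beta>) (g x0 - g y0)\<close>. A critical chord \<open>(x, y)\<close>
  determines \<open>(a, b)\<close>, and the degenerate ones are critical points of this map, so that Sard's theorem
  provides arbitrarily small good parameters. Finitely many such perturbations cover all long chords, and
  openness preserves what the earlier ones achieved.

  Nondegenerate critical points make sublevel sets locally contractible. The inclusion of a smaller into
  a larger neighbourhood then has finite rank on homology locally, hence, by Mayer--Vietoris, on compact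
  sets; applied to the whole compact sublevel set this is finite dimensionality.
\<close>

section \<open>Linear extension of integral chain operators\<close>

text \<open>Since \<open>k\<close> may be 2, no smooth Morse coordinates are used, and a critical
  level need not be a manifold. Local contractions are therefore built by hand from straight-line
  homotopies in the plane, and they work exactly at the critical level, where finiteness is least
  obvious. Density meets the same low regularity: the gradient of a chord function is only C^1, so
  Sard's theorem is applied between planes, to a map that is merely differentiable within the set of
  degenerate chords. The direction \<open>g x0 - g y0\<close> makes the two gradient equations
  independently adjustable: tilting the tangent at one end along it changes the equation of that end
  at the rate |g x0 - g y0|^2, which injectivity makes positive. Subdivision and prisms are integral
  operators given on simplices. Reading their coefficients in \<open>'k\<close> and extending
  linearly carries their identities over to field chains, which is the purpose of the operator
  below.\<close>

definition linear_extension ::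
    "(((nat \<Rightarrow> real) \<Rightarrow> 'a) \<Rightarrow> 'b chain) \<Rightarrow> ('a, 'k::field) field_chain \<Rightarrow> ('b, 'k) field_chain" where
  "linear_extension f c = (\<Sum>s\<in>Poly_Mapping.keys c.
     scale_chain (Poly_Mapping.lookup c s) (Poly_Mapping.map of_int (f s)))"

lemma linear_extension_superset:
  fixes c :: "('a, 'k::field) field_chain" and f :: "((nat \<Rightarrow> real) \<Rightarrow> 'a) \<Rightarrow> 'b chain"
  assumes "finite K" "Poly_Mapping.keys c \<subseteq> K"
  shows "linear_extension f c =
    (\<Sum>s\<in>K. scale_chain (Poly_Mapping.lookup c s) (Poly_Mapping.map of_int (f s)))"
proof -
  have z: "scale_chain 0 d = 0" for d :: "('b, 'k) field_chain"
    by (rule poly_mapping_eqI) (simp add: lookup_scale_chain)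
  show ?thesis
    unfolding linear_extension_def using assms
    by (intro sum.mono_neutral_left) (auto simp: in_keys_iff z)
qed

lemma lookup_map_of_int:
  "Poly_Mapping.lookup (Poly_Mapping.map of_int x :: _ \<Rightarrow>\<^sub>0 'k::field) t = of_int (Poly_Mapping.lookup x t)"
  by (simp add: Poly_Mapping.map.rep_eq when_def)

lemma lookup_linear_extension:
  assumes "finite K" "Poly_Mapping.keys c \<subseteq> K"
  shows "Poly_Mapping.lookup (linear_extension f c) t =
    (\<Sum>s\<in>K. Poly_Mapping.lookup c s * of_int (Poly_Mapping.lookup (f s) t))"
  by (simp add: linear_extension_superset[OF assms] lookup_sum lookup_scale_chain lookup_map_of_int)

lemma linear_extension_add: "linear_extension f (c + d) = linear_extension f c + linear_extension f d"
proof -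
  let ?K = "Poly_Mapping.keys c \<union> Poly_Mapping.keys d"
  show ?thesis
    by (rule poly_mapping_eqI)
      (simp add: lookup_add lookup_linear_extension[of ?K] Poly_Mapping.keys_add distrib_right sum.distrib)
qed

lemma linear_extension_0 [simp]: "linear_extension f 0 = 0"
  by (simp add: linear_extension_def)

lemma linear_extension_diff:
  "linear_extension f (c - d) = linear_extension f c - linear_extension f d"
  using linear_extension_add[of f "c - d" d] by (simp add: algebra_simps)

lemma linear_extension_plus_op:
  "linear_extension (\<lambda>s. f s + g s) c = linear_extension f c + linear_extension g c"
  by (rule poly_mapping_eqI)
    (simp add: lookup_add lookup_linear_extension[of "Poly_Mapping.keys c"] distrib_left sum.distrib)

lemma linear_extension_minus_op:
  "linear_extension (\<lambda>s. f s - g s) c = linear_extension f c - linear_extension g c"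
  by (rule poly_mapping_eqI)
    (simp add: lookup_minus lookup_linear_extension[of "Poly_Mapping.keys c"] right_diff_distrib sum_subtractf)

lemma linear_extension_cong:
  "(\<And>s. s \<in> Poly_Mapping.keys c \<Longrightarrow> f s = g s) \<Longrightarrow> linear_extension f c = linear_extension g c"
  unfolding linear_extension_def by (intro sum.cong) auto

lemma linear_extension_frag_of [simp]: "linear_extension frag_of c = c"
proof (rule poly_mapping_eqI)
  fix t
  have "Poly_Mapping.lookup (linear_extension frag_of c) t =
    (\<Sum>s\<in>Poly_Mapping.keys c. if s = t then Poly_Mapping.lookup c s else 0)"
    by (simp add: lookup_linear_extension[of "Poly_Mapping.keys c"] lookup_single when_def
        if_distrib cong: if_cong)
  then show "Poly_Mapping.lookup (linear_extension frag_of c) t = Poly_Mapping.lookup c t"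
    by (simp add: in_keys_iff)
qed

lemma keys_linear_extension:
  "Poly_Mapping.keys (linear_extension f c) \<subseteq> (\<Union>s\<in>Poly_Mapping.keys c. Poly_Mapping.keys (f s))"
proof
  fix t assume "t \<in> Poly_Mapping.keys (linear_extension f c)"
  then have "(\<Sum>s\<in>Poly_Mapping.keys c.
      Poly_Mapping.lookup c s * of_int (Poly_Mapping.lookup (f s) t)) \<noteq> 0"
    by (simp add: in_keys_iff lookup_linear_extension[of "Poly_Mapping.keys c"])
  then obtain s where "s \<in> Poly_Mapping.keys c" "Poly_Mapping.lookup (f s) t \<noteq> 0"
    by (metis (no_types, lifting) mult_zero_right of_int_0 sum.neutral)
  then show "t \<in> (\<Union>s\<in>Poly_Mapping.keys c. Poly_Mapping.keys (f s))"
    by (auto simp: in_keys_iff)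
qed

lemma lookup_frag_extend:
  assumes "finite K" "Poly_Mapping.keys x \<subseteq> K"
  shows "Poly_Mapping.lookup (frag_extend g x) t =
    (\<Sum>s\<in>K. Poly_Mapping.lookup x s * Poly_Mapping.lookup (g s) t)"
proof -
  have "Poly_Mapping.lookup (frag_extend g x) t =
    (\<Sum>s\<in>Poly_Mapping.keys x. Poly_Mapping.lookup x s * Poly_Mapping.lookup (g s) t)"
    by (simp add: frag_extend_def lookup_sum)
  also have "\<dots> = (\<Sum>s\<in>K. Poly_Mapping.lookup x s * Poly_Mapping.lookup (g s) t)"
    using assms by (intro sum.mono_neutral_left) (auto simp: in_keys_iff)
  finally show ?thesis .
qed

text \<open>\<open>frag_extend\<close> is the integral counterpart of
  \<open>linear_extension\<close>, so this is functoriality of the change of coefficients: an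
  identity between composites of integral operators passes to field chains.\<close>

lemma linear_extension_compose:
  "linear_extension g (linear_extension f c) = linear_extension (\<lambda>s. frag_extend g (f s)) c"
proof (rule poly_mapping_eqI)
  fix t
  let ?C = "Poly_Mapping.keys c"
  let ?K = "\<Union>s\<in>?C. Poly_Mapping.keys (f s)"
  have fin: "finite ?K" by simp
  have "Poly_Mapping.lookup (linear_extension g (linear_extension f c)) t =
    (\<Sum>u\<in>?K. (\<Sum>s\<in>?C. Poly_Mapping.lookup c s * of_int (Poly_Mapping.lookup (f s) u))
        * of_int (Poly_Mapping.lookup (g u) t))"
    by (simp add: lookup_linear_extension[OF fin keys_linear_extension]
        lookup_linear_extension[of ?C])
  also have "\<dots> = (\<Sum>s\<in>?C. \<Sum>u\<in>?K. Poly_Mapping.lookup c s *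
      of_int (Poly_Mapping.lookup (f s) u * Poly_Mapping.lookup (g u) t))"
    by (subst sum.swap) (simp add: sum_distrib_right mult.assoc)
  also have "\<dots> = (\<Sum>s\<in>?C. Poly_Mapping.lookup c s *
      of_int (Poly_Mapping.lookup (frag_extend g (f s)) t))"
  proof (rule sum.cong)
    fix s assume "s \<in> ?C"
    then have "Poly_Mapping.keys (f s) \<subseteq> ?K" by blast
    then show "(\<Sum>u\<in>?K. Poly_Mapping.lookup c s *
        of_int (Poly_Mapping.lookup (f s) u * Poly_Mapping.lookup (g u) t)) =
      Poly_Mapping.lookup c s * of_int (Poly_Mapping.lookup (frag_extend g (f s)) t)"
      by (simp add: lookup_frag_extend[OF fin] sum_distrib_left)
  qed simp
  finally show "Poly_Mapping.lookup (linear_extension g (linear_extension f c)) t =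
      Poly_Mapping.lookup (linear_extension (\<lambda>s. frag_extend g (f s)) c) t"
    by (simp add: lookup_linear_extension[of ?C])
qed

text \<open>Brings an additive operator, such as the boundary or a subdivision homotopy, into the
  form that \<open>linear_extension_compose\<close> accepts.\<close>

lemma additive_frag_extend:
  assumes "h 0 = 0" "\<And>c d. h (c - d) = h c - h d"
  shows "h x = frag_extend (\<lambda>s. h (frag_of s)) x"
proof -
  have "Poly_Mapping.keys x \<subseteq> UNIV" by simp
  then show ?thesis
    by (induction x rule: frag_induction) (simp_all add: assms frag_extend_diff)
qed

text \<open>The bridge to integral homology: the field boundary is the integral one after change of
  coefficients, so that its properties need not be proved again.\<close>

lemma field_boundary_eq:
  "field_boundary p c = linear_extension (\<lambda>s. chain_boundary p (frag_of s)) c"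
proof (cases "p = 0")
  case True
  then show ?thesis
    by (intro poly_mapping_eqI) (simp add: field_boundary_def chain_boundary_def
        lookup_linear_extension[of "Poly_Mapping.keys c"])
next
  case False
  have "(\<Sum>j\<le>p. Poly_Mapping.single (singular_face p j s) ((-1) ^ j * a)) =
      scale_chain a (Poly_Mapping.map of_int (chain_boundary p (frag_of s)))"
    for s :: "(nat \<Rightarrow> real) \<Rightarrow> 'a" and a :: 'b
    by (rule poly_mapping_eqI)
      (auto simp: False chain_boundary_of lookup_scale_chain lookup_map_of_int lookup_sum
        lookup_single when_def sum_distrib_left intro!: sum.cong)
  with False show ?thesis
    by (simp add: field_boundary_def linear_extension_def)
qed

lemma chain_boundary_eq_frag_extend:
  "chain_boundary p x = frag_extend (\<lambda>s. chain_boundary p (frag_of s)) x"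
  by (rule additive_frag_extend) (simp_all add: chain_boundary_diff)

lemma field_chainsD: "c \<in> field_chains p X \<Longrightarrow> s \<in> Poly_Mapping.keys c \<Longrightarrow> singular_simplex p X s"
  unfolding field_chains_def by blast

lemma linear_extension_field_chains:
  assumes "c \<in> field_chains p X" "\<And>s. singular_simplex p X s \<Longrightarrow> singular_chain q Y (f s)"
  shows "linear_extension f c \<in> field_chains q Y"
  using keys_linear_extension[of f c] assms unfolding field_chains_def singular_chain_def by blast

lemma field_chains_mono:
  "c \<in> field_chains p (subtopology X T) \<Longrightarrow> T \<subseteq> S \<Longrightarrow> c \<in> field_chains p (subtopology X S)"
  unfolding field_chains_def using singular_simplex_mono by fastforce

lemma field_cycles_mono:
  "c \<in> field_cycles p (subtopology X T) \<Longrightarrow> T \<subseteq> S \<Longrightarrow> c \<in> field_cycles p (subtopology X S)"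
  unfolding field_cycles_def using field_chains_mono by fastforce

lemma field_boundaries_mono:
  "c \<in> field_boundaries p (subtopology X T) \<Longrightarrow> T \<subseteq> S \<Longrightarrow> c \<in> field_boundaries p (subtopology X S)"
  unfolding field_boundaries_def using field_chains_mono by fastforce

lemma field_boundary_chains:
  assumes "c \<in> field_chains p X"
  shows "field_boundary p c \<in> field_chains (p - 1) X"
  unfolding field_boundary_eq using assms
  by (rule linear_extension_field_chains)
    (metis One_nat_def singular_chain_boundary singular_chain_of)

lemma field_boundary_0 [simp]: "field_boundary p 0 = 0"
  by (simp add: field_boundary_eq)

lemma field_boundary_diff: "field_boundary p (c - d) = field_boundary p c - field_boundary p d"
  by (simp add: field_boundary_eq linear_extension_diff)

lemma field_boundary_boundary:
  assumes "c \<in> field_chains (Suc p) X"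
  shows "field_boundary p (field_boundary (Suc p) c) = 0"
proof -
  have "frag_extend (\<lambda>s. chain_boundary p (frag_of s)) (chain_boundary (Suc p) (frag_of s)) = 0"
    if "s \<in> Poly_Mapping.keys c" for s
    using chain_boundary_boundary_alt[of p X "frag_of s"] field_chainsD[OF assms that]
    by (simp add: singular_chain_of flip: chain_boundary_eq_frag_extend)
  then have "field_boundary p (field_boundary (Suc p) c) = linear_extension (\<lambda>s. 0) c"
    unfolding field_boundary_eq linear_extension_compose by (intro linear_extension_cong)
  also have "\<dots> = 0"
    by (rule poly_mapping_eqI) (simp add: lookup_linear_extension[of "Poly_Mapping.keys c"])
  finally show ?thesis .
qed

lemma field_boundaries_cycles: "field_boundaries p X \<subseteq> field_cycles p X"
  unfolding field_boundaries_def field_cycles_def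
  using field_boundary_chains[of _ "Suc p" X] field_boundary_boundary by fastforce

subsection \<open>Chain homotopies\<close>

text \<open>On a cycle the term with \<open>h'\<close> is applied to a vanishing boundary, and what
  remains is the boundary of the extended \<open>h\<close>. The identity is asked for on simplices
  only, where it is an integral statement.\<close>

lemma chain_homotopy_extension:
  fixes c :: "('a, 'k::field) field_chain"
  assumes hom: "\<And>s. singular_simplex p X s \<Longrightarrow>
      chain_boundary (Suc p) (h s) + frag_extend h' (chain_boundary p (frag_of s)) = f s - g s"
    and h: "\<And>s. singular_simplex p X s \<Longrightarrow> singular_chain (Suc p) Y (h s)"
    and c: "c \<in> field_cycles p X"
  shows "linear_extension f c - linear_extension g c \<in> field_boundaries p Y"
proof -
  have ch: "c \<in> field_chains p X" and b: "field_boundary p c = 0"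
    using c by (auto simp: field_cycles_def)
  have "linear_extension f c - linear_extension g c = linear_extension (\<lambda>s. f s - g s) c"
    by (simp add: linear_extension_minus_op)
  also have "\<dots> = linear_extension (\<lambda>s. chain_boundary (Suc p) (h s) +
      frag_extend h' (chain_boundary p (frag_of s))) c"
    using hom field_chainsD[OF ch] by (intro linear_extension_cong) auto
  also have "\<dots> = field_boundary (Suc p) (linear_extension h c) +
      linear_extension h' (field_boundary p c)"
    by (simp add: linear_extension_plus_op field_boundary_eq linear_extension_compose
        flip: chain_boundary_eq_frag_extend)
  also have "\<dots> = field_boundary (Suc p) (linear_extension h c)" by (simp add: b)
  finally show ?thesis
    using linear_extension_field_chains[of c p X "Suc p" Y h, OF ch h]
    unfolding field_boundaries_def by blast
qed

text \<open>Iterated subdivision makes the simplices small, and its homotopy to the identity does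
  not leave the union. A simplex lying in both sets is counted in \<open>a\<close>.\<close>

lemma field_chain_split:
  fixes c :: "('a, 'k::field) field_chain"
  assumes c: "c \<in> field_cycles p (subtopology X (U \<union> V))"
    and U: "openin X U" and V: "openin X V"
  obtains a b where "a \<in> field_chains p (subtopology X U)" "b \<in> field_chains p (subtopology X V)"
    "a + b - c \<in> field_boundaries p (subtopology X (U \<union> V))"
proof -
  let ?Y = "subtopology X (U \<union> V)"
  have UV: "U \<subseteq> topspace X" "V \<subseteq> topspace X" using U V by (auto dest: openin_subset)
  have ch: "c \<in> field_chains p ?Y" using c by (simp add: field_cycles_def)
  have ex: "\<exists>n. \<forall>m\<ge>n. \<forall>f\<in>Poly_Mapping.keys ((singular_subdivision p ^^ m) (frag_of s)).
      f ` standard_simplex p \<subseteq> U \<or> f ` standard_simplex p \<subseteq> V" if "singular_simplex p ?Y s" for s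
  proof -
    have 1: "\<And>W. W \<in> {U, V} \<Longrightarrow> openin ?Y W"
      using U V by (auto simp: openin_subtopology_alt)
    have 2: "topspace ?Y \<subseteq> \<Union>{U, V}" by auto
    have 3: "singular_chain p ?Y (frag_of s)" using that by (simp add: singular_chain_of)
    obtain n where "\<And>m f. \<lbrakk>n \<le> m; f \<in> Poly_Mapping.keys ((singular_subdivision p ^^ m) (frag_of s))\<rbrakk>
                      \<Longrightarrow> \<exists>W \<in> {U, V}. f \<in> (standard_simplex p) \<rightarrow> W"
      using sufficient_iterated_singular_subdivision_exists[OF 1 2 3] by blast
    then show ?thesis by (intro exI[of _ n]) blast
  qed
  then obtain n where n: "\<And>s m f. singular_simplex p ?Y s \<Longrightarrow> m \<ge> n s \<Longrightarrow>
      f \<in> Poly_Mapping.keys ((singular_subdivision p ^^ m) (frag_of s)) \<Longrightarrow>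
      f ` standard_simplex p \<subseteq> U \<or> f ` standard_simplex p \<subseteq> V"
    by metis
  \<comment> \<open>The sum dominates each of the finitely many \<open>n s\<close>, so one number of
    subdivisions serves the whole chain.\<close>
  define m where "m = (\<Sum>s\<in>Poly_Mapping.keys c. n s)"
  have m: "n s \<le> m" if "s \<in> Poly_Mapping.keys c" for s
    unfolding m_def using that by (intro member_le_sum) auto
  obtain h where h: "\<And>p. h p 0 = (0 :: 'a chain)"
        "\<And>p c1 c2. h p (c1-c2) = h p c1 - h p c2"
        "\<And>p X c. singular_chain p X c \<Longrightarrow> singular_chain (Suc p) X (h p c)"
        "\<And>p X c. singular_chain p X c
                 \<Longrightarrow> chain_boundary (Suc p) (h p c) + h (p - Suc 0) (chain_boundary p c)
                   = (singular_subdivision p ^^ m) c - c"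
    using chain_homotopic_iterated_singular_subdivision by blast
  define d where "d = linear_extension (\<lambda>s. (singular_subdivision p ^^ m) (frag_of s)) c"
  have "d - linear_extension frag_of c \<in> field_boundaries p ?Y"
    unfolding d_def
  proof (rule chain_homotopy_extension[OF _ _ c])
    fix s assume s: "singular_simplex p ?Y s"
    then have ss: "singular_chain p ?Y (frag_of s)" by (simp add: singular_chain_of)
    show "singular_chain (Suc p) ?Y (h p (frag_of s))" using h(3)[OF ss] .
    show "chain_boundary (Suc p) (h p (frag_of s)) +
        frag_extend (\<lambda>s. h (p - Suc 0) (frag_of s)) (chain_boundary p (frag_of s)) =
        (singular_subdivision p ^^ m) (frag_of s) - frag_of s"
      using h(4)[OF ss] additive_frag_extend[of "h (p - Suc 0)" "chain_boundary p (frag_of s)"] h(1,2)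
      by simp
  qed
  then have dc: "d - c \<in> field_boundaries p ?Y" by simp
  have sd: "singular_chain p ?Y ((singular_subdivision p ^^ m) (frag_of s))"
    if "singular_simplex p ?Y s" for s
    using that
    by (induction m) (auto simp: singular_chain_of singular_chain_singular_subdivision)
  have keysd: "Poly_Mapping.keys d \<subseteq>
      {f. singular_simplex p (subtopology X U) f} \<union> {f. singular_simplex p (subtopology X V) f}"
  proof
    fix f assume "f \<in> Poly_Mapping.keys d"
    then obtain s where s: "s \<in> Poly_Mapping.keys c"
      "f \<in> Poly_Mapping.keys ((singular_subdivision p ^^ m) (frag_of s))"
      using keys_linear_extension unfolding d_def by blast
    have ss: "singular_simplex p ?Y s" using field_chainsD[OF ch s(1)] .
    have "singular_simplex p ?Y f" using sd[OF ss] s(2) unfolding singular_chain_def by blast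
    moreover have "f ` standard_simplex p \<subseteq> U \<or> f ` standard_simplex p \<subseteq> V"
      using n[OF ss m[OF s(1)] s(2)] .
    ultimately show "f \<in> {f. singular_simplex p (subtopology X U) f} \<union>
        {f. singular_simplex p (subtopology X V) f}"
      by (auto simp: singular_simplex_subtopology)
  qed
  define a where "a = linear_extension
    (\<lambda>s. if singular_simplex p (subtopology X U) s then frag_of s else 0) d"
  define b where "b = linear_extension
    (\<lambda>s. if singular_simplex p (subtopology X U) s then 0 else frag_of s) d"
  have "a + b = linear_extension frag_of d"
    unfolding a_def b_def linear_extension_plus_op[symmetric] by (intro linear_extension_cong) auto
  then have "a + b = d" by simp
  moreover have "a \<in> field_chains p (subtopology X U)"
    unfolding a_def field_chains_def using keys_linear_extension
    by (fastforce split: if_splits)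
  moreover have "b \<in> field_chains p (subtopology X V)"
  proof -
    have "Poly_Mapping.keys b \<subseteq> (\<Union>s\<in>Poly_Mapping.keys d. Poly_Mapping.keys
        (if singular_simplex p (subtopology X U) s then 0 else frag_of s))"
      unfolding b_def by (rule keys_linear_extension)
    also have "\<dots> \<subseteq> {f. singular_simplex p (subtopology X V) f}"
      using keysd by (auto split: if_splits)
    finally show ?thesis by (simp add: field_chains_def)
  qed
  ultimately show thesis using that dc by simp
qed

section \<open>Homotopy invariance\<close>

text \<open>The cycle is homologous to its image under a constant map, which is a cycle in a
  one-point space and bounds there. Degree 0 is excluded because a point has homology in it.\<close>

lemma contractible_cycle_bounds:
  assumes hom: "homotopic_with (\<lambda>_. True) X X id (\<lambda>_. a)" and a: "a \<in> topspace X"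
    and p: "1 \<le> p" and c: "singular_chain p X c" "chain_boundary p c = 0"
  shows "\<exists>d. singular_chain (Suc p) X d \<and> chain_boundary (Suc p) d = c"
proof -
  have cyc: "singular_relcycle p X {} c" using c by (simp add: singular_cycle)
  have "homotopic_with (\<lambda>h. h \<in> {} \<rightarrow> {}) X X id (\<lambda>_. a)"
    using hom by (rule homotopic_with_mono) auto
  then have 1: "singular_relboundary p X {} (chain_map p id c - chain_map p (\<lambda>_. a) c)"
    using homotopic_imp_homologous_rel_chain_maps[OF _ cyc] by (simp add: homologous_rel_def)
  have "continuous_map X (subtopology X {a}) (\<lambda>_. a)" using a by (simp add: continuous_map_in_subtopology)
  then have "singular_relcycle p (subtopology X {a}) {} (chain_map p (\<lambda>_. a) c)"
    using singular_relcycle_chain_map[OF cyc] by blast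
  moreover have top: "topspace (subtopology X {a}) = {a}" using a by auto
  ultimately have "singular_relboundary p (subtopology X {a}) {} (chain_map p (\<lambda>_. a) c)"
    by (simp only: singular_boundary_eq_cycle_singleton[OF top p])
  then have "singular_relboundary p (subtopology X (topspace X)) {} (chain_map p (\<lambda>_. a) c)"
    by (rule singular_boundary_mono[rotated]) (use a in simp)
  then have "singular_relboundary p X {} (chain_map p (\<lambda>_. a) c)" by simp
  from singular_relboundary_add[OF 1 this]
  have "singular_relboundary p X {} (chain_map p id c)" by simp
  then show ?thesis using chain_map_ident[OF c(1)] by (simp add: singular_boundary)
qed

abbreviation simplex_space :: "nat \<Rightarrow> (nat \<Rightarrow> real) topology" where
  "simplex_space p \<equiv> subtopology (powertop_real UNIV) (standard_simplex p)"

abbreviation cylinder :: "'a topology \<Rightarrow> (real \<times> 'a) topology" where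
  "cylinder X \<equiv> prod_topology (top_of_set {0..1}) X"

text \<open>The universal simplex: every singular simplex is its image under itself. The restriction
  is there because singular simplices are extensional functions.\<close>

abbreviation id_simplex :: "nat \<Rightarrow> (nat \<Rightarrow> real) \<Rightarrow> nat \<Rightarrow> real" where
  "id_simplex p \<equiv> restrict id (standard_simplex p)"

lemma singular_simplex_id: "singular_simplex p (simplex_space p) (id_simplex p)"
  unfolding singular_simplex_def using continuous_map_eq[OF continuous_map_id, of "simplex_space p" "id_simplex p"]
  by simp

text \<open>Both factors are convex, so the straight-line homotopy to \<open>(0, v)\<close> stays
  inside.\<close>

lemma cylinder_simplex_contractible:
  "\<exists>a\<in>topspace (cylinder (simplex_space p)).
     homotopic_with (\<lambda>_. True) (cylinder (simplex_space p)) (cylinder (simplex_space p)) id (\<lambda>_. a)"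
proof -
  obtain v where v: "v \<in> standard_simplex p" using nonempty_standard_simplex by blast
  let ?M = "cylinder (simplex_space p)"
  define h where "h = (\<lambda>(s::real, t::real, x). ((1 - s) * t, \<lambda>i. (1 - s) * x i + s * v i))"
  have "continuous_map (prod_topology (top_of_set {0..1}) ?M) ?M h"
    unfolding continuous_map_pairwise
  proof
    have s: "continuous_map (prod_topology (top_of_set {0..1}) ?M) euclideanreal fst"
      and t: "continuous_map (prod_topology (top_of_set {0..1}) ?M) euclideanreal (\<lambda>z. fst (snd z))"
      using continuous_map_compose[OF continuous_map_snd continuous_map_fst]
      by (auto simp: o_def intro: continuous_map_into_fulltopology continuous_map_fst)
    have x: "continuous_map (prod_topology (top_of_set {0..1}) ?M) euclideanreal (\<lambda>z. snd (snd z) i)" for i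
    proof -
      have "continuous_map (prod_topology (top_of_set {0..1}) ?M) (powertop_real UNIV) (\<lambda>z. snd (snd z))"
        using continuous_map_compose[OF continuous_map_snd continuous_map_snd]
        by (auto simp: o_def intro: continuous_map_into_fulltopology)
      then show ?thesis by (auto simp: continuous_map_componentwise_UNIV)
    qed
    have "(1 - s) * t \<in> {0..1}" if "s \<in> {0..1}" "t \<in> {0..1}" for s t :: real
      using that by (auto intro: mult_le_one)
    then show "continuous_map (prod_topology (top_of_set {0..1}) ?M) (top_of_set {0..1}) (fst \<circ> h)"
      using s t unfolding h_def o_def case_prod_unfold continuous_map_in_subtopology
      by (auto intro!: continuous_intros)
    have "(\<lambda>i. (1 - s) * x i + s * v i) \<in> standard_simplex p"
      if "s \<in> {0..1}" "x \<in> standard_simplex p" for s :: real and x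
      using that v convex_standard_simplex[of x p v s] by (auto simp: algebra_simps)
    then show "continuous_map (prod_topology (top_of_set {0..1}) ?M) (simplex_space p) (snd \<circ> h)"
      using s x unfolding h_def o_def case_prod_unfold continuous_map_in_subtopology
        continuous_map_componentwise_UNIV
      by (auto intro!: continuous_intros)
  qed
  then have "homotopic_with (\<lambda>_. True) ?M ?M id (\<lambda>_. (0, v))"
    unfolding homotopic_with_def by (intro exI[of _ h]) (auto simp: h_def)
  then show ?thesis using v by (intro bexI[of _ "(0, v)"]) auto
qed

section \<open>Prism operators and the homotopy formula\<close>

definition on_snd :: "('b \<Rightarrow> 'c) \<Rightarrow> real \<times> 'b \<Rightarrow> real \<times> 'c" where
  "on_snd s = (\<lambda>(t, x). (t, s x))"

text \<open>Here \<open>x\<close> plays the role of a triangulated cylinder over the universal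
  simplex; it is pushed forward along each simplex of \<open>c\<close>.\<close>

definition prism_op :: "nat \<Rightarrow> (real \<times> (nat \<Rightarrow> real)) chain \<Rightarrow> 'b chain \<Rightarrow> (real \<times> 'b) chain" where
  "prism_op n x c = frag_extend (\<lambda>s. chain_map (Suc n) (on_snd s) x) c"

lemma continuous_map_on_snd:
  assumes "singular_simplex p X s"
  shows "continuous_map (cylinder (simplex_space p)) (cylinder X) (on_snd s)"
proof -
  have "continuous_map (simplex_space p) X s" using assms by (simp add: singular_simplex_def)
  then have "continuous_map (cylinder (simplex_space p)) X (s \<circ> snd)"
    by (rule continuous_map_compose[OF continuous_map_snd])
  then show ?thesis
    by (auto simp: on_snd_def continuous_map_pairwise o_def case_prod_unfold continuous_map_fst)
qed

lemma prism_op_0 [simp]: "prism_op n x 0 = 0"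
  by (simp add: prism_op_def)

lemma prism_op_diff: "prism_op n x (c - d) = prism_op n x c - prism_op n x d"
  by (simp add: prism_op_def frag_extend_diff)

lemma singular_chain_prism_op:
  assumes "singular_chain (Suc n) (cylinder (simplex_space n)) x" "singular_chain n X c"
  shows "singular_chain (Suc n) (cylinder X) (prism_op n x c)"
  unfolding prism_op_def
  using assms continuous_map_on_snd
  by (intro singular_chain_extend) (auto simp: singular_chain_def[of n] intro!: singular_chain_chain_map)

text \<open>Both sides push \<open>x\<close> forward along the composite of \<open>f\<close> and
  \<open>s\<close>. The two maps agree only over the standard simplex, because
  \<open>simplex_map\<close> restricts, and that is where \<open>x\<close> lives.\<close>

lemma prism_op_natural:
  assumes x: "singular_chain (Suc n) (cylinder (simplex_space n)) x"
    and c: "singular_chain n Y c"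
  shows "chain_map (Suc n) (on_snd f) (prism_op n x c) = prism_op n x (chain_map n f c)"
  using c unfolding singular_chain_def
proof (induction c rule: frag_induction)
  case (one s)
  have "chain_map (Suc n) (on_snd f) (chain_map (Suc n) (on_snd s) x) =
      chain_map (Suc n) (on_snd f \<circ> on_snd s) x"
    by (simp add: chain_map_compose)
  also have "\<dots> = chain_map (Suc n) (on_snd (simplex_map n f s)) x"
    by (rule chain_map_eq[OF x]) (auto simp: on_snd_def simplex_map_def)
  finally show ?case by (simp add: prism_op_def)
qed (auto simp: prism_op_diff chain_map_diff)

lemma chain_map_on_snd_end:
  "chain_map n (on_snd s) (frag_of (simplex_map n (Pair t) (id_simplex n))) = frag_of (simplex_map n (Pair t) s)"
proof -
  have "simplex_map n (on_snd s) (simplex_map n (Pair t) (id_simplex n)) = simplex_map n (Pair t) s"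
    by (rule ext) (simp add: simplex_map_def on_snd_def)
  then show ?thesis by simp
qed

text \<open>The boundary formula is checked on the universal simplex alone; pushing it forward along
  \<open>s\<close> gives the general case by naturality.\<close>

lemma prism_boundary:
  assumes x: "singular_chain (Suc n) (cylinder (simplex_space n)) x"
    and y: "singular_chain (Suc (Suc n)) (cylinder (simplex_space (Suc n))) y"
    and Q: "chain_boundary (Suc (Suc n)) y =
      frag_of (simplex_map (Suc n) (Pair 1) (id_simplex (Suc n)))
      - frag_of (simplex_map (Suc n) (Pair 0) (id_simplex (Suc n)))
      - prism_op n x (chain_boundary (Suc n) (frag_of (id_simplex (Suc n))))"
    and s: "singular_simplex (Suc n) X s"
  shows "chain_boundary (Suc (Suc n)) (chain_map (Suc (Suc n)) (on_snd s) y) =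
      frag_of (simplex_map (Suc n) (Pair 1) s) - frag_of (simplex_map (Suc n) (Pair 0) s)
      - prism_op n x (chain_boundary (Suc n) (frag_of s))"
proof -
  have ii: "singular_chain (Suc n) (simplex_space (Suc n)) (frag_of (id_simplex (Suc n)))"
    by (simp add: singular_chain_of singular_simplex_id)
  have nat: "chain_map (Suc n) (on_snd s) (prism_op n x (chain_boundary (Suc n) (frag_of (id_simplex (Suc n)))))
      = prism_op n x (chain_boundary (Suc n) (frag_of s))"
    using prism_op_natural[OF x singular_chain_boundary_alt[OF ii], of s]
      chain_boundary_chain_map[OF ii, of s] singular_simplex_chain_map_id[OF s] by simp
  have "chain_boundary (Suc (Suc n)) (chain_map (Suc (Suc n)) (on_snd s) y) =
      chain_map (Suc n) (on_snd s) (chain_boundary (Suc (Suc n)) y)"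
    using chain_boundary_chain_map[OF y] by simp
  then show ?thesis by (simp only: Q chain_map_diff chain_map_on_snd_end nat)
qed

text \<open>
  The prism chains are found by acyclic models: the chain required to bound in the cylinder over the
  standard simplex is a cycle there, and that cylinder is contractible.
\<close>

lemma prism_chains:
  obtains d :: "nat \<Rightarrow> (real \<times> (nat \<Rightarrow> real)) chain" where
    "\<And>n. singular_chain (Suc n) (cylinder (simplex_space n)) (d n)"
    "\<And>X s. singular_simplex 0 X s \<Longrightarrow> chain_boundary (Suc 0) (chain_map (Suc 0) (on_snd s) (d 0)) =
      frag_of (simplex_map 0 (Pair 1) s) - frag_of (simplex_map 0 (Pair 0) s)"
    "\<And>n X s. singular_simplex (Suc n) X s \<Longrightarrow>
      chain_boundary (Suc (Suc n)) (chain_map (Suc (Suc n)) (on_snd s) (d (Suc n))) =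
      frag_of (simplex_map (Suc n) (Pair 1) s) - frag_of (simplex_map (Suc n) (Pair 0) s)
      - prism_op n (d n) (chain_boundary (Suc n) (frag_of s))"
proof -
  \<comment> \<open>The last clause, that the prism over a cycle has top minus bottom as its
    boundary, is what makes the chain to be filled in the next degree a cycle.\<close>
  define P where "P = (\<lambda>n x. singular_chain (Suc n) (cylinder (simplex_space n)) x \<and>
    (n = 0 \<longrightarrow> chain_boundary (Suc 0) x =
      frag_of (simplex_map 0 (Pair 1) (id_simplex 0)) - frag_of (simplex_map 0 (Pair 0) (id_simplex 0))) \<and>
    (\<forall>m c. singular_chain n (simplex_space m) c \<longrightarrow> chain_boundary n c = 0 \<longrightarrow>
      chain_boundary (Suc n) (prism_op n x c) = chain_map n (Pair 1) c - chain_map n (Pair 0) c))"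
  define Q where "Q = (\<lambda>n x y. chain_boundary (Suc (Suc n)) y =
      frag_of (simplex_map (Suc n) (Pair (1::real)) (id_simplex (Suc n)))
      - frag_of (simplex_map (Suc n) (Pair 0) (id_simplex (Suc n)))
      - prism_op n x (chain_boundary (Suc n) (frag_of (id_simplex (Suc n)))))"
  have pair: "continuous_map (simplex_space m) (cylinder (simplex_space m)) (Pair t)" if "t \<in> {0..1}" for m t
    using that by (auto simp: continuous_map_pairwise o_def)
  have base: "\<exists>x. P 0 x"
  proof -
    let ?v = "(\<lambda>j. if j = 0 then 1 else 0) :: nat \<Rightarrow> real"
    \<comment> \<open>The edge of the cylinder over a point. The barycentric coordinate
      \<open>u 0\<close> serves as height, so that face \<open>k\<close> sits at height
      \<open>k\<close>.\<close>
    define e where "e = restrict (\<lambda>u. (u 0, ?v)) (standard_simplex 1)"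
    have v: "?v \<in> standard_simplex 0" by (simp add: standard_simplex_0)
    have c0: "continuous_map (simplex_space 1) euclideanreal (\<lambda>u. u 0)"
      by (intro continuous_map_from_subtopology continuous_map_product_projection) simp
    have "u 0 \<in> {0..1}" if "u \<in> standard_simplex 1" for u using that by (simp add: standard_simplex_def)
    with c0 v have ce: "continuous_map (simplex_space 1) (cylinder (simplex_space 0)) (\<lambda>u. (u 0, ?v))"
      by (auto simp: continuous_map_pairwise o_def continuous_map_in_subtopology)
    have "continuous_map (simplex_space 1) (cylinder (simplex_space 0)) e"
      by (rule continuous_map_eq[OF ce]) (simp add: e_def)
    then have "singular_simplex 1 (cylinder (simplex_space 0)) e"
      by (simp add: singular_simplex_def e_def)
    then have e: "singular_chain (Suc 0) (cylinder (simplex_space 0)) (frag_of e)"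
      by (simp add: singular_chain_of)
    have mem: "simplical_face k ?v \<in> standard_simplex 1" if "k \<le> 1" for k
      using simplical_face_in_standard_simplex[of 1 k ?v] that v by simp
    have f: "singular_face (Suc 0) k e = simplex_map 0 (Pair (real k)) (id_simplex 0)" if k: "k \<le> 1" for k
    proof
      fix u :: "nat \<Rightarrow> real"
      show "singular_face (Suc 0) k e u = simplex_map 0 (Pair (real k)) (id_simplex 0) u"
      proof (cases "u = ?v")
        case True
        have "simplical_face k ?v 0 = real k" using k by (cases "k = 0") (auto simp: simplical_face_def)
        then show ?thesis using mem[OF k] v True
          by (simp add: singular_face_def simplex_map_def e_def del: One_nat_def)
      qed (simp add: singular_face_def simplex_map_def standard_simplex_0)
    qed
    have f0: "singular_face (Suc 0) 0 e = simplex_map 0 (Pair 0) (id_simplex 0)"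
      and f1: "singular_face (Suc 0) (Suc 0) e = simplex_map 0 (Pair 1) (id_simplex 0)"
      using f[of 0] f[of 1] by simp_all
    \<comment> \<open>The boundary of an edge is face 0 minus face 1, here bottom minus top; the
      sign of the witness corrects this.\<close>
    have be: "chain_boundary (Suc 0) (- frag_of e) =
      frag_of (simplex_map 0 (Pair 1) (id_simplex 0)) - frag_of (simplex_map 0 (Pair 0) (id_simplex 0))"
      by (simp add: chain_boundary_minus chain_boundary_of f0 f1)
    have bs: "chain_boundary (Suc 0) (chain_map (Suc 0) (on_snd s) (- frag_of e)) =
      frag_of (simplex_map 0 (Pair 1) s) - frag_of (simplex_map 0 (Pair 0) s)" for s :: "_ \<Rightarrow> nat \<Rightarrow> real"
      using chain_boundary_chain_map[of "Suc 0" _ "- frag_of e" "on_snd s"] e be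
      by (simp add: singular_chain_minus chain_map_diff chain_map_on_snd_end del: chain_map_of)
    have "chain_boundary (Suc 0) (prism_op 0 (- frag_of e) c) = chain_map 0 (Pair 1) c - chain_map 0 (Pair 0) c"
      if "singular_chain 0 (simplex_space m) c" for m c
      using that unfolding singular_chain_def
      by (induction c rule: frag_induction)
        (auto simp: prism_op_def bs frag_extend_diff chain_boundary_diff chain_map_diff)
    then show ?thesis
      unfolding P_def using e be by (intro exI[of _ "- frag_of e"]) (auto simp: singular_chain_minus)
  qed
  have step: "\<exists>y. P (Suc n) y \<and> Q n x y" if x: "P n x" for n x
  proof -
    let ?i = "frag_of (id_simplex (Suc n))"
    let ?M = "cylinder (simplex_space (Suc n))"
    \<comment> \<open>The chain that the next prism has to bound. The boundaries of its two ends
      cancel against that of the prism over the boundary, by the last clause of \<open>P n x\<close>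
      for the cycle \<open>chain_boundary (Suc n) ?i\<close>.\<close>
    define r where "r = chain_map (Suc n) (Pair 1) ?i - chain_map (Suc n) (Pair 0) ?i
      - prism_op n x (chain_boundary (Suc n) ?i)"
    have xs: "singular_chain (Suc n) (cylinder (simplex_space n)) x" using x by (simp add: P_def)
    have ii: "singular_chain (Suc n) (simplex_space (Suc n)) ?i"
      by (simp add: singular_chain_of singular_simplex_id)
    note bi = singular_chain_boundary_alt[OF ii]
    have rs: "singular_chain (Suc n) ?M r"
      unfolding r_def
      by (intro singular_chain_diff singular_chain_prism_op[OF xs bi] singular_chain_chain_map[OF ii] pair) auto
    have "chain_boundary (Suc n) r = 0"
    proof -
      have "chain_boundary n (chain_boundary (Suc n) ?i) = 0"
        using chain_boundary_boundary_alt[OF ii] .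
      then have "chain_boundary (Suc n) (prism_op n x (chain_boundary (Suc n) ?i)) =
        chain_map n (Pair 1) (chain_boundary (Suc n) ?i) - chain_map n (Pair 0) (chain_boundary (Suc n) ?i)"
        using x bi unfolding P_def by blast
      then show ?thesis
        using chain_boundary_chain_map[OF ii, of "Pair (1::real)"] chain_boundary_chain_map[OF ii, of "Pair (0::real)"]
        by (simp add: r_def chain_boundary_diff del: chain_map_of)
    qed
    then obtain y where y: "singular_chain (Suc (Suc n)) ?M y" "chain_boundary (Suc (Suc n)) y = r"
      using cylinder_simplex_contractible[of "Suc n"] contractible_cycle_bounds[of ?M _ "Suc n" r] rs by auto
    have Q: "Q n x y" using y by (simp add: Q_def r_def)
    have "chain_boundary (Suc (Suc n)) (prism_op (Suc n) y c) =
        chain_map (Suc n) (Pair 1) c - chain_map (Suc n) (Pair 0) c - prism_op n x (chain_boundary (Suc n) c)"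
      if "singular_chain (Suc n) (simplex_space m) c" for m c
      using that unfolding singular_chain_def
    proof (induction c rule: frag_induction)
      case (one s)
      then show ?case
        using prism_boundary[OF xs y(1) Q[unfolded Q_def], of "simplex_space m" s] by (simp add: prism_op_def)
    qed (auto simp: prism_op_diff chain_boundary_diff chain_map_diff)
    then have "P (Suc n) y" using y by (auto simp: P_def)
    with Q show ?thesis by blast
  qed
  obtain d where d: "\<And>n. P n (d n)" "\<And>n. Q n (d n) (d (Suc n))"
    using dependent_nat_choice[of P Q, OF base step] by blast
  show thesis
  proof
    show ds: "singular_chain (Suc n) (cylinder (simplex_space n)) (d n)" for n using d(1)[of n] by (simp add: P_def)
    show "chain_boundary (Suc 0) (chain_map (Suc 0) (on_snd s) (d 0)) =
      frag_of (simplex_map 0 (Pair 1) s) - frag_of (simplex_map 0 (Pair 0) s)" if "singular_simplex 0 X s"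
      for X and s :: "(nat \<Rightarrow> real) \<Rightarrow> 'z"
    proof -
      have "chain_boundary (Suc 0) (chain_map (Suc 0) (on_snd s) (d 0)) =
          chain_map 0 (on_snd s) (chain_boundary (Suc 0) (d 0))"
        using chain_boundary_chain_map[OF ds[of 0], of "on_snd s"] by simp
      also have "\<dots> = frag_of (simplex_map 0 (Pair 1) s) - frag_of (simplex_map 0 (Pair 0) s)"
        using d(1)[of 0] by (simp add: P_def chain_map_diff chain_map_on_snd_end del: chain_map_of)
      finally show ?thesis .
    qed
    show "chain_boundary (Suc (Suc n)) (chain_map (Suc (Suc n)) (on_snd s) (d (Suc n))) =
      frag_of (simplex_map (Suc n) (Pair 1) s) - frag_of (simplex_map (Suc n) (Pair 0) s)
      - prism_op n (d n) (chain_boundary (Suc n) (frag_of s))" if "singular_simplex (Suc n) X s" for n X s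
      using prism_boundary[OF ds ds d(2)[unfolded Q_def] that] .
  qed
qed

text \<open>Pushing the prism over each simplex forward along the homotopy gives a chain homotopy
  whose two ends are the images under \<open>f\<close> and \<open>g\<close>.\<close>

lemma field_homotopy:
  fixes c :: "('a, 'k::field) field_chain"
  assumes hom: "homotopic_with (\<lambda>_. True) X Y f g" and c: "c \<in> field_cycles p X"
  shows "linear_extension (\<lambda>s. frag_of (simplex_map p g s)) c
    - linear_extension (\<lambda>s. frag_of (simplex_map p f s)) c \<in> field_boundaries p Y"
proof -
  obtain H where H: "continuous_map (cylinder X) Y H" "\<And>x. H (0, x) = f x" "\<And>x. H (1, x) = g x"
    using hom unfolding homotopic_with_def by auto
  have Hp: "H \<circ> Pair 0 = f" "H \<circ> Pair 1 = g" using H by auto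
  obtain d where d: "\<And>n. singular_chain (Suc n) (cylinder (simplex_space n)) (d n)"
    "\<And>X s. singular_simplex 0 X s \<Longrightarrow> chain_boundary (Suc 0) (chain_map (Suc 0) (on_snd s) (d 0)) =
      frag_of (simplex_map 0 (Pair 1) s) - frag_of (simplex_map 0 (Pair 0) (s :: _ \<Rightarrow> 'a))"
    "\<And>n X s. singular_simplex (Suc n) X s \<Longrightarrow>
      chain_boundary (Suc (Suc n)) (chain_map (Suc (Suc n)) (on_snd s) (d (Suc n))) =
      frag_of (simplex_map (Suc n) (Pair 1) s) - frag_of (simplex_map (Suc n) (Pair 0) (s :: _ \<Rightarrow> 'a))
      - prism_op n (d n) (chain_boundary (Suc n) (frag_of s))"
    by (rule prism_chains) blast
  define h where "h = (\<lambda>p s. chain_map (Suc p) H (chain_map (Suc p) (on_snd s) (d p)))"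
  have lift: "singular_chain (Suc p) (cylinder X) (chain_map (Suc p) (on_snd s) (d p))"
    if "singular_simplex p X s" for p s
    by (rule singular_chain_chain_map[OF d(1) continuous_map_on_snd[OF that]])
  have op: "frag_extend (h n) b = chain_map (Suc n) H (prism_op n (d n) b)" for n b
  proof -
    have "Poly_Mapping.keys b \<subseteq> UNIV" by simp
    then show ?thesis
      by (induction b rule: frag_induction) (simp_all add: frag_extend_diff prism_op_diff chain_map_diff,
          simp add: prism_op_def h_def)
  qed
  have "simplex_map p H (simplex_map p (Pair 1) s) = simplex_map p g s"
    "simplex_map p H (simplex_map p (Pair 0) s) = simplex_map p f s" for s
    by (metis Hp comp_apply simplex_map_compose)+
  then have comp: "chain_map p H (frag_of (simplex_map p (Pair 1) s)) = frag_of (simplex_map p g s)"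
    "chain_map p H (frag_of (simplex_map p (Pair 0) s)) = frag_of (simplex_map p f s)" for s
    by simp_all
  \<comment> \<open>For \<open>p = 0\<close> the index \<open>p - 1\<close> is again 0; this is
    harmless because \<open>chain_boundary 0\<close> vanishes.\<close>
  have "chain_boundary (Suc p) (h p s) + frag_extend (h (p - 1)) (chain_boundary p (frag_of s)) =
      frag_of (simplex_map p g s) - frag_of (simplex_map p f s)" if s: "singular_simplex p X s" for s
  proof -
    have "chain_boundary (Suc p) (h p s) =
        chain_map p H (chain_boundary (Suc p) (chain_map (Suc p) (on_snd s) (d p)))"
      using chain_boundary_chain_map[OF lift[OF s], of H] by (simp add: h_def)
    then show ?thesis
    proof (cases p)
      case 0
      then show ?thesis
        using \<open>chain_boundary (Suc p) (h p s) = _\<close> d(2) s comp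
        by (simp add: chain_map_diff chain_boundary_def[of 0] del: chain_map_of)
    next
      case (Suc n)
      then show ?thesis
        using \<open>chain_boundary (Suc p) (h p s) = _\<close> d(3) s comp
        by (simp add: chain_map_diff op del: chain_map_of)
    qed
  qed
  then show ?thesis
    by (rule chain_homotopy_extension[OF _ _ c]) (use lift singular_chain_chain_map[OF _ H(1)] in \<open>auto simp: h_def\<close>)
qed

section \<open>Finite rank of inclusions\<close>

interpretation chains: vector_space "scale_chain :: 'k::field \<Rightarrow> ('a, 'k) field_chain \<Rightarrow> ('a, 'k) field_chain"
  by unfold_locales (simp_all add: scale_chain_simps)

lemma subspace_field_chains: "chains.subspace (field_chains p X)"
  unfolding chains.subspace_def using field_chains_closed by blast

lemma subspace_field_cycles: "chains.subspace (field_cycles p X)"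
  unfolding chains.subspace_def using field_cycles_closed by blast

lemma subspace_field_boundaries: "chains.subspace (field_boundaries p X)"
  unfolding chains.subspace_def using field_boundaries_closed by blast

lemma span_Un_subspace:
  assumes "chains.subspace B"
  shows "x \<in> chains.span (F \<union> B) \<longleftrightarrow> (\<exists>u\<in>chains.span F. \<exists>b\<in>B. x = u + b)"
proof -
  have B: "chains.span B = B" using assms chains.span_eq_iff by blast
  show ?thesis unfolding chains.span_Un B by blast
qed

text \<open>A subspace of a finite-dimensional quotient is finite dimensional. The point is that the
  new generators lie in \<open>S\<close> itself: if \<open>f\<close> contributes to \<open>S\<close>
  modulo the rest, an element \<open>s0\<close> of \<open>S\<close> takes its place.\<close>

lemma finite_spanning_subset_mod:
  assumes "finite F" "chains.subspace S" "S \<subseteq> chains.span (F \<union> B)"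
  shows "\<exists>F'. finite F' \<and> F' \<subseteq> S \<and> S \<subseteq> chains.span (F' \<union> B)"
  using assms
proof (induction F arbitrary: S rule: finite_induct)
  case empty
  then show ?case by (intro exI[of _ "{}"]) auto
next
  case (insert f F)
  show ?case
  proof (cases "S \<subseteq> chains.span (F \<union> B)")
    case True
    then show ?thesis using insert.IH insert.prems by blast
  next
    case False
    then obtain s0 where s0: "s0 \<in> S" "s0 \<notin> chains.span (F \<union> B)" by blast
    have dec: "\<exists>k. s - scale_chain k f \<in> chains.span (F \<union> B)" if "s \<in> S" for s
      using that insert.prems(2) chains.span_breakdown_eq[of s f "F \<union> B"] by auto
    obtain k where k: "s0 - scale_chain k f \<in> chains.span (F \<union> B)" using dec[OF s0(1)] by blast
    have k0: "k \<noteq> 0" using k s0 by auto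
    let ?S = "S \<inter> chains.span (F \<union> B)"
    have "chains.subspace ?S" using insert.prems(1) by (intro chains.subspace_inter) auto
    then obtain F' where F': "finite F'" "F' \<subseteq> ?S" "?S \<subseteq> chains.span (F' \<union> B)"
      using insert.IH[of ?S] by blast
    have "s \<in> chains.span (insert s0 F' \<union> B)" if s: "s \<in> S" for s
    proof -
      obtain j where j: "s - scale_chain j f \<in> chains.span (F \<union> B)" using dec[OF s] by blast
      \<comment> \<open>\<open>s0\<close> has the nonzero coefficient \<open>k\<close> at
        \<open>f\<close>, so this multiple of it removes the \<open>f\<close>-part of
        \<open>s\<close>.\<close>
      have eq: "s - scale_chain (j / k) s0 = (s - scale_chain j f) - scale_chain (j / k) (s0 - scale_chain k f)"
        using k0 by (simp add: chains.scale_right_diff_distrib)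
      have "s - scale_chain (j / k) s0 \<in> chains.span (F \<union> B)"
        unfolding eq by (rule chains.span_diff[OF j chains.span_scale[OF k]])
      moreover have "s - scale_chain (j / k) s0 \<in> S"
        using chains.subspace_diff[OF insert.prems(1) s chains.subspace_scale[OF insert.prems(1) s0(1)]] .
      ultimately have "s - scale_chain (j / k) s0 \<in> ?S" by blast
      then have "s - scale_chain (j / k) s0 \<in> chains.span (F' \<union> B)" using F' by blast
      then show ?thesis using chains.span_breakdown_eq[of s s0 "F' \<union> B"] by auto
    qed
    then show ?thesis using F' s0 by (intro exI[of _ "insert s0 F'"]) auto
  qed
qed

text \<open>
  \<open>finite_rank TYPE('k) p X U W\<close>: the map induced by \<open>U \<subseteq> W\<close> on \<open>p\<close>-th homology over the field \<open>'k\<close>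
  has finite rank.
\<close>

definition finite_rank :: "'k::field itself \<Rightarrow> nat \<Rightarrow> 'a topology \<Rightarrow> 'a set \<Rightarrow> 'a set \<Rightarrow> bool" where
  "finite_rank _ p X U W \<longleftrightarrow> (\<exists>F :: ('a, 'k) field_chain set. finite F \<and>
     field_cycles p (subtopology X U) \<subseteq> chains.span (F \<union> field_boundaries p (subtopology X W)))"

lemma finite_rank_mono:
  assumes "finite_rank TYPE('k::field) p X U W" "U' \<subseteq> U" "W \<subseteq> W'"
  shows "finite_rank TYPE('k) p X U' W'"
proof -
  obtain F :: "('a, 'k) field_chain set" where F: "finite F"
    "field_cycles p (subtopology X U) \<subseteq> chains.span (F \<union> field_boundaries p (subtopology X W))"
    using assms(1) unfolding finite_rank_def by blast
  have "F \<union> field_boundaries p (subtopology X W) \<subseteq> F \<union> field_boundaries p (subtopology X W')"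
    using field_boundaries_mono[OF _ assms(3)] by blast
  from chains.span_mono[OF this] F field_cycles_mono[OF _ assms(2)] show ?thesis
    unfolding finite_rank_def by blast
qed

lemma finite_rank_empty: "finite_rank TYPE('k::field) p X {} W"
proof -
  have "c = 0" if "c \<in> field_cycles p (subtopology X {})" for c :: "('a, 'k) field_chain"
  proof -
    have "topspace (subtopology X {}) = {}" by simp
    then have "Poly_Mapping.keys c = {}"
      using that singular_simplex_empty unfolding field_cycles_def field_chains_def by blast
    then show ?thesis by simp
  qed
  then have "field_cycles p (subtopology X {}) \<subseteq>
      chains.span ({} \<union> field_boundaries p (subtopology X W) :: ('a, 'k) field_chain set)"
    using chains.span_zero by blast
  then show ?thesis unfolding finite_rank_def by blast
qed

text \<open>Homotopy invariance replaces every simplex by the one constant simplex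
  \<open>?\<kappa>\<close>, so a single generator suffices in every degree.\<close>

lemma finite_rank_nullhomotopic:
  assumes hom: "homotopic_with (\<lambda>_. True) (subtopology X U) (subtopology X W) id (\<lambda>_. a)"
  shows "finite_rank TYPE('k::field) p X U W"
proof -
  let ?\<kappa> = "restrict (\<lambda>_. a) (standard_simplex p)"
  let ?f = "Poly_Mapping.map of_int (frag_of ?\<kappa>) :: ('a, 'k) field_chain"
  have "c \<in> chains.span ({?f} \<union> field_boundaries p (subtopology X W))"
    if c: "c \<in> field_cycles p (subtopology X U)" for c :: "('a, 'k) field_chain"
  proof -
    have ch: "c \<in> field_chains p (subtopology X U)" using c by (simp add: field_cycles_def)
    have "linear_extension (\<lambda>s. frag_of (simplex_map p id s)) c = linear_extension frag_of c"
      using field_chainsD[OF ch] by (intro linear_extension_cong)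
        (simp add: singular_simplex_def extensional_restrict)
    moreover have "linear_extension (\<lambda>s. frag_of (simplex_map p (\<lambda>_. a) s)) c \<in> chains.span {?f}"
      unfolding linear_extension_def simplex_map_def o_def
      by (intro chains.span_sum chains.span_scale chains.span_base) simp
    ultimately obtain b e where "b \<in> field_boundaries p (subtopology X W)" "e \<in> chains.span {?f}" "e - c = b"
      using field_homotopy[OF hom c] by simp
    then have "c = e + (- b)" "- b \<in> field_boundaries p (subtopology X W)"
      using chains.subspace_neg[OF subspace_field_boundaries] by auto
    then show ?thesis using \<open>e \<in> _\<close> span_Un_subspace[OF subspace_field_boundaries] by blast
  qed
  then show ?thesis unfolding finite_rank_def by (intro exI[of _ "{?f}"]) auto
qed

text \<open>
  The connecting homomorphism of the Mayer--Vietoris sequence sends the class of \<open>a + b\<close> to that of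
  \<open>\<partial> a\<close>; modulo finitely many cycles it vanishes in \<open>U1 \<inter> U2\<close>, and then the cycle splits into cycles
  of \<open>U1\<close> and \<open>U2\<close>.
\<close>

lemma finite_rank_union:
  assumes V: "openin X V1" "openin X V2" and VU: "V1 \<subseteq> U1" "V2 \<subseteq> U2" "U1 \<subseteq> W" "U2 \<subseteq> W"
    and fr: "finite_rank TYPE('k::field) p X U1 W" "finite_rank TYPE('k) p X U2 W"
    and frI: "p > 0 \<Longrightarrow> finite_rank TYPE('k) (p - 1) X (V1 \<inter> V2) (U1 \<inter> U2)"
  shows "finite_rank TYPE('k) p X (V1 \<union> V2) W"
proof -
  define B :: "('a, 'k) field_chain set" where "B = field_boundaries p (subtopology X W)"
  have sB: "chains.subspace B" unfolding B_def by (rule subspace_field_boundaries)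
  obtain F1 :: "('a, 'k) field_chain set" where F1: "finite F1"
    "field_cycles p (subtopology X U1) \<subseteq> chains.span (F1 \<union> B)"
    using fr(1) unfolding finite_rank_def B_def by blast
  obtain F2 :: "('a, 'k) field_chain set" where F2: "finite F2"
    "field_cycles p (subtopology X U2) \<subseteq> chains.span (F2 \<union> B)"
    using fr(2) unfolding finite_rank_def B_def by blast
  \<comment> \<open>The image of the connecting homomorphism on chains: boundaries of the first
    halves of cycles \<open>a + b\<close>.\<close>
  define E :: "('a, 'k) field_chain set" where "E = {e. \<exists>a b. a \<in> field_chains p (subtopology X V1) \<and>
      b \<in> field_chains p (subtopology X V2) \<and> field_boundary p a = e \<and> field_boundary p b = - e}"
  \<comment> \<open>Written with \<open>field_boundary p\<close> rather than as the boundaries of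
    degree \<open>p - 1\<close>, so that it makes sense for \<open>p = 0\<close>, where it is
    zero.\<close>
  define BI :: "('a, 'k) field_chain set" where
    "BI = field_boundary p ` field_chains p (subtopology X (U1 \<inter> U2))"
  have sBI: "chains.subspace BI"
  proof (cases p)
    case 0
    then have "BI = {0}" unfolding BI_def using field_chains_closed(1)
      by (auto simp: field_boundary_def image_iff)
    then show ?thesis by simp
  next
    case (Suc q)
    then show ?thesis
      using subspace_field_boundaries[of q "subtopology X (U1 \<inter> U2)"] by (simp add: BI_def field_boundaries_def)
  qed
  have "\<exists>F. finite F \<and> E \<subseteq> chains.span (F \<union> BI)"
  proof (cases p)
    case 0
    then have "E \<subseteq> {0}" by (auto simp: E_def field_boundary_def)
    then show ?thesis using chains.span_zero by (intro exI[of _ "{}"]) auto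
  next
    case (Suc q)
    have "E \<subseteq> field_cycles q (subtopology X (V1 \<inter> V2))"
    proof
      fix e assume "e \<in> E"
      then obtain a b where ab: "a \<in> field_chains p (subtopology X V1)" "b \<in> field_chains p (subtopology X V2)"
        "field_boundary p a = e" "field_boundary p b = - e" by (auto simp: E_def)
      have "e \<in> field_chains q (subtopology X V1)" using field_boundary_chains[OF ab(1)] ab Suc by simp
      moreover have "- e \<in> field_chains q (subtopology X V2)" using field_boundary_chains[OF ab(2)] ab Suc by simp
      then have "e \<in> field_chains q (subtopology X V2)"
        using chains.subspace_neg[OF subspace_field_chains] by fastforce
      ultimately have "e \<in> field_chains q (subtopology X (V1 \<inter> V2))"
        by (auto simp: field_chains_def singular_simplex_subtopology subset_eq)
      moreover have "field_boundary q e = 0" using field_boundary_boundary ab Suc by blast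
      ultimately show "e \<in> field_cycles q (subtopology X (V1 \<inter> V2))" by (simp add: field_cycles_def)
    qed
    then show ?thesis using frI Suc unfolding finite_rank_def BI_def field_boundaries_def by fastforce
  qed
  then obtain F where F: "finite F" "E \<subseteq> chains.span (F \<union> BI)" by blast
  have sE: "chains.subspace E"
    unfolding chains.subspace_def
  proof (intro conjI ballI allI)
    show "0 \<in> E" unfolding E_def using field_chains_closed(1) by (auto intro!: exI[of _ 0])
    show "x + y \<in> E" if "x \<in> E" "y \<in> E" for x y
    proof -
      from that obtain a b a' b' where
        "a \<in> field_chains p (subtopology X V1)" "b \<in> field_chains p (subtopology X V2)"
        "field_boundary p a = x" "field_boundary p b = - x"
        "a' \<in> field_chains p (subtopology X V1)" "b' \<in> field_chains p (subtopology X V2)"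
        "field_boundary p a' = y" "field_boundary p b' = - y" unfolding E_def by blast
      then show ?thesis unfolding E_def
        by (intro CollectI exI[of _ "a + a'"] exI[of _ "b + b'"])
          (simp add: field_chains_closed field_boundary_add)
    qed
    show "scale_chain k x \<in> E" if "x \<in> E" for k x
    proof -
      from that obtain a b where
        "a \<in> field_chains p (subtopology X V1)" "b \<in> field_chains p (subtopology X V2)"
        "field_boundary p a = x" "field_boundary p b = - x" unfolding E_def by blast
      then show ?thesis unfolding E_def
        by (intro CollectI exI[of _ "scale_chain k a"] exI[of _ "scale_chain k b"])
          (simp add: field_chains_closed field_boundary_scale)
    qed
  qed
  \<comment> \<open>Generators inside \<open>E\<close> are essential here: each of them is realised
    by a cycle of the union, whose halves are chosen next.\<close>
  obtain F' where F': "finite F'" "F' \<subseteq> E" "E \<subseteq> chains.span (F' \<union> BI)"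
    using finite_spanning_subset_mod[OF F(1) sE F(2)] by blast
  have "\<forall>e\<in>F'. \<exists>a b. a \<in> field_chains p (subtopology X V1) \<and>
      b \<in> field_chains p (subtopology X V2) \<and> field_boundary p a = e \<and> field_boundary p b = - e"
    using F'(2) unfolding E_def by blast
  then obtain \<alpha> \<beta> where \<alpha>\<beta>: "\<And>e. e \<in> F' \<Longrightarrow> \<alpha> e \<in> field_chains p (subtopology X V1)"
    "\<And>e. e \<in> F' \<Longrightarrow> \<beta> e \<in> field_chains p (subtopology X V2)"
    "\<And>e. e \<in> F' \<Longrightarrow> field_boundary p (\<alpha> e) = e" "\<And>e. e \<in> F' \<Longrightarrow> field_boundary p (\<beta> e) = - e"
    by metis
  define G where "G = (\<lambda>e. \<alpha> e + \<beta> e) ` F'"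
  have lift: "\<exists>a\<in>field_chains p (subtopology X V1). \<exists>b\<in>field_chains p (subtopology X V2).
      field_boundary p a = e \<and> field_boundary p b = - e \<and> a + b \<in> chains.span G" if "e \<in> chains.span F'" for e
    using that
  proof (induction rule: chains.span_induct_alt)
    case base
    show ?case using field_chains_closed(1) chains.span_zero by (intro bexI[of _ 0]) auto
  next
    case (step k x y)
    then obtain a b where ab: "a \<in> field_chains p (subtopology X V1)" "b \<in> field_chains p (subtopology X V2)"
      "field_boundary p a = y" "field_boundary p b = - y" "a + b \<in> chains.span G" by blast
    have "scale_chain k (\<alpha> x) + a + (scale_chain k (\<beta> x) + b) = scale_chain k (\<alpha> x + \<beta> x) + (a + b)"
      by (simp add: scale_chain_simps ac_simps)
    also have "\<dots> \<in> chains.span G"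
    proof (rule chains.span_add)
      have "\<alpha> x + \<beta> x \<in> G" using step(1) by (simp add: G_def)
      then show "scale_chain k (\<alpha> x + \<beta> x) \<in> chains.span G"
        by (intro chains.span_scale chains.span_base)
    qed (rule ab)
    finally have "scale_chain k (\<alpha> x) + a + (scale_chain k (\<beta> x) + b) \<in> chains.span G" .
    moreover have "scale_chain k (- x) = - scale_chain k x" by simp
    ultimately show ?case using ab step(1) \<alpha>\<beta>[of x]
      by (intro bexI[of _ "scale_chain k (\<alpha> x) + a"] bexI[of _ "scale_chain k (\<beta> x) + b"])
        (simp_all add: field_boundary_add field_boundary_scale field_chains_closed)
  qed
  have "c \<in> chains.span ((F1 \<union> F2 \<union> G) \<union> B)" (is "c \<in> ?T")
    if c: "c \<in> field_cycles p (subtopology X (V1 \<union> V2))" for c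
  proof -
    have subT: "chains.span (F1 \<union> B) \<subseteq> ?T" "chains.span (F2 \<union> B) \<subseteq> ?T" "chains.span G \<subseteq> ?T" "B \<subseteq> ?T"
      by (intro chains.span_mono, blast)+ (auto intro: chains.span_base)
    obtain a b where ab: "a \<in> field_chains p (subtopology X V1)" "b \<in> field_chains p (subtopology X V2)"
      "a + b - c \<in> field_boundaries p (subtopology X (V1 \<union> V2))"
      using field_chain_split[OF c V] by blast
    have "a + b - c \<in> field_cycles p (subtopology X (V1 \<union> V2))"
      using field_boundaries_cycles ab by blast
    then have "field_boundary p a + field_boundary p b = 0"
      using c by (simp add: field_cycles_def field_boundary_diff field_boundary_add)
    then have eb: "field_boundary p b = - field_boundary p a" by (simp add: eq_neg_iff_add_eq_0 add.commute)
    then have "field_boundary p a \<in> E" using ab unfolding E_def by blast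
    then have "field_boundary p a \<in> chains.span (F' \<union> BI)" using F'(3) by blast
    then obtain e u where e: "e \<in> chains.span F'" and u: "u \<in> field_chains p (subtopology X (U1 \<inter> U2))"
      "field_boundary p a = e + field_boundary p u"
      using span_Un_subspace[OF sBI] unfolding BI_def by blast
    obtain a' b' where ab': "a' \<in> field_chains p (subtopology X V1)" "b' \<in> field_chains p (subtopology X V2)"
      "field_boundary p a' = e" "field_boundary p b' = - e" "a' + b' \<in> chains.span G"
      using lift[OF e] by blast
    \<comment> \<open>Subtracting the lifted halves \<open>a'\<close>, \<open>b'\<close> and the
      filling \<open>u\<close> of the remainder turns each half into a cycle of its own.\<close>
    have "a - a' - u \<in> field_cycles p (subtopology X U1)"
      using field_chains_mono[OF ab(1) VU(1)] field_chains_mono[OF ab'(1) VU(1)]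
        field_chains_mono[OF u(1), of U1] u(2) ab'(3)
      by (simp add: field_cycles_def field_boundary_diff chains.subspace_diff[OF subspace_field_chains])
    then have 1: "a - a' - u \<in> ?T" using F1 subT by blast
    have "b - b' + u \<in> field_cycles p (subtopology X U2)"
      using field_chains_mono[OF ab(2) VU(2)] field_chains_mono[OF ab'(2) VU(2)]
        field_chains_mono[OF u(1), of U2] u(2) ab'(4) eb
      by (simp add: field_cycles_def field_boundary_diff field_boundary_add
          chains.subspace_diff[OF subspace_field_chains] chains.subspace_add[OF subspace_field_chains])
    then have 2: "b - b' + u \<in> ?T" using F2 subT by blast
    have "a + b - c \<in> B" unfolding B_def using field_boundaries_mono[OF ab(3)] VU by blast
    then have 3: "a + b - c \<in> ?T" using subT by blast
    have 4: "a' + b' \<in> ?T" using ab'(5) subT by blast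
    have "c = (a - a' - u) + (b - b' + u) + (a' + b') - (a + b - c)" by (simp add: algebra_simps)
    also have "\<dots> \<in> ?T" by (intro chains.span_diff[OF chains.span_add[OF chains.span_add[OF 1 2] 4] 3])
    finally show ?thesis .
  qed
  moreover have "finite (F1 \<union> F2 \<union> G)" using F1 F2 F' by (simp add: G_def)
  ultimately show ?thesis
    unfolding finite_rank_def B_def[symmetric] by (intro exI[of _ "F1 \<union> F2 \<union> G"] conjI subsetI)
qed

text \<open>Induction on the degree. In a fixed degree, closed sets having a suitable neighbourhood
  are stable under finite unions: by normality the neighbourhoods shrink to ones with closures
  inside, and the previous degree is applied to the intersection of these closures. Compactness then
  reduces to small closed sets around points.\<close>

lemma finite_rank_compact:
  assumes X: "compact_space X" "Hausdorff_space X"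
    and loc: "\<And>p x U. openin X U \<Longrightarrow> x \<in> U \<Longrightarrow>
      \<exists>V. openin X V \<and> x \<in> V \<and> V \<subseteq> U \<and> finite_rank TYPE('k::field) p X V U"
    and K: "closedin X K" "openin X W" "K \<subseteq> W"
  shows "\<exists>U. openin X U \<and> K \<subseteq> U \<and> U \<subseteq> W \<and> finite_rank TYPE('k) p X U W"
  using K
proof (induction p arbitrary: K W rule: less_induct)
  case (less p)
  have nor: "\<exists>V. openin X V \<and> S \<subseteq> V \<and> X closure_of V \<subseteq> U" if "closedin X S" "openin X U" "S \<subseteq> U" for S U
    using X that compact_Hausdorff_or_regular_imp_normal_space normal_space_alt by metis
  define good where "good K \<longleftrightarrow> (\<exists>U. openin X U \<and> K \<subseteq> U \<and> U \<subseteq> W \<and> finite_rank TYPE('k) p X U W)" for K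
  have good_Un: "good (K1 \<union> K2)" if K12: "closedin X K1" "closedin X K2" "good K1" "good K2" for K1 K2
  proof -
    obtain U1 where U1: "openin X U1" "K1 \<subseteq> U1" "U1 \<subseteq> W" "finite_rank TYPE('k) p X U1 W"
      using K12(3) unfolding good_def by blast
    obtain U2 where U2: "openin X U2" "K2 \<subseteq> U2" "U2 \<subseteq> W" "finite_rank TYPE('k) p X U2 W"
      using K12(4) unfolding good_def by blast
    obtain V1 where V1: "openin X V1" "K1 \<subseteq> V1" "X closure_of V1 \<subseteq> U1" using nor[OF K12(1) U1(1,2)] by blast
    obtain V2 where V2: "openin X V2" "K2 \<subseteq> V2" "X closure_of V2 \<subseteq> U2" using nor[OF K12(2) U2(1,2)] by blast
    have sub: "V1 \<subseteq> X closure_of V1" "V2 \<subseteq> X closure_of V2"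
      using V1 V2 by (auto intro!: closure_of_subset openin_subset)
    have "finite_rank TYPE('k) (p - 1) X (V1 \<inter> V2) (U1 \<inter> U2)" if "p > 0"
    proof -
      have "\<exists>U. openin X U \<and> X closure_of V1 \<inter> X closure_of V2 \<subseteq> U \<and> U \<subseteq> U1 \<inter> U2 \<and>
          finite_rank TYPE('k) (p - 1) X U (U1 \<inter> U2)"
        using that U1 U2 V1 V2 by (intro less.IH) auto
      then show ?thesis using sub finite_rank_mono by (metis Int_mono order_trans subset_refl)
    qed
    then have "finite_rank TYPE('k) p X (V1 \<union> V2) W"
      using U1 U2 V1 V2 sub by (intro finite_rank_union[of X V1 V2 U1 U2]) auto
    then show ?thesis unfolding good_def using U1 U2 V1 V2 sub by (intro exI[of _ "V1 \<union> V2"]) auto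
  qed
  have "\<forall>x\<in>K. \<exists>O'. openin X O' \<and> x \<in> O' \<and> good (X closure_of O')"
  proof
    fix x assume "x \<in> K"
    then obtain V where V: "openin X V" "x \<in> V" "V \<subseteq> W" "finite_rank TYPE('k) p X V W"
      using loc[of W x p] less.prems by blast
    have "closedin X {x}" using V(1,2) X(2) by (meson Hausdorff_imp_t1_space closedin_t1_singleton openin_subset subsetD)
    then obtain O' where "openin X O'" "{x} \<subseteq> O'" "X closure_of O' \<subseteq> V" using nor[of "{x}" V] V by blast
    then show "\<exists>O'. openin X O' \<and> x \<in> O' \<and> good (X closure_of O')"
      unfolding good_def using V by blast
  qed
  then obtain O' where O': "\<And>x. x \<in> K \<Longrightarrow> openin X (O' x)" "\<And>x. x \<in> K \<Longrightarrow> x \<in> O' x"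
    "\<And>x. x \<in> K \<Longrightarrow> good (X closure_of (O' x))" by metis
  have "compactin X K" using X(1) less.prems(1) closedin_compact_space by blast
  then obtain \<F> where \<F>: "finite \<F>" "\<F> \<subseteq> O' ` K" "K \<subseteq> \<Union>\<F>"
    using O' unfolding compactin_def by (metis (no_types, lifting) UN_I image_iff subsetI)
  have "closedin X (\<Union>V\<in>\<F>. X closure_of V) \<and> good (\<Union>V\<in>\<F>. X closure_of V)"
    using \<F>(1,2)
  proof (induction rule: finite_induct)
    case empty
    have "good {}" unfolding good_def by (intro exI[of _ "{}"]) (simp add: finite_rank_empty)
    then show ?case by simp
  next
    case (insert V \<F>)
    then have "good (X closure_of V)" using O' by auto
    with insert show ?case using good_Un[of "X closure_of V"] by (auto intro: closedin_Un)
  qed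
  moreover have "K \<subseteq> (\<Union>V\<in>\<F>. X closure_of V)"
  proof
    fix x assume "x \<in> K"
    then obtain V where V: "V \<in> \<F>" "x \<in> V" using \<F> by blast
    then have "openin X V" using \<F> O' by blast
    then have "V \<subseteq> X closure_of V" by (intro closure_of_subset openin_subset)
    then show "x \<in> (\<Union>V\<in>\<F>. X closure_of V)" using V by blast
  qed
  ultimately show ?case unfolding good_def by (metis order_trans)
qed

section \<open>From finite rank to finite dimension\<close>

lemma homology_class_eq:
  assumes "b \<in> field_boundaries p X"
  shows "homology_class p X (c + b) = homology_class p X c"
proof -
  have "(c + b) + d \<in> homology_class p X c" if "d \<in> field_boundaries p X" for d
    using field_boundaries_closed(2)[OF assms that] unfolding homology_class_def
    by (auto simp: add.assoc)
  moreover have "c + d \<in> homology_class p X (c + b)" if d: "d \<in> field_boundaries p X" for d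
  proof -
    have "c + d = (c + b) + (d - b)" by simp
    moreover have "d - b \<in> field_boundaries p X"
      using chains.subspace_diff[OF subspace_field_boundaries d assms] .
    ultimately show ?thesis unfolding homology_class_def by blast
  qed
  ultimately show ?thesis unfolding homology_class_def by blast
qed

lemma fin_dim_field_homology:
  assumes "finite_rank TYPE('k::field) p X (topspace X) (topspace X)"
  shows "vectorspace.fin_dim coefficient_field (field_homology p X :: ('k, ('a, 'k) field_chain set) module)"
proof -
  let ?V = "field_homology p X :: ('k, ('a, 'k) field_chain set) module"
  let ?cls = "homology_class p X :: ('a, 'k) field_chain \<Rightarrow> _"
  interpret V: vectorspace coefficient_field ?V by (rule vectorspace_field_homology)
  have car: "carrier ?V = ?cls ` field_cycles p X" by (simp add: field_homology_def)
  obtain F0 :: "('a, 'k) field_chain set" where F0: "finite F0"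
    "field_cycles p X \<subseteq> chains.span (F0 \<union> field_boundaries p X)"
    using assms unfolding finite_rank_def by auto
  \<comment> \<open>Only cycles have homology classes, so the spanning chains are first replaced by
    cycles.\<close>
  obtain F :: "('a, 'k) field_chain set" where F: "finite F" "F \<subseteq> field_cycles p X" "field_cycles p X \<subseteq> chains.span (F \<union> field_boundaries p X)"
    using finite_spanning_subset_mod[OF F0(1) subspace_field_cycles F0(2)] by blast
  have A: "?cls ` F \<subseteq> carrier ?V" using F(2) by (auto simp: car)
  interpret S: LinearCombinations.submodule coefficient_field "V.span (?cls ` F)" ?V
    using V.span_is_submodule[OF A] .
  have span: "?cls x \<in> V.span (?cls ` F)" if "x \<in> chains.span F" for x
    using that
  proof (induction rule: chains.span_induct_alt)
    case base
    show ?case using S.submodule_axioms unfolding submodule_def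
      by (metis field_homology_zero)
  next
    case (step k x y)
    have "?cls x \<in> V.span (?cls ` F)" using V.in_own_span[OF A] step(1) by blast
    then have "k \<odot>\<^bsub>?V\<^esub> ?cls x \<in> V.span (?cls ` F)"
      using S.submodule_axioms unfolding submodule_def by (simp add: coefficient_field_def)
    then have "k \<odot>\<^bsub>?V\<^esub> ?cls x \<oplus>\<^bsub>?V\<^esub> ?cls y \<in> V.span (?cls ` F)"
      using S.submodule_axioms step(2) unfolding submodule_def by blast
    then show ?case by (simp add: field_homology_smult field_homology_add)
  qed
  have "?cls z \<in> V.span (?cls ` F)" if z: "z \<in> field_cycles p X" for z
  proof -
    obtain u b where "u \<in> chains.span F" "b \<in> field_boundaries p X" "z = u + b"
      using F(3) z span_Un_subspace[OF subspace_field_boundaries, of z F p X] by blast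
    then show ?thesis using span homology_class_eq by metis
  qed
  then have "V.span (?cls ` F) = carrier ?V"
    using V.span_is_subset2[OF A] by (auto simp: car)
  then show ?thesis unfolding V.fin_dim_def using A F(1) by blast
qed

lemma fin_dim_field_homology_compact:
  assumes "compact_space X" "Hausdorff_space X"
    and "\<And>x U. openin X U \<Longrightarrow> x \<in> U \<Longrightarrow> \<exists>V a. openin X V \<and> x \<in> V \<and> V \<subseteq> U \<and>
      homotopic_with (\<lambda>_. True) (subtopology X V) (subtopology X U) id (\<lambda>_. a)"
  shows "vectorspace.fin_dim coefficient_field (field_homology p X :: ('k::field, ('a, 'k) field_chain set) module)"
proof -
  have "\<exists>V. openin X V \<and> x \<in> V \<and> V \<subseteq> U \<and> finite_rank TYPE('k) p X V U"
    if "openin X U" "x \<in> U" for p x U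
    using assms(3)[OF that] finite_rank_nullhomotopic by metis
  from finite_rank_compact[OF assms(1,2) this, of "topspace X" "topspace X" p]
  obtain U where "topspace X \<subseteq> U" "U \<subseteq> topspace X" "finite_rank TYPE('k) p X U (topspace X)" by blast
  then have "finite_rank TYPE('k) p X (topspace X) (topspace X)" by (metis subset_antisym)
  then show ?thesis by (rule fin_dim_field_homology)
qed

section \<open>Functions of class \<open>C\<^sup>k\<close>\<close>

lemma Ck_open_SucD: "Ck_open (Suc k) U f \<Longrightarrow> Ck_open k U f"
proof (induction k arbitrary: f)
  case 0
  then show ?case
    by (auto intro: differentiable_imp_continuous_on simp: differentiable_on_def differentiable_at_withinI)
next
  case (Suc k)
  then show ?case by (metis Ck_open.simps(2))
qed

lemma Ck_open_mono: "Ck_open k U f \<Longrightarrow> j \<le> k \<Longrightarrow> Ck_open j U f"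
  by (induction k) (auto simp: le_Suc_eq dest: Ck_open_SucD simp del: Ck_open.simps(2))

lemma Ck_open_differentiable: "Ck_open (Suc k) UNIV f \<Longrightarrow> f differentiable (at x)"
  by simp

lemma Ck_open_const: "Ck_open k UNIV (\<lambda>x. c)"
  by (induction k arbitrary: c) (auto simp: frechet_derivative_const)

lemma Ck_open_add:
  "Ck_open k UNIV f \<Longrightarrow> Ck_open k UNIV g \<Longrightarrow> Ck_open k UNIV (\<lambda>x. f x + g x)"
proof (induction k arbitrary: f g)
  case (Suc k)
  have der: "((\<lambda>x. f x + g x) has_derivative
      (\<lambda>v. frechet_derivative f (at x) v + frechet_derivative g (at x) v)) (at x)" for x
    using Suc.prems by (intro has_derivative_add) (auto simp flip: frechet_derivative_works)
  have eq: "frechet_derivative (\<lambda>x. f x + g x) (at x) =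
      (\<lambda>v. frechet_derivative f (at x) v + frechet_derivative g (at x) v)" for x
    using frechet_derivative_at[OF der] by simp
  show ?case using Suc der unfolding Ck_open.simps eq by (auto simp: differentiable_def)
qed (auto intro: continuous_on_add)

lemma Ck_open_bilinear:
  assumes bil: "bounded_bilinear pr"
  shows "Ck_open k UNIV f \<Longrightarrow> Ck_open k UNIV g \<Longrightarrow> Ck_open k UNIV (\<lambda>x. pr (f x) (g x))"
proof (induction k arbitrary: f g)
  case 0
  then show ?case using bounded_bilinear.continuous_on[OF bil] by auto
next
  case (Suc k)
  have der: "((\<lambda>x. pr (f x) (g x)) has_derivative
      (\<lambda>v. pr (f x) (frechet_derivative g (at x) v) + pr (frechet_derivative f (at x) v) (g x))) (at x)" for x
    using Suc.prems by (intro bounded_bilinear.FDERIV[OF bil]) (auto simp flip: frechet_derivative_works)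
  have eq: "frechet_derivative (\<lambda>x. pr (f x) (g x)) (at x) =
      (\<lambda>v. pr (f x) (frechet_derivative g (at x) v) + pr (frechet_derivative f (at x) v) (g x))" for x
    using frechet_derivative_at[OF der] by simp
  have "Ck_open k UNIV f" "Ck_open k UNIV g" using Suc.prems Ck_open_SucD by blast+
  then show ?case
    using Suc der unfolding Ck_open.simps eq by (auto intro!: Ck_open_add simp: differentiable_def)
qed

lemma Ck_open_compose_linear:
  assumes lin: "bounded_linear L"
  shows "Ck_open k UNIV f \<Longrightarrow> Ck_open k UNIV (\<lambda>x. f (L x))"
proof (induction k arbitrary: f)
  case 0
  then show ?case using linear_continuous_on[OF lin]
    by (auto intro: continuous_on_compose2[of UNIV f UNIV L])
next
  case (Suc k)
  have der: "((\<lambda>x. f (L x)) has_derivative (\<lambda>v. frechet_derivative f (at (L x)) (L v))) (at x)" for x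
    using Suc.prems lin
    by (intro has_derivative_compose[OF bounded_linear_imp_has_derivative[OF lin], of f])
      (auto simp flip: frechet_derivative_works)
  have eq: "frechet_derivative (\<lambda>x. f (L x)) (at x) = (\<lambda>v. frechet_derivative f (at (L x)) (L v))" for x
    using frechet_derivative_at[OF der] by simp
  show ?case using Suc der unfolding Ck_open.simps eq by (auto simp: differentiable_def)
qed

lemma Ck_open_imp_Ck_on: "Ck_open k UNIV f \<Longrightarrow> Ck_on k D f"
  unfolding Ck_on_def by (intro ballI exI[of _ UNIV] exI[of _ f]) auto

section \<open>Iterated derivatives of functions on the line, and periodicity\<close>

lemma Ck_open_real_Suc:
  fixes g :: "real \<Rightarrow> 'v::real_normed_vector"
  shows "Ck_open (Suc k) UNIV g \<longleftrightarrow>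
    (\<forall>t. g differentiable (at t)) \<and> Ck_open k UNIV (\<lambda>t. vector_derivative g (at t))"
proof -
  have eq: "frechet_derivative g (at t) v = v *\<^sub>R vector_derivative g (at t)"
    if "\<forall>t. g differentiable (at t)" for t v
    using that frechet_derivative_eq_vector_derivative[of g t] by simp
  show ?thesis
  proof (intro iffI conjI)
    assume L: "Ck_open (Suc k) UNIV g"
    then show d: "\<forall>t. g differentiable (at t)" by simp
    have "Ck_open k UNIV (\<lambda>x. frechet_derivative g (at x) 1)" using L by simp
    then show "Ck_open k UNIV (\<lambda>t. vector_derivative g (at t))" by (simp add: eq[OF d])
  next
    assume R: "(\<forall>t. g differentiable (at t)) \<and> Ck_open k UNIV (\<lambda>t. vector_derivative g (at t))"
    then have "Ck_open k UNIV (\<lambda>x. v *\<^sub>R vector_derivative g (at x))" for v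
      using Ck_open_bilinear[OF bounded_bilinear_scaleR Ck_open_const] by blast
    with R show "Ck_open (Suc k) UNIV g" by (simp add: eq)
  qed
qed

lemma iterated_derivative_Suc:
  "iterated_derivative (Suc j) g = (\<lambda>t. vector_derivative (iterated_derivative j g) (at t))"
  by (simp add: iterated_derivative_def)

lemma iterated_derivative_Suc':
  "iterated_derivative (Suc j) g = iterated_derivative j (\<lambda>t. vector_derivative g (at t))"
  unfolding iterated_derivative_def by (simp add: funpow_Suc_right del: funpow.simps(2))

lemma iterated_derivative_0 [simp]: "iterated_derivative 0 g = g"
  by (simp add: iterated_derivative_def)

lemma Ck_open_iterated_derivative:
  "Ck_open (j + k) UNIV g \<Longrightarrow> Ck_open k UNIV (iterated_derivative j g)"
  by (induction j arbitrary: g) (auto simp: iterated_derivative_Suc' Ck_open_real_Suc simp del: Ck_open.simps(2))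

lemma continuous_iterated_derivative:
  assumes "Ck_open k UNIV g" "j \<le> k"
  shows "continuous_on S (iterated_derivative j g)"
  using Ck_open_iterated_derivative[of j 0 g] Ck_open_mono[OF assms]
  by (auto intro: continuous_on_subset)

lemma has_vector_derivative_iterated:
  assumes "Ck_open k UNIV g" "j < k"
  shows "(iterated_derivative j g has_vector_derivative iterated_derivative (Suc j) g t) (at t)"
proof -
  have "Ck_open (Suc j) UNIV g" by (rule Ck_open_mono[OF assms(1)]) (use assms(2) in simp)
  then have "Ck_open (Suc 0) UNIV (iterated_derivative j g)"
    using Ck_open_iterated_derivative[of j "Suc 0" g] by (simp only: add_Suc_right add_0_right)
  then have "iterated_derivative j g differentiable (at t)" by (rule Ck_open_differentiable)
  then show ?thesis by (simp add: iterated_derivative_Suc vector_derivative_works)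
qed

lemma iterated_derivative_periodic:
  assumes g: "Ck_open k UNIV g" "j \<le> k" and per: "\<And>t. g (t + 1) = g t"
  shows "iterated_derivative j g (t + 1) = iterated_derivative j g t"
  using g(2)
proof (induction j arbitrary: t)
  case (Suc j)
  let ?h = "iterated_derivative j g"
  have d: "(?h has_vector_derivative iterated_derivative (Suc j) g t) (at t)" for t
    using has_vector_derivative_iterated[OF g(1)] Suc.prems by simp
  have "((\<lambda>s. ?h (s + 1)) has_vector_derivative iterated_derivative (Suc j) g (t + 1)) (at t)"
  proof -
    have "((\<lambda>s. s + 1) has_vector_derivative 1) (at t)"
      by (auto simp flip: has_real_derivative_iff_has_vector_derivative intro!: derivative_eq_intros)
    from vector_diff_chain_at[OF this d] show ?thesis by (simp add: o_def)
  qed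
  then have "(?h has_vector_derivative iterated_derivative (Suc j) g (t + 1)) (at t)"
    using Suc by simp
  then show ?case using d vector_derivative_unique_at by blast
qed (simp add: per)

lemma periodic_int:
  fixes g :: "real \<Rightarrow> 'v"
  assumes "\<And>t. g (t + 1) = g t"
  shows "g (t + of_int n) = g t"
proof -
  have nat: "g (t + of_nat m) = g t" for m t
  proof (induction m)
    case (Suc m)
    have "g (t + real (Suc m)) = g ((t + real m) + 1)" by (simp add: add.commute add.left_commute)
    then show ?case using Suc assms by metis
  qed simp
  show ?thesis
  proof (cases "n \<ge> 0")
    case True
    then show ?thesis using nat[of t "nat n"] by simp
  next
    case False
    then show ?thesis using nat[of "t + of_int n" "nat (- n)"] by simp
  qed
qed

lemma periodic_frac:
  fixes g :: "real \<Rightarrow> 'v"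
  assumes "\<And>t. g (t + 1) = g t"
  shows "g (frac t) = g t"
  using periodic_int[of g "frac t" "\<lfloor>t\<rfloor>", OF assms] by (simp add: frac_def)

lemma iterated_derivative_bounded:
  assumes g: "Ck_open k UNIV g" and per: "\<And>t. g (t + 1) = g t"
  shows "\<exists>B>0. \<forall>j\<le>k. \<forall>t. norm (iterated_derivative j g t) \<le> B"
proof -
  have "\<exists>B>0. \<forall>t. norm (iterated_derivative j g t) \<le> B" if "j \<le> k" for j
  proof -
    have "bounded (iterated_derivative j g ` {0..1})"
      using continuous_iterated_derivative[OF g that]
      by (intro compact_imp_bounded compact_continuous_image) auto
    then obtain B where B: "B > 0" "\<And>t. t \<in> {0..1} \<Longrightarrow> norm (iterated_derivative j g t) \<le> B"
      unfolding bounded_pos by auto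
    have "norm (iterated_derivative j g t) \<le> B" for t
      using B(2)[of "frac t"] periodic_frac[of "iterated_derivative j g" t]
        iterated_derivative_periodic[OF g that per] frac_ge_0[of t] frac_lt_1[of t]
      by (simp add: less_imp_le)
    with B show ?thesis by blast
  qed
  then obtain B where B: "\<And>j. j \<le> k \<Longrightarrow> B j > 0" "\<And>j t. j \<le> k \<Longrightarrow> norm (iterated_derivative j g t) \<le> B j"
    by metis
  have "B j \<le> sum B {..k}" if "j \<le> k" for j
    using that B(1) by (intro member_le_sum) (auto simp: less_imp_le)
  moreover have "sum B {..k} > 0" using B(1) by (intro sum_pos) auto
  ultimately show ?thesis using B(2) by (intro exI[of _ "sum B {..k}"]) (meson order_trans)
qed

lemma iterated_derivative_add_scaled:
  fixes g h :: "real \<Rightarrow> 'v::real_normed_vector"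
  assumes "Ck_open k UNIV g" "Ck_open k UNIV h" "j \<le> k"
  shows "iterated_derivative j (\<lambda>t. g t + c *\<^sub>R h t) t =
    iterated_derivative j g t + c *\<^sub>R iterated_derivative j h t"
  using assms(3)
proof (induction j arbitrary: t)
  case (Suc j)
  have eq: "iterated_derivative j (\<lambda>t. g t + c *\<^sub>R h t) =
      (\<lambda>t. iterated_derivative j g t + c *\<^sub>R iterated_derivative j h t)"
    using Suc by auto
  have "((\<lambda>t. iterated_derivative j g t + c *\<^sub>R iterated_derivative j h t) has_vector_derivative
      iterated_derivative (Suc j) g t + c *\<^sub>R iterated_derivative (Suc j) h t) (at t)"
    using has_vector_derivative_iterated[OF assms(1)] has_vector_derivative_iterated[OF assms(2)] Suc.prems
    by (intro has_vector_derivative_add bounded_linear.has_vector_derivative[OF bounded_linear_scaleR_right])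
      simp_all
  then show ?case unfolding iterated_derivative_Suc[of j "\<lambda>t. g t + c *\<^sub>R h t"] eq
    by (rule vector_derivative_at)
qed simp

section \<open>The half squared chord length on the universal cover\<close>

definition half_sq_dist :: "(real \<Rightarrow> 'v::real_inner) \<Rightarrow> real \<times> real \<Rightarrow> real" where
  "half_sq_dist g = (\<lambda>(x, y). (norm (g x - g y))\<^sup>2 / 2)"

lemma half_sq_chord_cover: "half_sq_chord \<gamma> \<circ> F2_cover = half_sq_dist (\<gamma> \<circ> circle_exp)"
  by (auto simp: half_sq_chord_def F2_cover_def half_sq_dist_def chord_pair fun_eq_iff)

lemma half_sq_dist_inner: "half_sq_dist g (x, y) = inner (g x - g y) (g x - g y) / 2"
  by (simp add: half_sq_dist_def power2_norm_eq_inner)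

abbreviation (input) D1 :: "(real \<Rightarrow> 'v::real_normed_vector) \<Rightarrow> real \<Rightarrow> 'v" where
  "D1 g \<equiv> iterated_derivative 1 g"

abbreviation (input) D2 :: "(real \<Rightarrow> 'v::real_normed_vector) \<Rightarrow> real \<Rightarrow> 'v" where
  "D2 g \<equiv> iterated_derivative 2 g"

text \<open>The gradient of \<open>half_sq_dist g\<close> is \<open>(chord_fst g, - chord_snd g)\<close>.\<close>

definition chord_fst :: "(real \<Rightarrow> 'v::real_inner) \<Rightarrow> real \<Rightarrow> real \<Rightarrow> real" where
  "chord_fst g x y = inner (g x - g y) (D1 g x)"

definition chord_snd :: "(real \<Rightarrow> 'v::real_inner) \<Rightarrow> real \<Rightarrow> real \<Rightarrow> real" where
  "chord_snd g x y = inner (g x - g y) (D1 g y)"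

definition hess_xx :: "(real \<Rightarrow> 'v::real_inner) \<Rightarrow> real \<Rightarrow> real \<Rightarrow> real" where
  "hess_xx g x y = inner (D1 g x) (D1 g x) + inner (g x - g y) (D2 g x)"

definition hess_xy :: "(real \<Rightarrow> 'v::real_inner) \<Rightarrow> real \<Rightarrow> real \<Rightarrow> real" where
  "hess_xy g x y = - inner (D1 g x) (D1 g y)"

definition hess_yy :: "(real \<Rightarrow> 'v::real_inner) \<Rightarrow> real \<Rightarrow> real \<Rightarrow> real" where
  "hess_yy g x y = inner (D1 g y) (D1 g y) - inner (g x - g y) (D2 g y)"

definition hess_det :: "(real \<Rightarrow> 'v::real_inner) \<Rightarrow> real \<Rightarrow> real \<Rightarrow> real" where
  "hess_det g x y = hess_xx g x y * hess_yy g x y - (hess_xy g x y)\<^sup>2"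

text \<open>Noncritical chords count as nondegenerate. The negation then consists of three
  equations, each continuous in the 2-jet at the ends, which makes the condition open.\<close>

definition nondegenerate_chord :: "(real \<Rightarrow> 'v::real_inner) \<Rightarrow> real \<Rightarrow> real \<Rightarrow> bool" where
  "nondegenerate_chord g x y \<longleftrightarrow> \<not> (chord_fst g x y = 0 \<and> chord_snd g x y = 0 \<and> hess_det g x y = 0)"

lemma C2_derivatives:
  assumes "Ck_open k UNIV g" "k \<ge> 2"
  shows "(g has_vector_derivative D1 g t) (at t)" "(D1 g has_vector_derivative D2 g t) (at t)"
  using has_vector_derivative_iterated[OF assms(1), of 0] has_vector_derivative_iterated[OF assms(1), of 1] assms(2)
  by (auto simp: numeral_2_eq_2)

lemma C2_has_derivative_fst:
  assumes "(g has_vector_derivative d) (at (fst q))"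
  shows "((\<lambda>q::real \<times> real. g (fst q)) has_derivative (\<lambda>v. fst v *\<^sub>R d)) (at q)"
  using has_derivative_compose[OF has_derivative_fst[OF has_derivative_ident], of g "\<lambda>x. x *\<^sub>R d" q UNIV] assms
  by (simp add: has_vector_derivative_def)

lemma C2_has_derivative_snd:
  assumes "(g has_vector_derivative d) (at (snd q))"
  shows "((\<lambda>q::real \<times> real. g (snd q)) has_derivative (\<lambda>v. snd v *\<^sub>R d)) (at q)"
  using has_derivative_compose[OF has_derivative_snd[OF has_derivative_ident], of g "\<lambda>x. x *\<^sub>R d" q UNIV] assms
  by (simp add: has_vector_derivative_def)

lemma has_derivative_half_sq_dist:
  assumes "Ck_open k UNIV g" "k \<ge> 2"
  shows "(half_sq_dist g has_derivative
    (\<lambda>v. chord_fst g (fst q) (snd q) * fst v - chord_snd g (fst q) (snd q) * snd v)) (at q)"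
proof -
  note d = C2_derivatives[OF assms]
  have eq: "half_sq_dist g = (\<lambda>q. inner (g (fst q) - g (snd q)) (g (fst q) - g (snd q)) / 2)"
    by (auto simp: half_sq_dist_inner fun_eq_iff)
  show ?thesis unfolding eq
    by (rule has_derivative_eq_rhs, (rule derivative_intros C2_has_derivative_fst C2_has_derivative_snd d | simp)+)
      (auto simp: chord_fst_def chord_snd_def field_simps inner_diff_left inner_diff_right inner_commute fun_eq_iff)
qed

lemma has_derivative_chord_fst:
  assumes "Ck_open k UNIV g" "k \<ge> 2"
  shows "((\<lambda>q. chord_fst g (fst q) (snd q)) has_derivative
    (\<lambda>v. hess_xx g (fst q) (snd q) * fst v + hess_xy g (fst q) (snd q) * snd v)) (at q)"
proof -
  note d = C2_derivatives[OF assms]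
  show ?thesis unfolding chord_fst_def
    by (rule has_derivative_eq_rhs, (rule derivative_intros C2_has_derivative_fst C2_has_derivative_snd d | simp)+)
      (auto simp: hess_xx_def hess_xy_def algebra_simps inner_diff_left inner_diff_right inner_commute fun_eq_iff)
qed

lemma has_derivative_chord_snd:
  assumes "Ck_open k UNIV g" "k \<ge> 2"
  shows "((\<lambda>q. chord_snd g (fst q) (snd q)) has_derivative
    (\<lambda>v. - hess_xy g (fst q) (snd q) * fst v - hess_yy g (fst q) (snd q) * snd v)) (at q)"
proof -
  note d = C2_derivatives[OF assms]
  show ?thesis unfolding chord_snd_def
    by (rule has_derivative_eq_rhs, (rule derivative_intros C2_has_derivative_fst C2_has_derivative_snd d | simp)+)
      (auto simp: hess_yy_def hess_xy_def algebra_simps inner_diff_left inner_diff_right inner_commute fun_eq_iff)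
qed

lemma Ck_open_half_sq_dist:
  assumes "Ck_open k UNIV g"
  shows "Ck_open k UNIV (half_sq_dist g)"
proof -
  let ?h = "\<lambda>q. g (fst q) + (-1) *\<^sub>R g (snd q)"
  note scale = Ck_open_bilinear[OF bounded_bilinear_scaleR Ck_open_const]
  have h: "Ck_open k UNIV ?h"
    by (rule Ck_open_add[OF Ck_open_compose_linear[OF bounded_linear_fst assms]
          scale[OF Ck_open_compose_linear[OF bounded_linear_snd assms]]])
  have "Ck_open k UNIV (\<lambda>q. (1/2) *\<^sub>R inner (?h q) (?h q))"
    by (rule scale[OF Ck_open_bilinear[OF bounded_bilinear_inner h h]])
  moreover have "half_sq_dist g = (\<lambda>q. (1/2) *\<^sub>R inner (?h q) (?h q))"
    by (auto simp: half_sq_dist_inner fun_eq_iff)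
  ultimately show ?thesis by simp
qed

lemma hessian_half_sq_dist:
  assumes "Ck_open k UNIV g" "k \<ge> 2"
  shows "hessian (half_sq_dist g) (x, y) u v =
    (hess_xx g x y * fst v + hess_xy g x y * snd v) * fst u +
    (hess_xy g x y * fst v + hess_yy g x y * snd v) * snd u"
proof -
  have 1: "frechet_derivative (half_sq_dist g) (at q) u =
      chord_fst g (fst q) (snd q) * fst u - chord_snd g (fst q) (snd q) * snd u" for q
    using frechet_derivative_at[OF has_derivative_half_sq_dist[OF assms, of q]] by metis
  have "((\<lambda>q. chord_fst g (fst q) (snd q) * fst u - chord_snd g (fst q) (snd q) * snd u) has_derivative
      (\<lambda>v. (hess_xx g x y * fst v + hess_xy g x y * snd v) * fst u -
        (- hess_xy g x y * fst v - hess_yy g x y * snd v) * snd u)) (at (x, y))"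
    using has_derivative_chord_fst[OF assms, of "(x, y)"] has_derivative_chord_snd[OF assms, of "(x, y)"]
    by (intro has_derivative_diff has_derivative_mult_left) simp_all
  note eq = frechet_derivative_at[OF this, symmetric]
  show ?thesis unfolding hessian_def 1 eq by (simp add: algebra_simps)
qed

lemma symmetric_form_nondegenerate:
  fixes a b c :: real
  shows "(\<forall>u::real \<times> real. (\<forall>v. (a * fst v + b * snd v) * fst u + (b * fst v + c * snd v) * snd u = 0) \<longrightarrow> u = 0)
    \<longleftrightarrow> a * c - b\<^sup>2 \<noteq> 0" (is "?L \<longleftrightarrow> ?R")
proof
  assume L: ?L
  show ?R
  proof
    assume z: "a * c - b\<^sup>2 = 0"
    \<comment> \<open>A singular matrix kills \<open>(c, - b)\<close>. If this vector is zero, then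
      \<open>(0, 1)\<close> is in the kernel instead.\<close>
    have "\<forall>v. (a * fst v + b * snd v) * fst (c, - b) + (b * fst v + c * snd v) * snd (c, - b) = 0"
      using z by (auto simp: algebra_simps power2_eq_square)
    then have 1: "c = 0" "b = 0" using L by (metis Pair_inject neg_equal_0_iff_equal zero_prod_def)+
    then have "\<forall>v. (a * fst v + b * snd v) * fst (0::real, 1::real) + (b * fst v + c * snd v) * snd (0::real, 1::real) = 0"
      by auto
    then have "(0::real, 1::real) = 0" using L by blast
    then show False by (simp add: zero_prod_def)
  qed
next
  assume R: ?R
  show ?L
  proof (intro allI impI)
    fix u :: "real \<times> real"
    assume H: "\<forall>v. (a * fst v + b * snd v) * fst u + (b * fst v + c * snd v) * snd u = 0"
    from H[rule_format, of "(1, 0)"] have 1: "a * fst u + b * snd u = 0" by simp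
    from H[rule_format, of "(0, 1)"] have 2: "b * fst u + c * snd u = 0" by simp
    have "(a * c - b\<^sup>2) * fst u = c * (a * fst u + b * snd u) - b * (b * fst u + c * snd u)"
      "(a * c - b\<^sup>2) * snd u = a * (b * fst u + c * snd u) - b * (a * fst u + b * snd u)"
      by (auto simp: algebra_simps power2_eq_square)
    then have "(a * c - b\<^sup>2) * fst u = 0" "(a * c - b\<^sup>2) * snd u = 0" by (simp_all only: 1 2 mult_zero_right diff_self)
    then have "fst u = 0" "snd u = 0" using R by simp_all
    then show "u = 0" by (simp add: prod_eq_iff)
  qed
qed

section \<open>Local contractibility of sublevel sets\<close>

text \<open>Gradient and Hessian are given as data, so that the explicit formulas for chords can be
  inserted; the shared \<open>b\<close> expresses symmetry of the Hessian.\<close>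

locale C2_plane_function =
  fixes F p1 p2 a b c :: "real \<times> real \<Rightarrow> real"
  assumes dF: "\<And>q. (F has_derivative (\<lambda>v. p1 q * fst v + p2 q * snd v)) (at q)"
    and dp1: "\<And>q. (p1 has_derivative (\<lambda>v. a q * fst v + b q * snd v)) (at q)"
    and dp2: "\<And>q. (p2 has_derivative (\<lambda>v. b q * fst v + c q * snd v)) (at q)"
    and cont: "continuous_on UNIV a" "continuous_on UNIV b" "continuous_on UNIV c"
begin

definition slope :: "real \<times> real \<Rightarrow> real \<times> real \<Rightarrow> real" where
  "slope v q = p1 q * fst v + p2 q * snd v"

definition curvature :: "real \<times> real \<Rightarrow> real \<times> real \<Rightarrow> real" where
  "curvature v q = (a q * fst v + b q * snd v) * fst v + (b q * fst v + c q * snd v) * snd v"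

lemma cont_F: "continuous_on S F" and cont_p: "continuous_on S p1" "continuous_on S p2"
  by (rule has_derivative_continuous_on, rule has_derivative_at_withinI, rule dF dp1 dp2)+

lemma continuous_slope: "continuous_on UNIV (slope v)"
  unfolding slope_def by (intro continuous_intros cont_p)

lemma continuous_curvature: "continuous_on UNIV (curvature v)"
  unfolding curvature_def by (intro continuous_intros cont)

lemma line_derivative: "((\<lambda>s. F (q + s *\<^sub>R v)) has_real_derivative slope v (q + s *\<^sub>R v)) (at s)"
proof -
  have "((\<lambda>s. q + s *\<^sub>R v) has_derivative (\<lambda>h. h *\<^sub>R v)) (at s)"
    by (auto intro!: derivative_eq_intros)
  from has_derivative_compose[OF this dF] show ?thesis
    by (auto simp: has_field_derivative_def slope_def algebra_simps mult_commute_abs fun_eq_iff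
        elim!: has_derivative_eq_rhs)
qed

lemma line_derivative_slope:
  "((\<lambda>s. slope v (q + s *\<^sub>R v)) has_real_derivative curvature v (q + s *\<^sub>R v)) (at s)"
proof -
  have l: "((\<lambda>s. q + s *\<^sub>R v) has_derivative (\<lambda>h. h *\<^sub>R v)) (at s)"
    by (auto intro!: derivative_eq_intros)
  have "((\<lambda>s. slope v (q + s *\<^sub>R v)) has_derivative
      (\<lambda>h. (a (q + s *\<^sub>R v) * fst (h *\<^sub>R v) + b (q + s *\<^sub>R v) * snd (h *\<^sub>R v)) * fst v +
        (b (q + s *\<^sub>R v) * fst (h *\<^sub>R v) + c (q + s *\<^sub>R v) * snd (h *\<^sub>R v)) * snd v)) (at s)"
    unfolding slope_def
    using has_derivative_compose[OF l dp1] has_derivative_compose[OF l dp2]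
    by (intro has_derivative_add has_derivative_mult_left) auto
  then show ?thesis
    by (auto simp: has_field_derivative_def curvature_def algebra_simps fun_eq_iff
        elim!: has_derivative_eq_rhs)
qed

lemma decreasing_of_slope:
  assumes "\<And>s. 0 \<le> s \<Longrightarrow> s \<le> 1 \<Longrightarrow> slope v (q + s *\<^sub>R v) \<le> 0"
  shows "F (q + v) \<le> F q"
proof -
  have "F (q + 1 *\<^sub>R v) \<le> F (q + 0 *\<^sub>R v)"
    by (rule DERIV_nonpos_imp_nonincreasing[of 0 1 "\<lambda>s. F (q + s *\<^sub>R v)"], simp,
        intro exI conjI, rule line_derivative, rule assms)
  then show ?thesis by simp
qed

lemma second_order_increase:
  assumes crit: "slope v q = 0" and curv: "\<And>s. 0 \<le> s \<Longrightarrow> s \<le> 1 \<Longrightarrow> curvature v (q + s *\<^sub>R v) > 0"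
  shows "F q < F (q + v)"
proof -
  have pos: "slope v (q + s *\<^sub>R v) > 0" if "0 < s" "s \<le> 1" for s
  proof -
    have "slope v (q + 0 *\<^sub>R v) < slope v (q + s *\<^sub>R v)"
      by (rule DERIV_pos_imp_increasing[OF that(1), of "\<lambda>s. slope v (q + s *\<^sub>R v)"],
          intro exI conjI, rule line_derivative_slope, rule curv) (use that in auto)
    then show ?thesis using crit by simp
  qed
  obtain s where s: "0 < s" "s < 1" "F (q + 1 *\<^sub>R v) - F (q + 0 *\<^sub>R v) = (1 - 0) * slope v (q + s *\<^sub>R v)"
    using MVT2[of 0 1 "\<lambda>s. F (q + s *\<^sub>R v)" "\<lambda>s. slope v (q + s *\<^sub>R v)", OF _ line_derivative] by force
  then show ?thesis using pos[of s] by simp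
qed

lemma second_order_decrease:
  assumes crit: "slope v q = 0" and curv: "\<And>s. 0 \<le> s \<Longrightarrow> s \<le> 1 \<Longrightarrow> curvature v (q + s *\<^sub>R v) < 0"
  shows "F (q + v) < F q"
proof -
  have neg: "slope v (q + s *\<^sub>R v) < 0" if "0 < s" "s \<le> 1" for s
  proof -
    have "slope v (q + 0 *\<^sub>R v) > slope v (q + s *\<^sub>R v)"
      by (rule DERIV_neg_imp_decreasing[OF that(1), of "\<lambda>s. slope v (q + s *\<^sub>R v)"],
          intro exI conjI, rule line_derivative_slope, rule curv) (use that in auto)
    then show ?thesis using crit by simp
  qed
  obtain s where s: "0 < s" "s < 1" "F (q + 1 *\<^sub>R v) - F (q + 0 *\<^sub>R v) = (1 - 0) * slope v (q + s *\<^sub>R v)"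
    using MVT2[of 0 1 "\<lambda>s. F (q + s *\<^sub>R v)" "\<lambda>s. slope v (q + s *\<^sub>R v)", OF _ line_derivative] by force
  then show ?thesis using neg[of s] by simp
qed

lemma sublevel_convex_along:
  assumes curv: "\<And>s. 0 \<le> s \<Longrightarrow> s \<le> 1 \<Longrightarrow> curvature v (q + s *\<^sub>R v) \<ge> 0"
    and ends: "F q \<le> t" "F (q + v) \<le> t" and s: "0 \<le> s" "s \<le> 1"
  shows "F (q + s *\<^sub>R v) \<le> t"
proof -
  have "convex_on {0..1} (\<lambda>s. F (q + s *\<^sub>R v))"
    by (rule f''_ge0_imp_convex[where f' = "\<lambda>s. slope v (q + s *\<^sub>R v)" and f'' = "\<lambda>s. curvature v (q + s *\<^sub>R v)"])
      (use curv in \<open>simp_all add: line_derivative line_derivative_slope\<close>)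
  then have "F (q + ((1 - s) *\<^sub>R 0 + s *\<^sub>R 1) *\<^sub>R v) \<le> (1 - s) * F (q + 0 *\<^sub>R v) + s * F (q + 1 *\<^sub>R v)"
    by (rule convex_onD) (use s in auto)
  also have "\<dots> \<le> (1 - s) * t + s * t" using s ends by (intro add_mono mult_left_mono) auto
  finally show ?thesis by (simp add: algebra_simps)
qed

lemma neighbourhood_positive:
  fixes f :: "real \<times> real \<Rightarrow> real"
  assumes "continuous_on UNIV f" "f z > 0" "open W" "z \<in> W"
  obtains r where "r > 0" "ball z r \<subseteq> W" "\<And>q. q \<in> ball z r \<Longrightarrow> f q > 0"
proof -
  have "open (W \<inter> {q. f q > 0})"
    using assms by (intro open_Int open_Collect_less continuous_on_const)
  then obtain r where "r > 0" "ball z r \<subseteq> W \<inter> {q. f q > 0}"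
    using assms open_contains_ball[of "W \<inter> {q. f q > 0}"] by blast
  then show thesis using that by blast
qed

lemma segment_point: "x \<in> closed_segment q (q + v) \<Longrightarrow> \<exists>s. 0 \<le> s \<and> s \<le> 1 \<and> x = q + s *\<^sub>R (v :: real \<times> real)"
  by (auto simp: closed_segment_def algebra_simps)

text \<open>All points are translated by the same vector along the negative gradient at
  \<open>z\<close>. This lowers \<open>F\<close> and ends in a ball on which \<open>F < F z\<close>
  throughout, where a straight contraction is possible.\<close>

lemma contract_regular:
  assumes z: "\<not> (p1 z = 0 \<and> p2 z = 0)" and W: "open W" "z \<in> W"
  shows "\<exists>V o'. open V \<and> z \<in> V \<and> V \<subseteq> W \<and>
    homotopic_with_canon (\<lambda>_. True) {q \<in> V. F q \<le> F z} {q \<in> W. F q \<le> F z} id (\<lambda>_. o')"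
proof -
  define n where "n = (- p1 z, - p2 z)"
  have n0: "n \<noteq> 0" using z by (auto simp: n_def zero_prod_def)
  have "- slope n z = p1 z * p1 z + p2 z * p2 z" by (simp add: slope_def n_def)
  then have "- slope n z > 0" using z
    by (metis add_pos_nonneg add_nonneg_pos not_real_square_gt_zero zero_le_square)
  then obtain \<rho> where \<rho>: "\<rho> > 0" "ball z \<rho> \<subseteq> W" "\<And>q. q \<in> ball z \<rho> \<Longrightarrow> - slope n q > 0"
    using neighbourhood_positive[of "\<lambda>q. - slope n q" z W] continuous_slope W
    by (metis continuous_on_minus)
  \<comment> \<open>The translation has length \<open>\<rho> / 2\<close>, so that points of the half
    ball stay in the ball on which \<open>F\<close> decreases along \<open>n\<close>.\<close>
  define d where "d = \<rho> / (2 * norm n)"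
  have d: "d > 0" "norm (d *\<^sub>R n) = \<rho> / 2" using \<rho> n0 by (auto simp: d_def)
  have inb: "z + h + s *\<^sub>R d *\<^sub>R n \<in> ball z \<rho>" if "norm h < \<rho> / 2" "0 \<le> s" "s \<le> 1" for h s
  proof -
    have "norm (h + s *\<^sub>R d *\<^sub>R n) \<le> norm h + s * norm (d *\<^sub>R n)"
      using norm_triangle_ineq[of h "s *\<^sub>R d *\<^sub>R n"] that(2) by (simp only: norm_scaleR[of s] abs_of_nonneg)
    also have "\<dots> \<le> norm h + 1 * norm (d *\<^sub>R n)" using that by (intro add_left_mono mult_right_mono) auto
    also have "\<dots> < \<rho>" using that d by simp
    finally show ?thesis by (subst mem_ball, subst dist_commute) (simp add: dist_norm add.assoc)
  qed
  have slope_d: "slope (d *\<^sub>R n) q = d * slope n q" for q by (simp add: slope_def algebra_simps)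
  have "F (z + d *\<^sub>R n) < F z"
  proof -
    obtain s where s: "0 < s" "s < 1"
      "F (z + 1 *\<^sub>R d *\<^sub>R n) - F (z + 0 *\<^sub>R d *\<^sub>R n) = (1 - 0) * slope (d *\<^sub>R n) (z + s *\<^sub>R d *\<^sub>R n)"
      using MVT2[of 0 1 "\<lambda>s. F (z + s *\<^sub>R d *\<^sub>R n)" "\<lambda>s. slope (d *\<^sub>R n) (z + s *\<^sub>R d *\<^sub>R n)"]
        line_derivative[of z "d *\<^sub>R n"] by auto
    have "slope n (z + s *\<^sub>R d *\<^sub>R n) < 0" using \<rho>(3)[OF inb[of 0 s]] s \<rho>(1) by simp
    then have "slope (d *\<^sub>R n) (z + s *\<^sub>R d *\<^sub>R n) < 0" unfolding slope_d by (rule mult_pos_neg[OF d(1)])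
    then show ?thesis using s(3) by simp
  qed
  then have Fpos: "F z - F (z + d *\<^sub>R n) > 0" by simp
  have Fcont: "continuous_on UNIV (\<lambda>q. F z - F q)" by (intro continuous_intros cont_F)
  have "z + d *\<^sub>R n \<in> ball z \<rho>" using inb[of 0 1] \<rho>(1) by simp
  then obtain \<tau> where \<tau>: "\<tau> > 0" "ball (z + d *\<^sub>R n) \<tau> \<subseteq> ball z \<rho>"
    "\<And>q. q \<in> ball (z + d *\<^sub>R n) \<tau> \<Longrightarrow> F z - F q > 0"
    using neighbourhood_positive[OF Fcont Fpos open_ball] by metis
  define V where "V = ball z (min \<tau> (\<rho> / 2))"
  let ?A = "{q \<in> V. F q \<le> F z}" and ?B = "{q \<in> W. F q \<le> F z}"
  have "homotopic_with_canon (\<lambda>_. True) ?A ?B id (\<lambda>q. q + d *\<^sub>R n)"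
  proof (rule homotopic_with_linear)
    show "closed_segment (id q) (q + d *\<^sub>R n) \<subseteq> ?B" if q: "q \<in> ?A" for q
    proof
      fix x assume "x \<in> closed_segment (id q) (q + d *\<^sub>R n)"
      then obtain s where s: "0 \<le> s" "s \<le> 1" "x = q + s *\<^sub>R d *\<^sub>R n" using segment_point[of x q "d *\<^sub>R n"] by auto
      have q': "norm (q - z) < \<rho> / 2" using q by (simp add: V_def dist_norm norm_minus_commute)
      have inb': "q + u *\<^sub>R d *\<^sub>R n \<in> ball z \<rho>" if "0 \<le> u" "u \<le> 1" for u
        using inb[OF q' that] by simp
      have "F (q + s *\<^sub>R d *\<^sub>R n) \<le> F q"
      proof (rule decreasing_of_slope)
        fix u :: real assume u: "0 \<le> u" "u \<le> 1"
        then have "u * s \<le> 1" "0 \<le> u * s" using s by (auto intro: mult_le_one)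
        then have "slope n (q + (u * s) *\<^sub>R d *\<^sub>R n) < 0" using \<rho>(3)[OF inb'] by simp
        moreover have "slope (s *\<^sub>R d *\<^sub>R n) y = s * d * slope n y" for y by (simp add: slope_def algebra_simps)
        ultimately show "slope (s *\<^sub>R d *\<^sub>R n) (q + u *\<^sub>R s *\<^sub>R d *\<^sub>R n) \<le> 0"
          using s(1) d(1) mult_nonneg_nonpos[of "s * d" "slope n (q + (u * s) *\<^sub>R d *\<^sub>R n)"]
          by (simp add: mult.assoc)
      qed
      then show "x \<in> ?B" using q s inb'[of s] \<rho>(2) by auto
    qed
  qed (auto intro!: continuous_intros)
  moreover have "homotopic_with_canon (\<lambda>_. True) ?A ?B (\<lambda>q. q + d *\<^sub>R n) (\<lambda>_. z + d *\<^sub>R n)"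
  proof (rule homotopic_with_linear)
    show "closed_segment (q + d *\<^sub>R n) (z + d *\<^sub>R n) \<subseteq> ?B" if q: "q \<in> ?A" for q
    proof -
      have "q + d *\<^sub>R n \<in> ball (z + d *\<^sub>R n) \<tau>" using q by (simp add: V_def dist_norm)
      then have "closed_segment (q + d *\<^sub>R n) (z + d *\<^sub>R n) \<subseteq> ball (z + d *\<^sub>R n) \<tau>"
        using \<tau>(1) by (intro closed_segment_subset) auto
      then show ?thesis using \<tau> \<rho>(2) by fastforce
    qed
  qed (auto intro!: continuous_intros)
  ultimately have "homotopic_with_canon (\<lambda>_. True) ?A ?B id (\<lambda>_. z + d *\<^sub>R n)"
    by (rule homotopic_with_trans)
  moreover have "open V" "z \<in> V" "V \<subseteq> W" using \<tau> \<rho> unfolding V_def by auto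
  ultimately show ?thesis by blast
qed

lemma contract_convex:
  assumes "convex {q \<in> V. F q \<le> F z}" "z \<in> V" "V \<subseteq> W"
  shows "homotopic_with_canon (\<lambda>_. True) {q \<in> V. F q \<le> F z} {q \<in> W. F q \<le> F z} id (\<lambda>_. z)"
proof (rule homotopic_with_linear)
  show "closed_segment (id q) z \<subseteq> {q \<in> W. F q \<le> F z}" if "q \<in> {q \<in> V. F q \<le> F z}" for q
    using closed_segment_subset[of q "{q \<in> V. F q \<le> F z}" z] that assms by auto
qed (auto intro!: continuous_intros)

text \<open>Near \<open>z\<close>, \<open>F\<close> is convex along \<open>u\<close> and concave
  along \<open>w\<close>. Projection along \<open>u\<close> to the axis through \<open>z\<close> in
  direction \<open>w\<close> stays in the sublevel set by convexity, because the axis lies in it;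
  then the axis is contracted to \<open>z\<close>.\<close>

lemma contract_saddle:
  assumes crit: "p1 z = 0" "p2 z = 0" and W: "open W" "z \<in> W"
    and u: "curvature u z > 0" and w: "curvature w z < 0"
  shows "\<exists>V o'. open V \<and> z \<in> V \<and> V \<subseteq> W \<and>
    homotopic_with_canon (\<lambda>_. True) {q \<in> V. F q \<le> F z} {q \<in> W. F q \<le> F z} id (\<lambda>_. o')"
proof -
  have hom: "curvature (s *\<^sub>R v) q = s\<^sup>2 * curvature v q" for s v q
    by (simp add: curvature_def algebra_simps power2_eq_square)
  \<comment> \<open>Nonzero because a multiple of \<open>u\<close> cannot have curvature of the
    opposite sign; hence \<open>u\<close> and \<open>w\<close> form a basis.\<close>
  define \<Delta> where "\<Delta> = fst u * snd w - snd u * fst w"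
  have \<Delta>: "\<Delta> \<noteq> 0"
  proof
    assume 0: "\<Delta> = 0"
    have u0: "u \<noteq> 0" using u by (auto simp: curvature_def)
    have "\<exists>s. w = s *\<^sub>R u"
    proof (cases "fst u = 0")
      case True
      then have "snd u \<noteq> 0" using u0 by (simp add: prod_eq_iff)
      then show ?thesis using 0 True by (intro exI[of _ "snd w / snd u"]) (auto simp: \<Delta>_def prod_eq_iff)
    next
      case False
      then show ?thesis using 0
        by (intro exI[of _ "fst w / fst u"]) (auto simp: \<Delta>_def prod_eq_iff field_simps)
    qed
    then show False using hom u w
      by (metis less_imp_le mult_nonneg_nonneg not_less zero_le_power2)
  qed
  obtain r1 where r1: "r1 > 0" "ball z r1 \<subseteq> W" "\<And>q. q \<in> ball z r1 \<Longrightarrow> curvature u q > 0"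
    using neighbourhood_positive[OF continuous_curvature u W] by blast
  obtain \<rho> where \<rho>: "\<rho> > 0" "ball z \<rho> \<subseteq> ball z r1" "\<And>q. q \<in> ball z \<rho> \<Longrightarrow> - curvature w q > 0"
    using neighbourhood_positive[of "\<lambda>q. - curvature w q" z "ball z r1"] continuous_curvature[of w] w r1
    by (metis centre_in_ball continuous_on_minus neg_0_less_iff_less open_ball)
  \<comment> \<open>\<open>\<alpha>\<close> and \<open>\<beta>\<close> are the coordinates of
    \<open>q - z\<close> in the basis \<open>u\<close>, \<open>w\<close>, by Cramer's rule.\<close>
  define \<alpha> where "\<alpha> = (\<lambda>q. (fst (q - z) * snd w - snd (q - z) * fst w) / \<Delta>)"
  define \<beta> where "\<beta> = (\<lambda>q. (fst u * snd (q - z) - snd u * fst (q - z)) / \<Delta>)"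
  have coord: "q = z + \<beta> q *\<^sub>R w + \<alpha> q *\<^sub>R u" for q
  proof -
    have "\<Delta> * fst (q - z) = \<Delta> * (\<beta> q * fst w + \<alpha> q * fst u)" "\<Delta> * snd (q - z) = \<Delta> * (\<beta> q * snd w + \<alpha> q * snd u)"
      using \<Delta> by (simp_all add: \<alpha>_def \<beta>_def distrib_left) (simp_all add: \<Delta>_def algebra_simps)
    then have "fst (q - z) = \<beta> q * fst w + \<alpha> q * fst u" "snd (q - z) = \<beta> q * snd w + \<alpha> q * snd u"
      using \<Delta> mult_left_cancel by blast+
    then show ?thesis by (simp add: prod_eq_iff)
  qed
  define pr where "pr = (\<lambda>q. z + \<beta> q *\<^sub>R w)"
  have cpr: "continuous_on S pr" for S unfolding pr_def \<beta>_def using \<Delta> by (intro continuous_intros) auto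
  have prz: "pr z = z" by (simp add: pr_def \<beta>_def)
  have "open (pr -` ball z \<rho>)" using cpr[of UNIV] by (simp add: open_vimage)
  then have oV: "open (pr -` ball z \<rho> \<inter> ball z \<rho>)" by blast
  \<comment> \<open>Both \<open>q\<close> and its projection must lie in the ball where the
    curvature signs are known; the segment between them then does so too.\<close>
  define V where "V = pr -` ball z \<rho> \<inter> ball z \<rho>"
  let ?A = "{q \<in> V. F q \<le> F z}" and ?B = "{q \<in> W. F q \<le> F z}"
  have axis: "F (z + s *\<^sub>R w) \<le> F z" if "z + s *\<^sub>R w \<in> ball z \<rho>" for s
  proof (cases "s = 0")
    case False
    have "F (z + s *\<^sub>R w) < F z"
    proof (rule second_order_decrease)
      show "slope (s *\<^sub>R w) z = 0" by (simp add: slope_def crit)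
      fix x :: real assume x: "0 \<le> x" "x \<le> 1"
      have "z + x *\<^sub>R s *\<^sub>R w \<in> closed_segment z (z + s *\<^sub>R w)" using x
        by (auto simp: closed_segment_def algebra_simps intro!: exI[of _ x])
      moreover have "closed_segment z (z + s *\<^sub>R w) \<subseteq> ball z \<rho>"
        using that \<rho>(1) by (intro closed_segment_subset) auto
      ultimately have "z + x *\<^sub>R s *\<^sub>R w \<in> ball z \<rho>" by blast
      from \<rho>(3)[OF this] have "curvature w (z + x *\<^sub>R s *\<^sub>R w) < 0" by simp
      then show "curvature (s *\<^sub>R w) (z + x *\<^sub>R s *\<^sub>R w) < 0"
        using False by (simp add: hom mult_pos_neg)
    qed
    then show ?thesis by simp
  qed simp
  have "homotopic_with_canon (\<lambda>_. True) ?A ?B id pr"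
  proof (rule homotopic_with_linear)
    show "closed_segment (id q) (pr q) \<subseteq> ?B" if q: "q \<in> ?A" for q
    proof
      fix x assume x: "x \<in> closed_segment (id q) (pr q)"
      have seg: "closed_segment q (pr q) \<subseteq> ball z \<rho>"
        using q by (intro closed_segment_subset) (auto simp: V_def)
      have q': "q = pr q + \<alpha> q *\<^sub>R u" using coord[of q] by (simp add: pr_def)
      have "x \<in> closed_segment (pr q) (pr q + \<alpha> q *\<^sub>R u)"
        using x q' by (simp add: closed_segment_commute)
      then obtain s where s: "0 \<le> s" "s \<le> 1" "x = pr q + s *\<^sub>R \<alpha> q *\<^sub>R u" using segment_point by blast
      have "F (pr q + s *\<^sub>R \<alpha> q *\<^sub>R u) \<le> F z"
      proof (rule sublevel_convex_along)
        show "F (pr q) \<le> F z" using axis[of "\<beta> q"] q by (simp add: pr_def V_def)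
        show "F (pr q + \<alpha> q *\<^sub>R u) \<le> F z" using q q' by simp
        fix x :: real assume x: "0 \<le> x" "x \<le> 1"
        have "pr q + x *\<^sub>R \<alpha> q *\<^sub>R u \<in> closed_segment (pr q) (pr q + \<alpha> q *\<^sub>R u)" using x
          by (auto simp: closed_segment_def algebra_simps intro!: exI[of _ x])
        then have "pr q + x *\<^sub>R \<alpha> q *\<^sub>R u \<in> ball z \<rho>" using seg q' by (metis closed_segment_commute subsetD)
        then have "curvature u (pr q + x *\<^sub>R \<alpha> q *\<^sub>R u) > 0" using r1(3) \<rho>(2) by blast
        then show "curvature (\<alpha> q *\<^sub>R u) (pr q + x *\<^sub>R \<alpha> q *\<^sub>R u) \<ge> 0" by (simp add: hom)
      qed (use s in auto)
      moreover have "x \<in> ball z \<rho>" using x seg by auto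
      ultimately show "x \<in> ?B" using s \<rho>(2) r1(2) by blast
    qed
  qed (auto intro: cpr)
  moreover have "homotopic_with_canon (\<lambda>_. True) ?A ?B pr (\<lambda>_. z)"
  proof (rule homotopic_with_linear)
    show "closed_segment (pr q) z \<subseteq> ?B" if q: "q \<in> ?A" for q
    proof
      fix x assume x: "x \<in> closed_segment (pr q) z"
      have seg: "closed_segment (pr q) z \<subseteq> ball z \<rho>"
        using q \<rho>(1) by (intro closed_segment_subset) (auto simp: V_def)
      obtain s where s: "x = z + s *\<^sub>R \<beta> q *\<^sub>R w"
        using x segment_point[of x z "\<beta> q *\<^sub>R w"] by (auto simp: pr_def closed_segment_commute)
      then have "F x \<le> F z" using axis[of "s * \<beta> q"] seg x by auto
      then show "x \<in> ?B" using x seg \<rho>(2) r1(2) by blast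
    qed
  qed (auto intro: cpr)
  ultimately have "homotopic_with_canon (\<lambda>_. True) ?A ?B id (\<lambda>_. z)" by (rule homotopic_with_trans)
  moreover have "z \<in> V" "V \<subseteq> W" using prz \<rho> r1 by (auto simp: V_def)
  ultimately show ?thesis using oV unfolding V_def[symmetric] by blast
qed

text \<open>If the form is positive, \<open>z\<close> is a strict local minimum and the sublevel set
  is locally \<open>{z}\<close>; if it is negative, \<open>z\<close> is a local maximum and the
  sublevel set is locally a full ball. Both are convex.\<close>

lemma contract_definite:
  assumes crit: "p1 z = 0" "p2 z = 0" and W: "open W" "z \<in> W"
    and det: "a z * c z - (b z)\<^sup>2 > 0"
  shows "\<exists>V o'. open V \<and> z \<in> V \<and> V \<subseteq> W \<and>
    homotopic_with_canon (\<lambda>_. True) {q \<in> V. F q \<le> F z} {q \<in> W. F q \<le> F z} id (\<lambda>_. o')"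
proof -
  have a0: "a z \<noteq> 0" using det by (auto simp: not_less)
  have cdet: "continuous_on UNIV (\<lambda>q. a q * c q - (b q)\<^sup>2)" by (intro continuous_intros cont)
  obtain r1 where r1: "r1 > 0" "ball z r1 \<subseteq> W" "\<And>q. q \<in> ball z r1 \<Longrightarrow> a q * c q - (b q)\<^sup>2 > 0"
    using neighbourhood_positive[OF cdet det W] by metis
  have zr1: "z \<in> ball z r1" using r1(1) by simp
  \<comment> \<open>Completing the square: where the determinant is positive the form has the sign
    of \<open>a q\<close>.\<close>
  have sq: "a q * curvature v q = (a q * fst v + b q * snd v)\<^sup>2 + (a q * c q - (b q)\<^sup>2) * (snd v)\<^sup>2" for v q
    by (simp add: curvature_def algebra_simps power2_eq_square)
  have def: "a q * curvature v q > 0" if "q \<in> ball z r1" "v \<noteq> 0" "a q \<noteq> 0" for v q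
  proof (cases "snd v = 0")
    case True
    then have "fst v \<noteq> 0" using that by (simp add: prod_eq_iff)
    then show ?thesis using True that(3) unfolding sq by simp
  next
    case False
    then show ?thesis unfolding sq using r1(3)[OF that(1)] by (intro add_nonneg_pos) auto
  qed
  have seg: "z + s *\<^sub>R (q - z) \<in> ball z \<rho>" if "q \<in> ball z \<rho>" "0 \<le> s" "s \<le> 1" for q s \<rho>
  proof -
    have "z + s *\<^sub>R (q - z) \<in> closed_segment z q" using that
      by (auto simp: closed_segment_def algebra_simps intro!: exI[of _ s])
    moreover have "closed_segment z q \<subseteq> ball z \<rho>" using that(1)
      by (intro closed_segment_subset) (auto intro: le_less_trans[OF zero_le_dist])
    ultimately show ?thesis by blast
  qed
  have sl: "slope v z = 0" for v by (simp add: slope_def crit)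
  show ?thesis
  proof (cases "a z > 0")
    case True
    obtain \<rho> where \<rho>: "\<rho> > 0" "ball z \<rho> \<subseteq> ball z r1" "\<And>q. q \<in> ball z \<rho> \<Longrightarrow> a q > 0"
      using neighbourhood_positive[OF cont(1) True open_ball zr1] by metis
    have "F z < F q" if "q \<in> ball z \<rho>" "q \<noteq> z" for q
    proof -
      have "F z < F (z + (q - z))"
      proof (rule second_order_increase[OF sl])
        fix s :: real assume "0 \<le> s" "s \<le> 1"
        then have m: "z + s *\<^sub>R (q - z) \<in> ball z \<rho>" using seg that by blast
        then show "curvature (q - z) (z + s *\<^sub>R (q - z)) > 0"
          using def[of "z + s *\<^sub>R (q - z)" "q - z"] \<rho>(2) \<rho>(3)[OF m] that(2)
          by (auto simp: zero_less_mult_iff)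
      qed
      then show ?thesis by simp
    qed
    then have "{q \<in> ball z \<rho>. F q \<le> F z} = {z}" using \<rho>(1) by force
    then have "convex {q \<in> ball z \<rho>. F q \<le> F z}" by simp
    from contract_convex[OF this] show ?thesis using \<rho> r1 by (intro exI[of _ "ball z \<rho>"] exI[of _ z]) auto
  next
    case False
    then have neg: "- a z > 0" using a0 by simp
    obtain \<rho> where \<rho>: "\<rho> > 0" "ball z \<rho> \<subseteq> ball z r1" "\<And>q. q \<in> ball z \<rho> \<Longrightarrow> - a q > 0"
      using neighbourhood_positive[of "\<lambda>q. - a q", OF continuous_on_minus[OF cont(1)] neg open_ball zr1] by metis
    have "F q \<le> F z" if "q \<in> ball z \<rho>" for q
    proof (cases "q = z")
      case False
      have "F (z + (q - z)) < F z"
      proof (rule second_order_decrease[OF sl])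
        fix s :: real assume "0 \<le> s" "s \<le> 1"
        then have m: "z + s *\<^sub>R (q - z) \<in> ball z \<rho>" using seg that by blast
        then show "curvature (q - z) (z + s *\<^sub>R (q - z)) < 0"
          using def[of "z + s *\<^sub>R (q - z)" "q - z"] \<rho>(2) \<rho>(3)[OF m] False
          by (auto simp: zero_less_mult_iff)
      qed
      then show ?thesis by simp
    qed simp
    then have "{q \<in> ball z \<rho>. F q \<le> F z} = ball z \<rho>" by blast
    then have "convex {q \<in> ball z \<rho>. F q \<le> F z}" by simp
    from contract_convex[OF this] show ?thesis using \<rho> r1 by (intro exI[of _ "ball z \<rho>"] exI[of _ z]) auto
  qed
qed

lemma indefinite_directions:
  assumes "a z * c z - (b z)\<^sup>2 < 0"
  shows "(\<exists>u. curvature u z > 0) \<and> (\<exists>w. curvature w z < 0)"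
proof -
  have e1: "curvature (1, 0) z = a z" by (simp add: curvature_def)
  \<comment> \<open>This vector is conjugate to \<open>(1, 0)\<close> for the Hessian form, so if
    \<open>a z\<close> is nonzero the two directions get opposite signs when the determinant is
    negative.\<close>
  have e2: "curvature (- b z, a z) z = a z * (a z * c z - (b z)\<^sup>2)"
    by (simp add: curvature_def algebra_simps power2_eq_square)
  consider "a z > 0" | "a z < 0" | "a z = 0" by linarith
  then show ?thesis
  proof cases
    case 1
    then have "curvature (- b z, a z) z < 0" unfolding e2 using assms by (rule mult_pos_neg)
    moreover have "curvature (1, 0) z > 0" using 1 by (simp add: e1)
    ultimately show ?thesis by blast
  next
    case 2
    then have "curvature (- b z, a z) z > 0" unfolding e2 using assms by (rule mult_neg_neg)
    moreover have "curvature (1, 0) z < 0" using 2 by (simp add: e1)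
    ultimately show ?thesis by blast
  next
    case 3
    then have b: "b z \<noteq> 0" using assms by auto
    \<comment> \<open>With \<open>a z = 0\<close> the form is affine in \<open>x\<close> and not
      constant; the two points below are where it takes the values 1 and -1.\<close>
    have "curvature (x, 1) z = 2 * b z * x + c z" for x using 3 by (simp add: curvature_def algebra_simps)
    then have "curvature ((1 - c z) / (2 * b z), 1) z = 1" "curvature ((- 1 - c z) / (2 * b z), 1) z = - 1"
      using b by (simp_all add: field_simps)
    then have "0 < curvature ((1 - c z) / (2 * b z), 1) z" "curvature ((- 1 - c z) / (2 * b z), 1) z < 0"
      by linarith+
    then show ?thesis by blast
  qed
qed

lemma contract_local:
  assumes "\<not> (p1 z = 0 \<and> p2 z = 0 \<and> a z * c z - (b z)\<^sup>2 = 0)" and W: "open W" "z \<in> W"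
  shows "\<exists>V o'. open V \<and> z \<in> V \<and> V \<subseteq> W \<and>
    homotopic_with_canon (\<lambda>_. True) {q \<in> V. F q \<le> F z} {q \<in> W. F q \<le> F z} id (\<lambda>_. o')"
proof (cases "p1 z = 0 \<and> p2 z = 0")
  case True
  then consider "a z * c z - (b z)\<^sup>2 > 0" | "a z * c z - (b z)\<^sup>2 < 0" using assms(1) by linarith
  then show ?thesis
  proof cases
    case 1
    then show ?thesis using True by (intro contract_definite W) auto
  next
    case 2
    from indefinite_directions[OF 2] obtain u w where "curvature u z > 0" "curvature w z < 0" by blast
    then show ?thesis using True by (intro contract_saddle[of z W u w] W) auto
  qed
next
  case False
  then show ?thesis by (intro contract_regular W)
qed


end

section \<open>The topology of \<open>F\<^sub>2(S\<^sup>1)\<close>\<close>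

lemma continuous_circle_exp: "continuous_on S circle_exp"
  unfolding circle_exp_def by (intro continuous_intros)

lemma norm_circle_exp [simp]: "cmod (circle_exp t) = 1"
  using circle_exp_in[of t] by simp

lemma circle_exp_add_1: "circle_exp (t + 1) = circle_exp t"
  by (simp add: circle_exp_eq_iff)

lemma Ints_abs_less_1: "(x::real) \<in> \<int> \<Longrightarrow> \<bar>x\<bar> < 1 \<Longrightarrow> x = 0"
  by (auto elim!: Ints_cases)

lemma compact_space_F2: "compact_space F2"
proof -
  have "compact_space (prod_topology (top_of_set S1) (top_of_set S1))"
    unfolding compact_space_prod_topology by (auto simp: compact_space_subtopology)
  then have "compactin F2 ((\<lambda>(z, w). {z, w}) ` topspace (prod_topology (top_of_set S1) (top_of_set S1)))"
    using quotient_imp_continuous_map[OF quotient_map_F2] image_compactin unfolding compact_space_def by blast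
  then show ?thesis
    unfolding compact_space_def using quotient_imp_surjective_map[OF quotient_map_F2] by simp
qed

text \<open>An unordered pair is determined by its elementary symmetric functions.\<close>

lemma Hausdorff_space_F2: "Hausdorff_space F2"
proof -
  define \<Phi> :: "complex set \<Rightarrow> complex \<times> complex" where
    "\<Phi> = (\<lambda>P. THE v. \<exists>z w. P = {z, w} \<and> v = (z + w, z * w))"
  have \<Phi>: "\<Phi> {z, w} = (z + w, z * w)" for z w
    unfolding \<Phi>_def by (rule the_equality) (auto simp: doubleton_eq_iff)
  have "continuous_map (prod_topology (top_of_set S1) (top_of_set S1)) euclidean (\<lambda>p. (fst p + snd p, fst p * snd p))"
    by (auto simp flip: subtopology_Times intro!: continuous_intros)
  then have "continuous_map (prod_topology (top_of_set S1) (top_of_set S1)) euclidean (\<Phi> \<circ> (\<lambda>(z, w). {z, w}))"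
    by (rule continuous_map_eq) (auto simp: \<Phi>)
  then have "continuous_map F2 euclidean \<Phi>"
    using continuous_compose_quotient_map[OF quotient_map_F2] by blast
  moreover have "inj_on \<Phi> (topspace F2)"
  proof (rule inj_onI)
    fix P Q assume "P \<in> topspace F2" "Q \<in> topspace F2" and eq: "\<Phi> P = \<Phi> Q"
    then obtain z w z' w' where P: "P = {z, w}" and Q: "Q = {z', w'}"
      unfolding topspace_F2 F2_set_def by blast
    have s: "z + w = z' + w'" "z * w = z' * w'" using eq by (auto simp: P Q \<Phi>)
    have "(z' - z) * (z' - w) = z' * z' - (z + w) * z' + z * w" by (simp add: algebra_simps)
    also have "\<dots> = 0" unfolding s by (simp add: algebra_simps)
    finally have "z' = z \<or> z' = w" by simp
    then show "P = Q" using s(1) by (auto simp: P Q)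
  qed
  ultimately show ?thesis by (rule Hausdorff_space_injective_preimage[OF Hausdorff_space_euclidean])
qed

lemma continuous_F2_cover: "continuous_map euclidean F2 F2_cover"
proof -
  have "continuous_map euclidean (prod_topology (top_of_set S1) (top_of_set S1))
      (\<lambda>q. (circle_exp (fst q), circle_exp (snd q)))"
    unfolding continuous_map_pairwise o_def
    by (auto simp: continuous_map_in_subtopology circle_exp_in
        intro!: continuous_on_compose2[OF continuous_circle_exp[of UNIV]] continuous_intros)
  from continuous_map_compose[OF this quotient_imp_continuous_map[OF quotient_map_F2]]
  show ?thesis by (simp add: o_def F2_cover_def case_prod_unfold)
qed

lemma F2_cover_in: "F2_cover q \<in> F2_set"
  unfolding F2_cover_def case_prod_unfold by (intro F2_setI circle_exp_in)

text \<open>If the arc from \<open>z\<close> to \<open>w\<close> exceeds half a turn, the arc from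
  \<open>w\<close> to \<open>z\<close> is used, which is the deck transformation. Half the strip
  avoids the second boundary line \<open>y - x = 1\<close>.\<close>

lemma F2_cover_half_strip:
  assumes "P \<in> F2_set"
  obtains x y where "P = F2_cover (x, y)" "0 \<le> y - x" "y - x \<le> 1/2"
proof -
  obtain z w where zw: "P = {z, w}" "z \<in> S1" "w \<in> S1" using assms unfolding F2_set_def by blast
  obtain t s where t: "z = circle_exp t" "w = circle_exp s" using zw circle_exp_surj by metis
  define f where "f = frac (s - t)"
  have f: "0 \<le> f" "f < 1" using frac_ge_0 frac_lt_1 by (auto simp: f_def)
  have w: "w = circle_exp (t + f)" unfolding t circle_exp_eq_iff f_def by (simp add: frac_def)
  show thesis
  proof (cases "f \<le> 1/2")
    case True
    then show ?thesis using that[of t "t + f"] f zw t w by (simp add: F2_cover_def)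
  next
    case False
    have "P = F2_cover (t + f, t + 1)"
      unfolding zw F2_cover_def using w t circle_exp_add_1[of t] by auto
    then show ?thesis using that[of "t + f" "t + 1"] False f by simp
  qed
qed

text \<open>The complementary arc is the image of a compact interval, hence closed.\<close>

lemma openin_arc:
  assumes "0 < r" "r \<le> 1/2"
  shows "openin (top_of_set S1) (circle_exp ` ball x r)"
proof -
  have "circle_exp ` ball x r = S1 - circle_exp ` {x + r..x + 1 - r}"
  proof (intro equalityI subsetI)
    fix z assume "z \<in> circle_exp ` ball x r"
    then obtain t where t: "z = circle_exp t" "\<bar>x - t\<bar> < r" by (auto simp: dist_real_def)
    have "z \<noteq> circle_exp s" if "s \<in> {x + r..x + 1 - r}" for s
    proof
      assume "z = circle_exp s"
      then have "s - t \<in> \<int>" using t circle_exp_eq_iff[of s t] by simp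
      then have "s - t = 0" by (rule Ints_abs_less_1) (use that t in \<open>auto simp: abs_less_iff\<close>)
      then show False using that t by (auto simp: abs_less_iff)
    qed
    then have "z \<notin> circle_exp ` {x + r..x + 1 - r}" by blast
    then show "z \<in> S1 - circle_exp ` {x + r..x + 1 - r}" using t(1) circle_exp_in by blast
  next
    fix z assume z: "z \<in> S1 - circle_exp ` {x + r..x + 1 - r}"
    then obtain t where t: "z = circle_exp t" using circle_exp_surj by blast
    \<comment> \<open>The representative in the window of length 1 that starts at
      \<open>x - r\<close>. Its left end is identified with \<open>x + 1 - r\<close>, which belongs
      to the removed arc.\<close>
    define s where "s = x - r + frac (t - (x - r))"
    have s: "z = circle_exp s" unfolding t circle_exp_eq_iff s_def by (simp add: frac_def)
    have s1: "x - r \<le> s" "s < x - r + 1"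
      using frac_ge_0[of "t - (x - r)"] frac_lt_1[of "t - (x - r)"] by (auto simp: s_def)
    have "s \<noteq> x - r"
    proof
      assume "s = x - r"
      then have "z = circle_exp (x + 1 - r)" unfolding s circle_exp_eq_iff by simp
      then show False using z assms by auto
    qed
    moreover have "s \<notin> {x + r..x + 1 - r}" using z s by blast
    ultimately have "s \<in> ball x r" using s1 by (auto simp: dist_real_def abs_less_iff)
    then show "z \<in> circle_exp ` ball x r" using s by blast
  qed
  moreover have "closed (circle_exp ` {x + r..x + 1 - r})"
    by (intro compact_imp_closed compact_continuous_image continuous_circle_exp) auto
  ultimately show ?thesis by (metis Diff_eq openin_open open_Compl)
qed

text \<open>Upstairs on the torus the set becomes the union of a product of arcs and its mirror
  image. Off the diagonal the condition \<open>2 * r < y - x\<close> keeps the box inside the strip;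
  on the diagonal, a pair in the wrong order is swapped back into it.\<close>

lemma openin_F2_box:
  assumes xy: "0 \<le> y - x" "y - x \<le> 1/2" and r: "0 < r" "r \<le> 1/16" "x < y \<Longrightarrow> 2 * r < y - x"
  shows "openin F2 (F2_cover ` (strip \<inter> (ball x r \<times> ball y r)))"
proof -
  let ?A = "circle_exp ` ball x r" and ?B = "circle_exp ` ball y r"
  have im: "F2_cover ` (strip \<inter> (ball x r \<times> ball y r)) = {{z, w} |z w. z \<in> ?A \<and> w \<in> ?B}"
  proof (intro equalityI subsetI)
    fix P assume "P \<in> {{z, w} |z w. z \<in> ?A \<and> w \<in> ?B}"
    then obtain s t where st: "s \<in> ball x r" "t \<in> ball y r" "P = {circle_exp s, circle_exp t}" by blast
    then have *: "\<bar>s - x\<bar> < r" "\<bar>t - y\<bar> < r" by (auto simp: dist_real_def abs_minus_commute)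
    show "P \<in> F2_cover ` (strip \<inter> (ball x r \<times> ball y r))"
    proof (cases "s \<le> t")
      case True
      then have "(s, t) \<in> strip" using * r xy by (auto simp: strip_def abs_less_iff)
      then show ?thesis using st by (intro image_eqI[of _ _ "(s, t)"]) (auto simp: F2_cover_def)
    next
      case False
      then have "\<not> x < y" using * r by (auto simp: abs_less_iff)
      then have "x = y" using xy by simp
      moreover have "(t, s) \<in> strip" using * r xy False \<open>x = y\<close> by (auto simp: strip_def abs_less_iff)
      ultimately show ?thesis using st by (intro image_eqI[of _ _ "(t, s)"]) (auto simp: F2_cover_def)
    qed
  qed (auto simp: F2_cover_def)
  have sub: "?A \<subseteq> S1" "?B \<subseteq> S1" using circle_exp_in by blast+
  have "{(z, w). z \<in> S1 \<and> w \<in> S1 \<and> {z, w} \<in> {{z, w} |z w. z \<in> ?A \<and> w \<in> ?B}} = ?A \<times> ?B \<union> ?B \<times> ?A"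
    using sub by (auto simp: doubleton_eq_iff)
  moreover have "openin (prod_topology (top_of_set S1) (top_of_set S1)) (?A \<times> ?B \<union> ?B \<times> ?A)"
    using openin_arc[of r x] openin_arc[of r y] r
    by (intro openin_Un) (simp_all only: openin_prod_Times_iff, simp_all)
  moreover have "{{z, w} |z w. z \<in> ?A \<and> w \<in> ?B} \<subseteq> F2_set" using sub F2_setI by blast
  ultimately show ?thesis unfolding openin_F2 im by simp
qed

text \<open>All differences that occur are below 1, as 1/2 + 2/16 < 1, so congruence modulo integers
  is equality. A swapped pair then forces \<open>a = b\<close>, since both points satisfy the order
  of the strip.\<close>

lemma inj_on_F2_cover_box:
  assumes xy: "0 \<le> y - x" "y - x \<le> 1/2" and r: "r \<le> 1/16"
  shows "inj_on F2_cover (strip \<inter> (cball x r \<times> cball y r))"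
proof (rule inj_onI, clarify)
  fix a b a' b' assume s: "(a, b) \<in> strip" "(a', b') \<in> strip"
    and m: "a \<in> cball x r" "b \<in> cball y r" "a' \<in> cball x r" "b' \<in> cball y r"
    and eq: "F2_cover (a, b) = F2_cover (a', b')"
  have m': "\<bar>a - x\<bar> \<le> 1/16" "\<bar>b - y\<bar> \<le> 1/16" "\<bar>a' - x\<bar> \<le> 1/16" "\<bar>b' - y\<bar> \<le> 1/16"
    using m r by (auto simp: dist_real_def abs_minus_commute)
  have s': "a \<le> b" "a' \<le> b'" using s by (auto simp: strip_def)
  consider "circle_exp a = circle_exp a'" "circle_exp b = circle_exp b'"
    | "circle_exp a = circle_exp b'" "circle_exp b = circle_exp a'"
    using eq by (auto simp: F2_cover_def doubleton_eq_iff)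
  then show "a = a' \<and> b = b'"
  proof cases
    case 1
    then have "a - a' = 0" "b - b' = 0"
      using m' by (auto simp only: circle_exp_eq_iff intro!: Ints_abs_less_1)
    then show ?thesis by simp
  next
    case 2
    then have "a - b' \<in> \<int>" "b - a' \<in> \<int>" unfolding circle_exp_eq_iff by auto
    moreover have "\<bar>a - b'\<bar> < 1" "\<bar>b - a'\<bar> < 1" using m' xy by linarith+
    ultimately have "a - b' = 0" "b - a' = 0" using Ints_abs_less_1 by blast+
    then show ?thesis using s' by simp
  qed
qed

text \<open>A continuous injection of a compact space into a Hausdorff space is a homeomorphism onto
  its image.\<close>

lemma F2_chart_inverse:
  assumes E: "compact E" "inj_on F2_cover E"
  obtains \<psi> where "continuous_map (subtopology F2 (F2_cover ` E)) (top_of_set E) \<psi>"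
    "\<And>q. q \<in> E \<Longrightarrow> \<psi> (F2_cover q) = q"
proof -
  let ?Y = "subtopology F2 (F2_cover ` E)"
  have top: "topspace ?Y = F2_cover ` E" using F2_cover_in by (auto simp: topspace_F2)
  have "homeomorphic_map (top_of_set E) ?Y F2_cover"
  proof (rule continuous_imp_homeomorphic_map)
    show "continuous_map (top_of_set E) ?Y F2_cover"
      using continuous_F2_cover
      by (auto simp: continuous_map_in_subtopology intro: continuous_map_from_subtopology)
    show "compact_space (top_of_set E)" using E by (simp add: compact_space_subtopology)
    show "Hausdorff_space ?Y" by (rule Hausdorff_space_subtopology[OF Hausdorff_space_F2])
  qed (use E top in auto)
  then obtain \<psi> where "homeomorphic_maps (top_of_set E) ?Y F2_cover \<psi>"
    using homeomorphic_map_maps by blast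
  then show thesis using that unfolding homeomorphic_maps_def by auto
qed

section \<open>Persistent homology of nondegenerate chord functions\<close>

lemma continuous_half_sq_dist:
  assumes "Ck_open k UNIV g"
  shows "continuous_on S (half_sq_dist g)"
  using Ck_open_mono[OF Ck_open_half_sq_dist[OF assms], of 0] by (auto intro: continuous_on_subset)

lemma C2_plane_function_half_sq_dist:
  assumes "Ck_open k UNIV g" "k \<ge> 2"
  shows "C2_plane_function (half_sq_dist g) (\<lambda>q. chord_fst g (fst q) (snd q)) (\<lambda>q. - chord_snd g (fst q) (snd q))
    (\<lambda>q. hess_xx g (fst q) (snd q)) (\<lambda>q. hess_xy g (fst q) (snd q)) (\<lambda>q. hess_yy g (fst q) (snd q))"
proof
  have c: "continuous_on UNIV (iterated_derivative j g)" if "j \<le> 2" for j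
    using continuous_iterated_derivative[OF assms(1)] that assms(2) by simp
  have cf: "continuous_on UNIV (\<lambda>q::real \<times> real. iterated_derivative j g (fst q))"
    "continuous_on UNIV (\<lambda>q::real \<times> real. iterated_derivative j g (snd q))" if "j \<le> 2" for j
    by (auto intro!: continuous_on_compose2[OF c[OF that]] continuous_intros)
  note cont = cf[of 0] cf[of 1] cf[of 2]
  show "continuous_on UNIV (\<lambda>q. hess_xx g (fst q) (snd q))"
    "continuous_on UNIV (\<lambda>q. hess_xy g (fst q) (snd q))"
    "continuous_on UNIV (\<lambda>q. hess_yy g (fst q) (snd q))"
    unfolding hess_xx_def hess_xy_def hess_yy_def using cont by (auto intro!: continuous_intros)
  show "(half_sq_dist g has_derivative
      (\<lambda>v. chord_fst g (fst q) (snd q) * fst v + - chord_snd g (fst q) (snd q) * snd v)) (at q)" for q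
    using has_derivative_half_sq_dist[OF assms, of q] by simp
  show "((\<lambda>q. chord_fst g (fst q) (snd q)) has_derivative
      (\<lambda>v. hess_xx g (fst q) (snd q) * fst v + hess_xy g (fst q) (snd q) * snd v)) (at q)" for q
    by (rule has_derivative_chord_fst[OF assms])
  show "((\<lambda>q. - chord_snd g (fst q) (snd q)) has_derivative
      (\<lambda>v. hess_xy g (fst q) (snd q) * fst v + hess_yy g (fst q) (snd q) * snd v)) (at q)" for q
    by (rule has_derivative_eq_rhs[OF has_derivative_minus[OF has_derivative_chord_snd[OF assms, of q]]])
      (simp add: fun_eq_iff)
qed

text \<open>Strictly below the level, a convex piece of the strip does. On the diagonal at its own
  level \<open>t = 0\<close>, injectivity leaves only diagonal points, which form a convex set. At
  an interior point of level \<open>t\<close>, the box avoids the boundary and the planar result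
  \<open>contract_local\<close> applies.\<close>

lemma strip_sublevel_contraction:
  assumes g: "Ck_open k UNIV g" "k \<ge> 2" and inj: "\<And>x y. g x = g y \<Longrightarrow> x - y \<in> \<int>"
    and nd: "\<And>x y. 0 < y - x \<Longrightarrow> y - x < 1 \<Longrightarrow> nondegenerate_chord g x y"
    and xy: "0 \<le> y - x" "y - x \<le> 1/2" and R: "0 < R" "R \<le> 1/16" "x < y \<Longrightarrow> 2 * R < y - x"
    and t: "half_sq_dist g (x, y) \<le> t"
  defines "W \<equiv> ball x R \<times> ball y R"
  shows "\<exists>V o'. open V \<and> (x, y) \<in> V \<and> V \<subseteq> W \<and>
    homotopic_with_canon (\<lambda>_. True) {q \<in> strip \<inter> V. half_sq_dist g q \<le> t} {q \<in> strip \<inter> W. half_sq_dist g q \<le> t} id (\<lambda>_. o')"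
proof -
  let ?F = "half_sq_dist g"
  have W: "open W" "(x, y) \<in> W" using R by (auto simp: W_def intro: open_Times)
  have WD: "\<bar>a - x\<bar> < 1/16 \<and> \<bar>b - y\<bar> < 1/16 \<and> \<bar>a - x\<bar> < R \<and> \<bar>b - y\<bar> < R" if "(a, b) \<in> W" for a b
    using that R by (auto simp: W_def dist_real_def abs_minus_commute)
  have strip: "(x, y) \<in> strip" using xy by (simp add: strip_def)
  have convex_strip: "convex strip"
  proof -
    have eq: "strip = {q. inner (1, - 1) q \<le> 0} \<inter> {q. inner (- 1, 1) q \<le> 1}"
      by (auto simp: strip_def inner_prod_def)
    show ?thesis unfolding eq by (intro convex_Int convex_halfspace_le)
  qed
  consider "?F (x, y) < t" | "?F (x, y) = t" "x = y" | "?F (x, y) = t" "x < y"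
    using t xy by linarith
  then show ?thesis
  proof cases
    case 1
    have "open (W \<inter> {q. ?F q < t})"
      by (intro open_Int W open_Collect_less continuous_half_sq_dist[OF g(1)] continuous_on_const)
    then obtain e where e: "e > 0" "ball (x, y) e \<subseteq> W \<inter> {q. ?F q < t}"
      using 1 W open_contains_ball[of "W \<inter> {q. ?F q < t}"] by blast
    let ?V = "ball (x, y) e"
    have "{q \<in> strip \<inter> ?V. ?F q \<le> t} = strip \<inter> ?V" using e by force
    moreover have "homotopic_with_canon (\<lambda>_. True) (strip \<inter> ?V) {q \<in> strip \<inter> W. ?F q \<le> t} id (\<lambda>_. (x, y))"
    proof (rule homotopic_with_linear)
      show "closed_segment (id q) (x, y) \<subseteq> {q \<in> strip \<inter> W. ?F q \<le> t}" if "q \<in> strip \<inter> ?V" for q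
      proof -
        have "closed_segment q (x, y) \<subseteq> strip \<inter> ?V"
          using that strip e(1) convex_strip by (intro closed_segment_subset convex_Int) auto
        then show ?thesis using e by fastforce
      qed
    qed (auto intro!: continuous_intros)
    ultimately show ?thesis using e by (intro exI[of _ ?V] exI[of _ "(x, y)"]) auto
  next
    case 2
    then have t0: "t = 0" by (simp add: half_sq_dist_def)
    have diag: "a = b" if q: "(a, b) \<in> W" "?F (a, b) \<le> t" for a b
    proof -
      have "g a = g b" using q(2) t0 by (simp add: half_sq_dist_def)
      then have "a - b \<in> \<int>" by (rule inj)
      then have "a - b = 0" by (rule Ints_abs_less_1) (use WD[OF q(1)] 2 in linarith)
      then show ?thesis by simp
    qed
    have "homotopic_with_canon (\<lambda>_. True) {q \<in> strip \<inter> W. ?F q \<le> t} {q \<in> strip \<inter> W. ?F q \<le> t} id (\<lambda>_. (x, y))"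
    proof (rule homotopic_with_linear)
      show "closed_segment (id q) (x, y) \<subseteq> {q \<in> strip \<inter> W. ?F q \<le> t}" if q: "q \<in> {q \<in> strip \<inter> W. ?F q \<le> t}" for q
      proof
        fix p assume p: "p \<in> closed_segment (id q) (x, y)"
        have "convex W" unfolding W_def by (intro convex_Times) auto
        then have "closed_segment q (x, y) \<subseteq> strip \<inter> W"
          using q strip W convex_strip by (intro closed_segment_subset convex_Int) auto
        then have pW: "p \<in> strip \<inter> W" using p by auto
        have "fst q = snd q" using diag[of "fst q" "snd q"] q by simp
        then have "fst p = snd p" using p 2 by (auto simp: closed_segment_def)
        then have "?F p = 0" by (simp add: half_sq_dist_def case_prod_unfold)
        then show "p \<in> {q \<in> strip \<inter> W. ?F q \<le> t}" using pW t0 by simp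
      qed
    qed (auto intro!: continuous_intros)
    then show ?thesis using W by blast
  next
    case 3
    interpret C2_plane_function ?F "\<lambda>q. chord_fst g (fst q) (snd q)" "\<lambda>q. - chord_snd g (fst q) (snd q)"
      "\<lambda>q. hess_xx g (fst q) (snd q)" "\<lambda>q. hess_xy g (fst q) (snd q)" "\<lambda>q. hess_yy g (fst q) (snd q)"
      by (rule C2_plane_function_half_sq_dist[OF g])
    have "nondegenerate_chord g x y" using nd xy 3 by simp
    then obtain V o' where V: "open V" "(x, y) \<in> V" "V \<subseteq> W"
      "homotopic_with_canon (\<lambda>_. True) {q \<in> V. ?F q \<le> ?F (x, y)} {q \<in> W. ?F q \<le> ?F (x, y)} id (\<lambda>_. o')"
      using contract_local[of "(x, y)", OF _ W] by (auto simp: nondegenerate_chord_def hess_det_def)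
    have "W \<subseteq> strip"
    proof clarify
      fix a b assume "(a, b) \<in> W"
      from WD[OF this] show "(a, b) \<in> strip" using R(3) 3 xy by (simp add: strip_def abs_less_iff)
    qed
    then have "strip \<inter> V = V" "strip \<inter> W = W" using V(3) by blast+
    then have e: "{q \<in> strip \<inter> V. ?F q \<le> t} = {q \<in> V. ?F q \<le> t}" "{q \<in> strip \<inter> W. ?F q \<le> t} = {q \<in> W. ?F q \<le> t}"
      by simp_all
    have "homotopic_with_canon (\<lambda>_. True) {q \<in> strip \<inter> V. ?F q \<le> t} {q \<in> strip \<inter> W. ?F q \<le> t} id (\<lambda>_. o')"
      using V(4) unfolding 3 e .
    with V(1-3) show ?thesis by (intro exI conjI)
  qed
qed

lemma open_contains_box:
  fixes x y :: real
  assumes "open W" "(x, y) \<in> W"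
  obtains r where "r > 0" "\<And>s. s \<le> r \<Longrightarrow> cball x s \<times> cball y s \<subseteq> W"
proof -
  obtain A B where "open A" "open B" "(x, y) \<in> A \<times> B" "A \<times> B \<subseteq> W"
    by (rule open_prod_elim[OF assms])
  then have AB: "open A" "open B" "x \<in> A" "y \<in> B" "A \<times> B \<subseteq> W" by simp_all
  obtain r1 r2 where "r1 > 0" "cball x r1 \<subseteq> A" "r2 > 0" "cball y r2 \<subseteq> B"
    using AB(1-4) open_contains_cball[of A] open_contains_cball[of B] by blast
  then have "cball x s \<times> cball y s \<subseteq> W" if "s \<le> min r1 r2" for s
  proof -
    have "cball x s \<subseteq> cball x r1" "cball y s \<subseteq> cball y r2" using that by (auto intro: subset_cball)
    then show ?thesis using \<open>cball x r1 \<subseteq> A\<close> \<open>cball y r2 \<subseteq> B\<close> AB(5) by blast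
  qed
  then show thesis using that[of "min r1 r2"] \<open>r1 > 0\<close> \<open>r2 > 0\<close> by simp
qed

text \<open>The contraction in the strip is conjugated with the covering, restricted to a box on
  which it has a continuous inverse \<open>\<psi>\<close>.\<close>

lemma sublevel_locally_contractible:
  fixes \<gamma> :: "complex \<Rightarrow> 'v::real_inner" and t :: real
  assumes g: "Ck_open k UNIV (\<gamma> \<circ> circle_exp)" "k \<ge> 2" and inj: "inj_on \<gamma> S1"
    and nd: "\<And>x y. 0 < y - x \<Longrightarrow> y - x < 1 \<Longrightarrow> nondegenerate_chord (\<gamma> \<circ> circle_exp) x y"
  defines "X \<equiv> sublevel F2 (half_sq_chord \<gamma>) t"
  assumes U: "openin X U" "P \<in> U"
  shows "\<exists>V a. openin X V \<and> P \<in> V \<and> V \<subseteq> U \<and>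
      homotopic_with (\<lambda>_. True) (subtopology X V) (subtopology X U) id (\<lambda>_. a)"
proof -
  let ?g = "\<gamma> \<circ> circle_exp" and ?F = "half_sq_dist (\<gamma> \<circ> circle_exp)"
  let ?S = "{P \<in> F2_set. half_sq_chord \<gamma> P \<le> t}"
  have X: "X = subtopology F2 ?S" by (simp add: X_def sublevel_def topspace_F2)
  have Fc: "half_sq_chord \<gamma> (F2_cover q) = ?F q" for q using fun_cong[OF half_sq_chord_cover[of \<gamma>], of q] by simp
  obtain U' where U': "openin F2 U'" "U = U' \<inter> ?S" using U(1) unfolding X openin_subtopology by blast
  have P: "P \<in> F2_set" "half_sq_chord \<gamma> P \<le> t" "P \<in> U'" using U(2) U' by auto
  obtain x y where xy: "P = F2_cover (x, y)" "0 \<le> y - x" "y - x \<le> 1/2" using F2_cover_half_strip[OF P(1)] .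
  have "open (F2_cover -` U')"
    using openin_continuous_map_preimage[OF continuous_F2_cover U'(1)] by (simp add: vimage_def)
  then obtain R0 where R0: "R0 > 0" "\<And>s. s \<le> R0 \<Longrightarrow> cball x s \<times> cball y s \<subseteq> F2_cover -` U'"
    using open_contains_box[of "F2_cover -` U'" x y] P(3) xy(1) by blast
  \<comment> \<open>\<open>R0\<close> keeps the box inside the given neighbourhood, 1/16 makes the
    covering injective on it, and a third of \<open>y - x\<close> keeps it off the diagonal.\<close>
  define R where "R = (if x < y then min (min R0 (1/16)) ((y - x) / 3) else min R0 (1/16))"
  have R: "0 < R" "R \<le> 1/16" "x < y \<Longrightarrow> 2 * R < y - x" "R \<le> R0"
    using R0(1) by (auto simp: R_def min_def)
  let ?W = "ball x R \<times> ball y R"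
  have injg: "a - b \<in> \<int>" if "?g a = ?g b" for a b
    using that inj circle_exp_in by (auto simp: inj_on_def simp flip: circle_exp_eq_iff)
  obtain V0 o' where V0: "open V0" "(x, y) \<in> V0" "V0 \<subseteq> ?W"
    "homotopic_with_canon (\<lambda>_. True) {q \<in> strip \<inter> V0. ?F q \<le> t} {q \<in> strip \<inter> ?W. ?F q \<le> t} id (\<lambda>_. o')"
    using strip_sublevel_contraction[OF g injg nd xy(2,3) R(1-3), of t] P(2) Fc xy(1) by auto
  obtain r0 where r0: "r0 > 0" "\<And>s. s \<le> r0 \<Longrightarrow> cball x s \<times> cball y s \<subseteq> V0"
    using open_contains_box[OF V0(1,2)] by blast
  define r where "r = min r0 R"
  have r: "0 < r" "r \<le> R" "r \<le> r0" using r0 R by (auto simp: r_def)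
  let ?w = "ball x r \<times> ball y r"
  have wV: "?w \<subseteq> V0" using r0(2)[OF r(3)] by (meson Sigma_mono ball_subset_cball order_trans)
  let ?Lr = "{q \<in> strip \<inter> ?w. ?F q \<le> t}" and ?LR = "{q \<in> strip \<inter> ?W. ?F q \<le> t}"
  have hom: "homotopic_with_canon (\<lambda>_. True) ?Lr ?LR id (\<lambda>_. o')"
    by (rule homotopic_with_subset_left[OF V0(4)]) (use wV in blast)
  \<comment> \<open>Closed balls make \<open>E\<close> compact, as is required for continuity of the
    inverse.\<close>
  define E where "E = strip \<inter> (cball x R \<times> cball y R)"
  have "closed strip"
  proof -
    have eq: "strip = {q. 0 \<le> snd q - fst q} \<inter> {q. snd q - fst q \<le> 1}" by (auto simp: strip_def)
    show ?thesis unfolding eq by (intro closed_Int closed_Collect_le continuous_intros)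
  qed
  then have "compact E" unfolding E_def by (intro closed_Int_compact compact_Times) auto
  moreover have "inj_on F2_cover E" unfolding E_def by (rule inj_on_F2_cover_box[OF xy(2,3) R(2)])
  ultimately obtain \<psi> where \<psi>: "continuous_map (subtopology F2 (F2_cover ` E)) (top_of_set E) \<psi>"
    "\<And>q. q \<in> E \<Longrightarrow> \<psi> (F2_cover q) = q" using F2_chart_inverse by blast
  have LE: "?Lr \<subseteq> E" using r(2) by (auto simp: E_def)
  define V where "V = F2_cover ` ?Lr"
  have Veq: "V = F2_cover ` (strip \<inter> ?w) \<inter> ?S"
    unfolding V_def using Fc F2_cover_in by auto
  have "openin F2 (F2_cover ` (strip \<inter> ?w))"
    using r R by (intro openin_F2_box[OF xy(2,3)]) auto
  then have oV: "openin X V" unfolding X Veq openin_subtopology by blast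
  have PV: "P \<in> V"
    using xy r P(2) Fc unfolding V_def by (auto intro!: image_eqI[of _ _ "(x, y)"] simp: strip_def)
  have LU: "F2_cover ` ?LR \<subseteq> U"
  proof -
    have "?W \<subseteq> F2_cover -` U'" using R0(2)[OF R(4)] by (meson Sigma_mono ball_subset_cball order_trans)
    then show ?thesis using Fc F2_cover_in U'(2) by auto
  qed
  have VU: "V \<subseteq> U" using LU r(2) unfolding V_def by fastforce
  have "continuous_map (top_of_set ?LR) F2 F2_cover"
    by (rule continuous_map_from_subtopology[OF continuous_F2_cover])
  then have cU: "continuous_map (top_of_set ?LR) (subtopology X U) F2_cover"
    using LU U'(2) unfolding X by (auto simp: continuous_map_in_subtopology image_subset_iff)
  have sub: "subtopology X V = subtopology (subtopology F2 (F2_cover ` E)) V"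
  proof -
    have "?S \<inter> V = V" using Veq by blast
    moreover have "F2_cover ` E \<inter> V = V" using LE unfolding V_def by blast
    ultimately show ?thesis unfolding X by (simp only: subtopology_subtopology)
  qed
  have "\<psi> ` V \<subseteq> ?Lr"
  proof (rule image_subsetI)
    fix v assume "v \<in> V"
    then obtain q where "q \<in> ?Lr" "v = F2_cover q" unfolding V_def by blast
    then show "\<psi> v \<in> ?Lr" using \<psi>(2)[of q] LE by auto
  qed
  then have cV: "continuous_map (subtopology X V) (top_of_set ?Lr) \<psi>"
    using \<psi>(1) unfolding sub
    by (auto simp: continuous_map_in_subtopology image_subset_iff intro: continuous_map_from_subtopology)
  have "homotopic_with (\<lambda>_. True) (subtopology X V) (subtopology X U) (F2_cover \<circ> (id \<circ> \<psi>)) (F2_cover \<circ> ((\<lambda>_. o') \<circ> \<psi>))"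
    by (rule homotopic_with_compose_continuous_map_left[OF
          homotopic_with_compose_continuous_map_right[OF hom cV] cU]) auto
  moreover have "F2_cover (\<psi> v) = v" if v: "v \<in> V" for v
  proof -
    obtain q where "q \<in> ?Lr" "v = F2_cover q" using v unfolding V_def by blast
    then show ?thesis using \<psi>(2)[of q] LE by auto
  qed
  ultimately have "homotopic_with (\<lambda>_. True) (subtopology X V) (subtopology X U) id (\<lambda>_. F2_cover o')"
    by (elim homotopic_with_eq) auto
  then show ?thesis using oV PV VU by blast
qed

text \<open>The sublevel set is the image of a compact set of parameters: an integer translation
  brings \<open>x\<close> into [0, 1), and \<open>y - x \<le> 1/2\<close> then leaves
  \<open>y\<close> in [0, 2].\<close>

lemma closedin_half_sq_chord_le:
  fixes \<gamma> :: "complex \<Rightarrow> 'v::real_inner"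
  assumes "Ck_open k UNIV (\<gamma> \<circ> circle_exp)"
  shows "closedin F2 {P \<in> F2_set. half_sq_chord \<gamma> P \<le> t}"
proof -
  have Fc: "half_sq_chord \<gamma> (F2_cover q) = half_sq_dist (\<gamma> \<circ> circle_exp) q" for q
    using fun_cong[OF half_sq_chord_cover[of \<gamma>], of q] by simp
  have q: "F2_cover ` ({0..1} \<times> {0..2} \<inter> {q. half_sq_dist (\<gamma> \<circ> circle_exp) q \<le> t}) =
      {P \<in> F2_set. half_sq_chord \<gamma> P \<le> t}" (is "F2_cover ` ?K = ?S")
  proof (intro equalityI subsetI)
    fix P assume "P \<in> F2_cover ` ?K"
    then show "P \<in> ?S" using Fc F2_cover_in by auto
  next
    fix P assume P: "P \<in> ?S"
    then obtain x y where xy: "P = F2_cover (x, y)" "0 \<le> y - x" "y - x \<le> 1/2"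
      using F2_cover_half_strip by blast
    let ?n = "real_of_int \<lfloor>x\<rfloor>"
    have "P = F2_cover (x - ?n, y - ?n)"
    proof -
      have "circle_exp (a - ?n) = circle_exp a" for a by (simp add: circle_exp_eq_iff)
      then show ?thesis by (simp add: xy F2_cover_def)
    qed
    moreover have "(x - ?n, y - ?n) \<in> ?K"
      using P calculation Fc xy(2,3) by (auto simp: floor_le_iff) linarith+
    ultimately show "P \<in> F2_cover ` ?K" by blast
  qed
  have "closed {q. half_sq_dist (\<gamma> \<circ> circle_exp) q \<le> t}"
    by (intro closed_Collect_le continuous_half_sq_dist[OF assms] continuous_on_const)
  then have "compact ?K" by (intro compact_Int_closed compact_Times) auto
  then have "compactin F2 (F2_cover ` ?K)"
    using image_compactin[OF _ continuous_F2_cover] by (simp add: compactin_euclidean_iff)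
  then show ?thesis unfolding q using Hausdorff_space_F2 compactin_imp_closedin by blast
qed

lemma chord_nonneg: "P \<in> F2_set \<Longrightarrow> chord \<gamma> P \<ge> 0"
  unfolding F2_set_def by (auto simp: chord_pair)

lemma persistence_finite_dimensional:
  fixes \<gamma> :: "complex \<Rightarrow> 'v::real_inner"
  assumes g: "Ck_open k UNIV (\<gamma> \<circ> circle_exp)" "k \<ge> 2" and inj: "inj_on \<gamma> S1"
    and nd: "\<And>x y. 0 < y - x \<Longrightarrow> y - x < 1 \<Longrightarrow> nondegenerate_chord (\<gamma> \<circ> circle_exp) x y"
  shows "pointwise_finite_dimensional (sublevel_persistence i F2 (half_sq_chord \<gamma>) ::
           ('k::field, (complex set, 'k) field_chain set) persistence_module)"
    and "pointwise_finite_dimensional (sublevel_persistence i F2 (chord \<gamma>) ::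
           ('k::field, (complex set, 'k) field_chain set) persistence_module)"
proof -
  have fd: "vectorspace.fin_dim coefficient_field
     (field_homology i (sublevel F2 (half_sq_chord \<gamma>) t) :: ('k, (complex set, 'k) field_chain set) module)" for t
  proof (rule fin_dim_field_homology_compact)
    show "compact_space (sublevel F2 (half_sq_chord \<gamma>) t)"
      unfolding sublevel_def topspace_F2 using closedin_half_sq_chord_le[OF g(1)] compact_space_F2
      by (intro compact_space_subtopology closedin_compact_space) auto
    show "Hausdorff_space (sublevel F2 (half_sq_chord \<gamma>) t)"
      unfolding sublevel_def by (rule Hausdorff_space_subtopology[OF Hausdorff_space_F2])
  qed (rule sublevel_locally_contractible[OF g inj nd])
  then show "pointwise_finite_dimensional (sublevel_persistence i F2 (half_sq_chord \<gamma>) ::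
           ('k, (complex set, 'k) field_chain set) persistence_module)"
    by (simp add: pointwise_finite_dimensional_def sublevel_persistence_def)
  \<comment> \<open>Chord lengths are nonnegative, so squaring identifies the two filtrations; for
    negative \<open>s\<close> both sides are empty, and -1 stands for any negative level.\<close>
  have "sublevel F2 (chord \<gamma>) s = sublevel F2 (half_sq_chord \<gamma>) (if s \<ge> 0 then s\<^sup>2 / 2 else - 1)" for s
  proof -
    have "chord \<gamma> P \<le> s \<longleftrightarrow> half_sq_chord \<gamma> P \<le> (if s \<ge> 0 then s\<^sup>2 / 2 else - 1)" if "P \<in> F2_set" for P
    proof -
      have c: "chord \<gamma> P \<ge> 0" by (rule chord_nonneg[OF that])
      show ?thesis
      proof (cases "s \<ge> 0")
        case True
        then show ?thesis using c power_mono_iff[of "chord \<gamma> P" s 2] by (simp add: half_sq_chord_def)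
      next
        case False
        have "half_sq_chord \<gamma> P \<ge> 0" by (simp add: half_sq_chord_def)
        with False c show ?thesis by simp
      qed
    qed
    then have "{P \<in> F2_set. chord \<gamma> P \<le> s} =
        {P \<in> F2_set. half_sq_chord \<gamma> P \<le> (if s \<ge> 0 then s\<^sup>2 / 2 else - 1)}" by blast
    then show ?thesis unfolding sublevel_def topspace_F2 by (rule arg_cong)
  qed
  then show "pointwise_finite_dimensional (sublevel_persistence i F2 (chord \<gamma>) ::
           ('k, (complex set, 'k) field_chain set) persistence_module)"
    using fd by (simp add: pointwise_finite_dimensional_def sublevel_persistence_def)
qed

section \<open>Chords of embedded closed curves\<close>

text \<open>Uniform distance of all derivatives up to order \<open>k\<close>; on
  \<open>Ck_curves k\<close> its balls turn out to form a neighbourhood base of the Whitney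
  topology.\<close>

definition Ck_close :: "nat \<Rightarrow> real \<Rightarrow> (real \<Rightarrow> 'v::real_normed_vector) \<Rightarrow> (real \<Rightarrow> 'v) \<Rightarrow> bool" where
  "Ck_close k e f g \<longleftrightarrow> (\<forall>j\<le>k. \<forall>t. norm (iterated_derivative j f t - iterated_derivative j g t) < e)"

lemma Ck_closeD: "Ck_close k e f g \<Longrightarrow> j \<le> k \<Longrightarrow> norm (iterated_derivative j f t - iterated_derivative j g t) < e"
  by (simp add: Ck_close_def)

lemma Ck_close_mono: "Ck_close k e f g \<Longrightarrow> j \<le> k \<Longrightarrow> e \<le> e' \<Longrightarrow> Ck_close j e' f g"
  unfolding Ck_close_def by (meson le_trans less_le_trans)

lemma Ck_close_refl: "e > 0 \<Longrightarrow> Ck_close k e g g"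
  by (simp add: Ck_close_def)

lemma Ck_close_trans: "Ck_close k e f g \<Longrightarrow> Ck_close k e' g h \<Longrightarrow> Ck_close k (e + e') f h"
  unfolding Ck_close_def by (meson norm_diff_triangle_less)

lemma norm_diff_le_of_vector_derivative:
  fixes f :: "real \<Rightarrow> 'v::real_inner"
  assumes ab: "a \<le> b" and d: "\<And>t. (f has_vector_derivative f' t) (at t)"
    and K: "\<And>t. a \<le> t \<Longrightarrow> t \<le> b \<Longrightarrow> norm (f' t) \<le> K"
  shows "norm (f b - f a) \<le> K * (b - a)"
proof (cases "a = b")
  case False
  have "continuous_on {a..b} f"
    using d by (intro continuous_at_imp_continuous_on ballI has_vector_derivative_continuous)
  then obtain x where x: "x \<in> {a<..<b}" "norm (f b - f a) \<le> norm ((b - a) *\<^sub>R f' x)"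
    using mvt_general[of a b f "\<lambda>x h. h *\<^sub>R f' x"] d False ab
    by (auto simp: has_vector_derivative_def)
  have "norm ((b - a) *\<^sub>R f' x) = (b - a) * norm (f' x)" using ab by simp
  also have "\<dots> \<le> (b - a) * K" using K[of x] x ab by (intro mult_left_mono) auto
  finally show ?thesis using x(2) by (simp add: mult.commute)
qed simp

locale immersed_closed_curve =
  fixes k :: nat and g :: "real \<Rightarrow> 'v::real_inner"
  assumes Ck: "Ck_open k UNIV g" and k2: "k \<ge> 2"
    and periodic: "g (t + 1) = g t" and immersed: "D1 g t \<noteq> 0"

lemma periodic_iterated:
  assumes "Ck_open k UNIV g" "j \<le> k" "\<And>t. g (t + 1) = g t"
  shows "iterated_derivative j g (t + of_int n) = iterated_derivative j g t"
    "iterated_derivative j g (t + 1) = iterated_derivative j g t"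
    "iterated_derivative j g (t - 1) = iterated_derivative j g t"
    "iterated_derivative j g (frac t) = iterated_derivative j g t"
proof -
  have p: "iterated_derivative j g (t + 1) = iterated_derivative j g t" for t
    by (rule iterated_derivative_periodic[OF assms])
  show "iterated_derivative j g (t + of_int n) = iterated_derivative j g t"
    "iterated_derivative j g (t + 1) = iterated_derivative j g t"
    using periodic_int[of "iterated_derivative j g", OF p] p by auto
  show "iterated_derivative j g (t - 1) = iterated_derivative j g t" using p[of "t - 1"] by simp
  show "iterated_derivative j g (frac t) = iterated_derivative j g t"
    using periodic_frac[of "iterated_derivative j g", OF p] .
qed

text \<open>
  By Taylor's formula \<open>f (x + h) - f x\<close> differs from \<open>h f' x\<close> and from \<open>h f' (x + h)\<close> by \<open>O(h\<^sup>2)\<close>,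
  uniformly for \<open>f\<close> in a \<open>C\<^sup>2\<close>-neighbourhood of \<open>g\<close>.
\<close>

lemma (in immersed_closed_curve) short_chords:
  obtains d e where "0 < d" "d < 1/2" "0 < e"
    "\<And>l f x h. Ck_open l UNIV f \<Longrightarrow> l \<ge> 2 \<Longrightarrow> Ck_close 2 e f g \<Longrightarrow> 0 < h \<Longrightarrow> h \<le> d \<Longrightarrow>
      inner (f (x + h) - f x) (D1 f x) > 0 \<and> inner (f (x + h) - f x) (D1 f (x + h)) > 0"
    "\<And>l f t. Ck_open l UNIV f \<Longrightarrow> l \<ge> 2 \<Longrightarrow> Ck_close 2 e f g \<Longrightarrow> D1 f t \<noteq> 0"
proof -
  have "continuous_on {0..1} (\<lambda>t. norm (D1 g t))"
    using continuous_iterated_derivative[OF Ck] k2 by (intro continuous_on_norm) simp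
  then obtain s where s: "\<And>t. t \<in> {0..1} \<Longrightarrow> norm (D1 g s) \<le> norm (D1 g t)"
    using continuous_attains_inf[of "{0..1}" "\<lambda>t. norm (D1 g t)"] compact_Icc by (metis atLeastAtMost_iff empty_iff order_refl zero_le_one)
  define m where "m = norm (D1 g s)"
  have m0: "m > 0" using immersed by (simp add: m_def)
  have m: "m \<le> norm (D1 g t)" for t
    using s[of "frac t"] periodic_iterated(4)[OF Ck, of 1] periodic k2 frac_ge_0[of t] frac_lt_1[of t]
    by (simp add: m_def less_imp_le)
  obtain B where B: "B > 0" "\<And>j t. j \<le> k \<Longrightarrow> norm (iterated_derivative j g t) \<le> B"
    using iterated_derivative_bounded[OF Ck periodic] by blast
  \<comment> \<open>Bounds the derivatives up to order 2 of every curve within \<open>m / 2\<close>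
    of \<open>g\<close>; this \<open>m / 2\<close> is the \<open>e\<close> finally supplied.\<close>
  define C where "C = B + m"
  have C: "C > 0" using B m0 by (simp add: C_def)
  \<comment> \<open>The Taylor error is at most C^2 h^2, hence at most h m^2 / 8 for
    \<open>h \<le> d\<close>, while the main term is at least h m^2 / 4.\<close>
  define d where "d = min (1/4) (m\<^sup>2 / (8 * C\<^sup>2))"
  have d1: "d > 0" "d \<le> 1/4" "d \<le> m\<^sup>2 / (8 * C\<^sup>2)" using m0 C by (auto simp: d_def)
  have "C\<^sup>2 * d \<le> C\<^sup>2 * (m\<^sup>2 / (8 * C\<^sup>2))" using d1(3) by (intro mult_left_mono) auto
  with d1 have d: "d > 0" "d < 1/2" "C\<^sup>2 * d \<le> m\<^sup>2 / 8" using C by auto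
  have main: "(0 < h \<longrightarrow> h \<le> d \<longrightarrow>
       inner (f (x + h) - f x) (D1 f x) > 0 \<and> inner (f (x + h) - f x) (D1 f (x + h)) > 0) \<and> D1 f t \<noteq> 0"
    if f: "Ck_open l UNIV f" "l \<ge> 2" and cl: "Ck_close 2 (m / 2) f g" for l and f :: "real \<Rightarrow> 'v" and x h t
  proof -
    have lo: "norm (D1 f t) \<ge> m / 2" for t
    proof -
      have "norm (D1 g t) - norm (D1 f t) \<le> norm (D1 f t - D1 g t)"
        by (metis norm_minus_commute norm_triangle_ineq2)
      then show ?thesis using m[of t] Ck_closeD[OF cl, of 1 t] by simp
    qed
    have up: "norm (iterated_derivative j f t) \<le> C" if "j \<le> 2" for j t
    proof -
      have "norm (iterated_derivative j f t) \<le> norm (iterated_derivative j g t) + norm (iterated_derivative j f t - iterated_derivative j g t)"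
        by (metis add.commute diff_add_cancel norm_triangle_ineq)
      also have "\<dots> \<le> B + m / 2" using B(2)[of j t] Ck_closeD[OF cl that, of t] that k2 by (intro add_mono) auto
      finally show ?thesis using m0 by (simp add: C_def)
    qed
    note der = C2_derivatives[OF f]
    \<comment> \<open>The variable base point \<open>u\<close> treats both ends of the chord at
      once, as \<open>u = x\<close> and \<open>u = x + h\<close>.\<close>
    have key: "inner (f (x + h) - f x) (D1 f u) > 0" if h: "0 < h" "h \<le> d" and u: "x \<le> u" "u \<le> x + h" for x h u
    proof -
      have lip: "norm (D1 f s - D1 f u) \<le> C * h" if "x \<le> s" "s \<le> x + h" for s
      proof (cases "s \<le> u")
        case True
        have "norm (D1 f u - D1 f s) \<le> C * (u - s)"
          using norm_diff_le_of_vector_derivative[OF True der(2), of C] up[of 2] by simp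
        also have "\<dots> \<le> C * h" using C that u by (intro mult_left_mono) auto
        finally show ?thesis by (simp add: norm_minus_commute)
      next
        case False
        then have "norm (D1 f s - D1 f u) \<le> C * (s - u)"
          using norm_diff_le_of_vector_derivative[of u s, OF _ der(2), of C] up[of 2] by simp
        also have "\<dots> \<le> C * h" using C that u by (intro mult_left_mono) auto
        finally show ?thesis .
      qed
      have "norm ((f (x + h) - (x + h) *\<^sub>R D1 f u) - (f x - x *\<^sub>R D1 f u)) \<le> (C * h) * (x + h - x)"
      proof (rule norm_diff_le_of_vector_derivative)
        show "((\<lambda>s. f s - s *\<^sub>R D1 f u) has_vector_derivative D1 f s - D1 f u) (at s)" for s
          using has_vector_derivative_diff[OF der(1)[of s]
              bounded_linear.has_vector_derivative[OF bounded_linear_scaleR_left[of "D1 f u"]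
                has_vector_derivative_id[of "at s"]]] by simp
      qed (use h lip in auto)
      then have rem: "norm (f (x + h) - f x - h *\<^sub>R D1 f u) \<le> C * h * h"
        by (simp add: algebra_simps)
      have "inner (f (x + h) - f x) (D1 f u) = h * (norm (D1 f u))\<^sup>2 + inner (f (x + h) - f x - h *\<^sub>R D1 f u) (D1 f u)"
        by (simp add: inner_diff_left power2_norm_eq_inner)
      moreover have "\<bar>inner (f (x + h) - f x - h *\<^sub>R D1 f u) (D1 f u)\<bar> \<le> (C * h * h) * C"
        using Cauchy_Schwarz_ineq2 mult_mono[OF rem up[of 1 u]] C h
        by (smt (verit, ccfv_SIG) norm_ge_zero one_le_numeral mult_nonneg_nonneg)
      moreover have "(C * h * h) * C \<le> h * (m\<^sup>2 / 8)"
      proof -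
        have "C\<^sup>2 * h \<le> C\<^sup>2 * d" using h C by (intro mult_left_mono) auto
        then have "h * (C\<^sup>2 * h) \<le> h * (m\<^sup>2 / 8)" using d(3) h by (intro mult_left_mono) auto
        then show ?thesis by (simp add: power2_eq_square mult_ac)
      qed
      moreover have "h * (norm (D1 f u))\<^sup>2 \<ge> h * (m\<^sup>2 / 4)"
      proof -
        have "(m / 2)\<^sup>2 \<le> (norm (D1 f u))\<^sup>2" using lo m0 by (intro power_mono) auto
        then show ?thesis using h by (intro mult_left_mono) (auto simp: power_divide)
      qed
      moreover have "h * (m\<^sup>2 / 8) < h * (m\<^sup>2 / 4)" using h m0 by (intro mult_strict_left_mono) auto
      ultimately show ?thesis by linarith
    qed
    have "D1 f t \<noteq> 0" using lo[of t] m0 by auto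
    then show ?thesis using key[of h x x] key[of h x "x + h"] by simp
  qed
  show thesis using that[of d "m / 2"] d m0 main by simp
qed

text \<open>Exchanging the ends exchanges the two gradient entries up to sign and the two diagonal
  entries of the Hessian.\<close>

lemma nondegenerate_chord_swap:
  assumes "Ck_open k UNIV g" "k \<ge> 2" "\<And>t. g (t + 1) = g t"
  shows "nondegenerate_chord g y (x + 1) \<longleftrightarrow> nondegenerate_chord g x y"
proof -
  have p: "g (x + 1) = g x" "D1 g (x + 1) = D1 g x" "D2 g (x + 1) = D2 g x"
    using periodic_iterated(2)[OF assms(1) _ assms(3), of 1] periodic_iterated(2)[OF assms(1) _ assms(3), of 2] assms by auto
  have "chord_fst g y (x + 1) = - chord_snd g x y" "chord_snd g y (x + 1) = - chord_fst g x y"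
    by (simp_all only: chord_fst_def chord_snd_def p) (simp_all add: inner_diff_left)
  moreover have "hess_det g y (x + 1) = hess_det g x y"
    by (simp only: hess_det_def hess_xx_def hess_yy_def hess_xy_def p)
      (simp add: inner_diff_left algebra_simps inner_commute)
  ultimately show ?thesis by (auto simp: nondegenerate_chord_def)
qed

lemma nondegenerate_chord_shift:
  assumes "Ck_open k UNIV g" "k \<ge> 2" "\<And>t. g (t + 1) = g t"
  shows "chord_fst g (x + of_int n) (y + of_int m) = chord_fst g x y"
    "chord_snd g (x + of_int n) (y + of_int m) = chord_snd g x y"
    "nondegenerate_chord g (x + of_int n) (y + of_int m) \<longleftrightarrow> nondegenerate_chord g x y"
proof -
  have p: "g (t + of_int n) = g t" "D1 g (t + of_int n) = D1 g t" "D2 g (t + of_int n) = D2 g t" for t n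
    using periodic_iterated(1)[OF assms(1) _ assms(3), of 0] periodic_iterated(1)[OF assms(1) _ assms(3), of 1]
      periodic_iterated(1)[OF assms(1) _ assms(3), of 2] assms by auto
  show "chord_fst g (x + of_int n) (y + of_int m) = chord_fst g x y"
    "chord_snd g (x + of_int n) (y + of_int m) = chord_snd g x y"
    "nondegenerate_chord g (x + of_int n) (y + of_int m) \<longleftrightarrow> nondegenerate_chord g x y"
    by (simp_all only: nondegenerate_chord_def chord_fst_def chord_snd_def hess_det_def hess_xx_def
        hess_yy_def hess_xy_def p)
qed

text \<open>Chords with parameters in this compact set, translated by integers, are all that can be critical.\<close>

definition long_chords :: "real \<Rightarrow> (real \<times> real) set" where
  "long_chords d = {(x, y). x \<in> {0..1} \<and> d \<le> y - x \<and> y - x \<le> 1 - d}"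

lemma compact_long_chords: "compact (long_chords d)"
proof -
  have eq: "long_chords d = ({0..1} \<times> {-\<bar>d\<bar>..2 + \<bar>d\<bar>}) \<inter> ({q. d \<le> snd q - fst q} \<inter> {q. snd q - fst q \<le> 1 - d})"
    by (auto simp: long_chords_def)
  show ?thesis unfolding eq
    by (intro compact_Int_closed compact_Times closed_Int closed_Collect_le continuous_intros) auto
qed

text \<open>A short chord is not critical at its first end. If \<open>y - x\<close> is close to 1,
  the same is said of the chord from \<open>y - 1\<close> to \<open>x\<close>. As only
  \<open>chord_fst\<close> is assumed to vanish, the result covers self-intersections as well as
  critical chords.\<close>

lemma critical_chord_long:
  assumes f: "Ck_open k UNIV f" "k \<ge> 2" "\<And>t. f (t + 1) = f t"
    and short: "\<And>x h. 0 < h \<Longrightarrow> h \<le> d \<Longrightarrow>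
       inner (f (x + h) - f x) (D1 f x) > 0 \<and> inner (f (x + h) - f x) (D1 f (x + h)) > 0"
    and xy: "0 < y - x" "y - x < 1" and c: "chord_fst f x y = 0"
  shows "(frac x, y - of_int \<lfloor>x\<rfloor>) \<in> long_chords d"
proof -
  have "d < y - x"
  proof (rule ccontr)
    assume "\<not> d < y - x"
    then have "inner (f y - f x) (D1 f x) > 0" using short[of "y - x" x] xy by simp
    then show False using c by (simp add: chord_fst_def inner_diff_left)
  qed
  moreover have "y - x < 1 - d"
  proof (rule ccontr)
    assume "\<not> y - x < 1 - d"
    then have "inner (f x - f (y - 1)) (D1 f x) > 0" using short[of "1 - (y - x)" "y - 1"] xy by simp
    moreover have "f (y - 1) = f y" using f(3)[of "y - 1"] by simp
    ultimately show False using c by (simp add: chord_fst_def)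
  qed
  ultimately show ?thesis using frac_lt_1[of x] by (simp add: long_chords_def frac_def)
qed

text \<open>An injective linear map is bounded below by some \<open>B\<close>; where the remainder
  is at most half of that, the linear part wins.\<close>

lemma isolated_zero:
  fixes G :: "'a::euclidean_space \<Rightarrow> 'b::euclidean_space"
  assumes G: "(G has_derivative L) (at z)" and inj: "inj L" and z: "G z = 0"
  shows "\<not> z islimpt {q. G q = 0}"
proof -
  have lin: "linear L" using G has_derivative_linear by blast
  obtain B where B: "B > 0" "\<And>v. B * norm v \<le> norm (L v)" using linear_inj_bounded_below_pos[OF lin inj] by blast
  obtain e where e: "e > 0" "\<And>q. norm (q - z) < e \<Longrightarrow> norm (G q - G z - L (q - z)) \<le> B / 2 * norm (q - z)"
    using G B(1) unfolding has_derivative_at_alt by (metis half_gt_zero)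
  have "q = z" if "q \<in> ball z e" "G q = 0" for q
  proof -
    have "norm (L (q - z)) \<le> B / 2 * norm (q - z)"
      using e(2)[of q] that z by (simp add: dist_norm norm_minus_commute)
    then have "B * norm (q - z) \<le> B / 2 * norm (q - z)" using B(2) order_trans by blast
    then have "norm (q - z) \<le> 0" using B(1) by (simp add: mult_le_0_iff field_simps)
    then show ?thesis by simp
  qed
  then show ?thesis unfolding islimpt_def using e(1)
    by (metis (mono_tags, lifting) centre_in_ball mem_Collect_eq open_ball)
qed

text \<open>Noncritical chords are no limit points because the critical set is closed. At a critical
  chord the derivative of the gradient equations is the Hessian up to signs, which is injective, so
  that critical chords are isolated.\<close>

lemma finite_critical_chords:
  assumes f: "Ck_open k UNIV g" "k \<ge> 2"
    and nd: "\<And>x y. (x, y) \<in> K \<Longrightarrow> nondegenerate_chord g x y" and K: "compact K"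
  shows "finite (K \<inter> {q. chord_fst g (fst q) (snd q) = 0 \<and> chord_snd g (fst q) (snd q) = 0})"
proof (rule finite_not_islimpt_in_compact[OF K])
  fix z assume z: "z \<in> K"
  let ?G = "\<lambda>q. (chord_fst g (fst q) (snd q), chord_snd g (fst q) (snd q))"
  let ?Z = "{q. chord_fst g (fst q) (snd q) = 0 \<and> chord_snd g (fst q) (snd q) = 0}"
  have Z: "?Z = {q. ?G q = 0}" by (simp add: zero_prod_def)
  have dG: "(?G has_derivative (\<lambda>v. (hess_xx g (fst z) (snd z) * fst v + hess_xy g (fst z) (snd z) * snd v,
      - hess_xy g (fst z) (snd z) * fst v - hess_yy g (fst z) (snd z) * snd v))) (at z)" (is "(?G has_derivative ?L) _")
    by (intro has_derivative_Pair has_derivative_chord_fst[OF f] has_derivative_chord_snd[OF f])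
  show "\<not> z islimpt ?Z"
  proof (cases "z \<in> ?Z")
    case True
    then have det: "hess_det g (fst z) (snd z) \<noteq> 0" using nd[of "fst z" "snd z"] z by (auto simp: nondegenerate_chord_def)
    have "inj ?L"
    proof -
      have "linear ?L" using dG has_derivative_linear by blast
      moreover have "v = 0" if "?L v = 0" for v
      proof -
        let ?a = "hess_xx g (fst z) (snd z)" and ?b = "hess_xy g (fst z) (snd z)" and ?c = "hess_yy g (fst z) (snd z)"
        have 1: "?a * fst v + ?b * snd v = 0" "- ?b * fst v - ?c * snd v = 0" using that by (auto simp: zero_prod_def)
        have "(?a * ?c - ?b\<^sup>2) * fst v = ?c * (?a * fst v + ?b * snd v) + ?b * (- ?b * fst v - ?c * snd v)"
          "(?a * ?c - ?b\<^sup>2) * snd v = - ?a * (- ?b * fst v - ?c * snd v) - ?b * (?a * fst v + ?b * snd v)"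
          by (auto simp: algebra_simps power2_eq_square)
        then have "(?a * ?c - ?b\<^sup>2) * fst v = 0" "(?a * ?c - ?b\<^sup>2) * snd v = 0" unfolding 1 by simp_all
        then show ?thesis using det by (simp add: hess_det_def prod_eq_iff)
      qed
      ultimately show ?thesis using linear_injective_0 by blast
    qed
    then show ?thesis unfolding Z using isolated_zero[OF dG] True by (simp add: zero_prod_def)
  next
    case False
    have "continuous_on UNIV (\<lambda>q. chord_fst g (fst q) (snd q))"
      by (rule has_derivative_continuous_on, rule has_derivative_at_withinI, rule has_derivative_chord_fst[OF f])
    moreover have "continuous_on UNIV (\<lambda>q. chord_snd g (fst q) (snd q))"
      by (rule has_derivative_continuous_on, rule has_derivative_at_withinI, rule has_derivative_chord_snd[OF f])
    ultimately have "continuous_on UNIV ?G" by (rule continuous_on_Pair)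
    then have "closed (?G -` {0})" by (intro closed_vimage) auto
    moreover have "?G -` {0} = ?Z" by (auto simp: zero_prod_def)
    ultimately have "closed ?Z" by simp
    then show ?thesis using False closed_limpt by blast
  qed
qed

locale embedded_closed_curve = immersed_closed_curve +
  assumes injective: "g x = g y \<Longrightarrow> x - y \<in> \<int>"

section \<open>Morse-supported chord functions\<close>

text \<open>Lets continuity on the circle be tested on the pullback to an interval.\<close>

lemma quotient_map_circle_exp: "quotient_map (top_of_set {0..1}) (top_of_set S1) circle_exp"
proof (rule continuous_imp_quotient_map)
  show "continuous_map (top_of_set {0..1}) (top_of_set S1) circle_exp"
    using continuous_circle_exp by (auto simp: continuous_map_in_subtopology)
  have "z \<in> circle_exp ` {0..1}" if "z \<in> S1" for z
  proof -
    obtain t where "z = circle_exp t" using \<open>z \<in> S1\<close> circle_exp_surj by blast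
    then have "z = circle_exp (frac t)" by (simp add: circle_exp_eq_iff frac_def)
    then show ?thesis using frac_ge_0[of t] frac_lt_1[of t] by (auto simp: less_imp_le)
  qed
  then show "circle_exp ` topspace (top_of_set {0..1}) = topspace (top_of_set S1)"
    using circle_exp_in by auto
qed (auto simp: compact_space_subtopology Hausdorff_space_subtopology)

lemma continuous_on_S1:
  assumes "continuous_on UNIV (f \<circ> circle_exp)"
  shows "continuous_on S1 f"
proof -
  have "continuous_map (top_of_set {0..1}) euclidean (f \<circ> circle_exp)"
    using assms continuous_on_subset by auto
  then have "continuous_map (top_of_set S1) euclidean f"
    using continuous_compose_quotient_map[OF quotient_map_circle_exp] by blast
  then show ?thesis by simp
qed

lemma embedded_closed_curve_of_embedding:
  assumes "\<gamma> \<in> Ck_embeddings k" "k \<ge> 2"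
  shows "embedded_closed_curve k (\<gamma> \<circ> circle_exp)"
proof
  show "Ck_open k UNIV (\<gamma> \<circ> circle_exp)" using assms by (simp add: Ck_embeddings_def Ck_curves_def)
  show "(\<gamma> \<circ> circle_exp) (t + 1) = (\<gamma> \<circ> circle_exp) t" for t by (simp add: circle_exp_add_1)
  show "D1 (\<gamma> \<circ> circle_exp) t \<noteq> 0" for t
    using assms by (simp add: Ck_embeddings_def iterated_derivative_def)
  show "x - y \<in> \<int>" if "(\<gamma> \<circ> circle_exp) x = (\<gamma> \<circ> circle_exp) y" for x y
    using that assms circle_exp_in unfolding Ck_embeddings_def
    by (auto simp: inj_on_def simp flip: circle_exp_eq_iff)
qed (rule assms)

text \<open>Compactness of the circle yields the homeomorphism onto the image, so a perturbation
  only has to preserve immersion and injectivity modulo integers.\<close>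

lemma embedding_of_embedded_closed_curve:
  assumes "\<gamma> \<in> Ck_curves k" "embedded_closed_curve k (\<gamma> \<circ> circle_exp)"
  shows "\<gamma> \<in> Ck_embeddings k"
proof -
  interpret embedded_closed_curve k "\<gamma> \<circ> circle_exp" by (rule assms(2))
  have inj: "inj_on \<gamma> S1"
  proof (rule inj_onI)
    fix z w assume "z \<in> S1" "w \<in> S1" and eq: "\<gamma> z = \<gamma> w"
    then obtain s t where "z = circle_exp s" "w = circle_exp t" by (metis circle_exp_surj)
    then show "z = w" using injective[of s t] eq by (simp add: circle_exp_eq_iff)
  qed
  have "continuous_on S1 \<gamma>"
    using continuous_on_S1 continuous_iterated_derivative[OF Ck, of 0 UNIV] by simp
  then have "embedding_map (top_of_set S1) euclidean \<gamma>"
    using inj by (intro continuous_imp_embedding_map) (auto simp: compact_space_subtopology)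
  then show ?thesis
    using assms(1) inj immersed by (simp add: Ck_embeddings_def iterated_derivative_def)
qed

context embedded_closed_curve
begin

lemma half_sq_dist_increasing:
  assumes short: "\<And>h. 0 < h \<Longrightarrow> h \<le> d \<Longrightarrow> inner (g (x + h) - g x) (D1 g (x + h)) > 0"
    and h: "0 \<le> a" "a \<le> b" "b \<le> d"
  shows "half_sq_dist g (x, x + a) \<le> half_sq_dist g (x, x + b)"
proof (rule DERIV_nonneg_imp_nondecreasing[OF h(2), of "\<lambda>h. half_sq_dist g (x, x + h)"])
  fix s assume s: "a \<le> s" "s \<le> b"
  have "((\<lambda>h. (x, x + h)) has_derivative (\<lambda>k. (0, k))) (at s)" by (auto intro!: derivative_eq_intros)
  from has_derivative_compose[OF this has_derivative_half_sq_dist[OF Ck k2]]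
  have "((\<lambda>h. half_sq_dist g (x, x + h)) has_real_derivative - chord_snd g x (x + s)) (at s)"
    by (auto simp: has_field_derivative_def fun_eq_iff elim!: has_derivative_eq_rhs)
  moreover have "- chord_snd g x (x + s) \<ge> 0"
    using short[of s] s h by (cases "s = 0") (auto simp: chord_snd_def inner_diff_left less_imp_le)
  ultimately show "\<exists>y. ((\<lambda>h. half_sq_dist g (x, x + h)) has_real_derivative y) (at s) \<and> 0 \<le> y" by blast
qed

text \<open>Half the minimum over \<open>long_chords d\<close> works; it is positive by injectivity.
  The bound \<open>y - x \<le> 1/2\<close> rules out chords that are short because
  \<open>y - x\<close> is near 1.\<close>

lemma short_chord_bound:
  assumes d: "0 < d" "d < 1/2"
  shows "\<exists>a>0. \<forall>x y. 0 \<le> y - x \<longrightarrow> y - x \<le> 1/2 \<longrightarrow> half_sq_dist g (x, y) \<le> a \<longrightarrow> y - x \<le> d"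
proof -
  let ?F = "half_sq_dist g"
  have "(0, d) \<in> long_chords d" using d by (simp add: long_chords_def)
  then have ne: "long_chords d \<noteq> {}" by blast
  obtain q where q: "q \<in> long_chords d" "\<And>p. p \<in> long_chords d \<Longrightarrow> ?F q \<le> ?F p"
    using continuous_attains_inf[OF compact_long_chords ne continuous_half_sq_dist[OF Ck]] by blast
  have "?F q > 0"
  proof -
    obtain x y where xy: "q = (x, y)" "d \<le> y - x" "y - x \<le> 1 - d" using q(1) by (auto simp: long_chords_def)
    have "g x \<noteq> g y"
    proof
      assume "g x = g y"
      then have "x - y = 0" using xy d by (intro Ints_abs_less_1 injective) auto
      then show False using xy d by simp
    qed
    then show ?thesis by (simp add: xy half_sq_dist_def)
  qed
  moreover have "y - x \<le> d" if xy: "0 \<le> y - x" "y - x \<le> 1/2" "?F (x, y) \<le> ?F q / 2" for x y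
  proof (rule ccontr)
    assume "\<not> y - x \<le> d"
    then have "(frac x, y - of_int \<lfloor>x\<rfloor>) \<in> long_chords d"
      using xy d frac_ge_0[of x] frac_lt_1[of x] by (auto simp: long_chords_def frac_def)
    from q(2)[OF this] have "?F q \<le> ?F (frac x, y - of_int \<lfloor>x\<rfloor>)" .
    also have "\<dots> = ?F (x, y)"
      using periodic_int[of g x "- \<lfloor>x\<rfloor>", OF periodic] periodic_int[of g y "- \<lfloor>x\<rfloor>", OF periodic]
      by (simp add: half_sq_dist_def frac_def)
    finally show False using xy(3) \<open>?F q > 0\<close> by simp
  qed
  ultimately show ?thesis by (intro exI[of _ "?F q / 2"]) auto
qed

end

text \<open>
  Near the boundary a pair is \<open>{e(x), e(x + h)}\<close> with \<open>h\<close> small; shrinking \<open>h\<close> to \<open>0\<close> shortens the chord.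
\<close>

lemma boundary_deformation_retract:
  fixes \<gamma> :: "complex \<Rightarrow> 'v::real_inner"
  assumes "embedded_closed_curve k (\<gamma> \<circ> circle_exp)"
  shows "\<exists>a>0. \<forall>t\<in>{0..a}. mfd_boundary F2 F2_atlas deformation_retract_of
    subtopology F2 {p \<in> topspace F2. 0 \<le> half_sq_chord \<gamma> p \<and> half_sq_chord \<gamma> p \<le> t}"
proof -
  define g where "g = \<gamma> \<circ> circle_exp"
  interpret embedded_closed_curve k g using assms by (simp add: g_def)
  obtain d e where d: "0 < d" "d < 1/2" and e: "0 < e"
    and short_all: "\<And>l f x h. Ck_open l UNIV f \<Longrightarrow> l \<ge> 2 \<Longrightarrow> Ck_close 2 e f g \<Longrightarrow> 0 < h \<Longrightarrow> h \<le> d \<Longrightarrow>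
      inner (f (x + h) - f x) (D1 f x) > 0 \<and> inner (f (x + h) - f x) (D1 f (x + h)) > 0"
    by (rule short_chords) blast
  have short: "inner (g (x + h) - g x) (D1 g (x + h)) > 0" if "0 < h" "h \<le> d" for x h
    using short_all[OF Ck k2 Ck_close_refl[OF e] that] by blast
  obtain a where a: "a > 0" "\<And>x y. 0 \<le> y - x \<Longrightarrow> y - x \<le> 1/2 \<Longrightarrow> half_sq_dist g (x, y) \<le> a \<Longrightarrow> y - x \<le> d"
    using short_chord_bound[OF d] by blast
  have Fc: "half_sq_chord \<gamma> (F2_cover q) = half_sq_dist g q" for q
    using fun_cong[OF half_sq_chord_cover[of \<gamma>], of q] by (simp add: g_def)
  have "mfd_boundary F2 F2_atlas deformation_retract_of
    subtopology F2 {p \<in> topspace F2. 0 \<le> half_sq_chord \<gamma> p \<and> half_sq_chord \<gamma> p \<le> t}" if t: "0 \<le> t" "t \<le> a" for t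
  proof -
    let ?S = "{p \<in> topspace F2. 0 \<le> half_sq_chord \<gamma> p \<and> half_sq_chord \<gamma> p \<le> t}"
    let ?Y = "subtopology F2 ?S"
    let ?I = "top_of_set {0..1::real}"
    let ?B = "mfd_boundary F2 F2_atlas"
    \<comment> \<open>Parameters \<open>(x, h)\<close> for the pair with ends \<open>x\<close> and
      \<open>x + h\<close>. The shrinking is obvious on this compact set and has to be descended to
      pairs.\<close>
    define K where "K = ({0..1} \<times> {0..d}) \<inter> {q. half_sq_dist g (fst q, fst q + snd q) \<le> t}"
    define \<kappa> where "\<kappa> = (\<lambda>q. F2_cover (fst q, fst q + snd q))"
    have topY: "topspace ?Y = ?S" by auto
    have "closed {q. half_sq_dist g (fst q, fst q + snd q) \<le> t}"
      by (intro closed_Collect_le continuous_on_compose2[OF continuous_half_sq_dist[OF Ck, of UNIV]]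
          continuous_intros) auto
    then have K: "compact K" unfolding K_def by (intro compact_Int_closed compact_Times) auto
    have shrink: "\<kappa> (x, (1 - s) * h) \<in> ?S" if "(x, h) \<in> K" "s \<in> {0..1}" for x h s
    proof -
      have h: "0 \<le> h" "h \<le> d" "half_sq_dist g (x, x + h) \<le> t" using that by (auto simp: K_def)
      have "half_sq_dist g (x, x + (1 - s) * h) \<le> half_sq_dist g (x, x + h)"
      proof (rule half_sq_dist_increasing[of d, OF short])
        show "(1 - s) * h \<le> h" using h that(2) by (intro mult_left_le_one_le) auto
      qed (use h that(2) in auto)
      then show ?thesis using h F2_cover_in by (simp add: \<kappa>_def Fc topspace_F2) (simp add: half_sq_dist_def)
    qed
    have \<kappa>K: "\<kappa> ` K = ?S"
    proof (intro equalityI subsetI)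
      fix p assume "p \<in> \<kappa> ` K"
      then obtain x h where "(x, h) \<in> K" "p = \<kappa> (x, h)" by auto
      then show "p \<in> ?S" using shrink[of x h 0] by simp
    next
      fix p assume p: "p \<in> ?S"
      then obtain x y where xy: "p = F2_cover (x, y)" "0 \<le> y - x" "y - x \<le> 1/2"
        using F2_cover_half_strip by (metis (no_types, lifting) mem_Collect_eq topspace_F2)
      have F: "half_sq_dist g (x, y) \<le> t" using p xy Fc by auto
      then have "y - x \<le> d" using a(2) xy t by auto
      have p': "p = \<kappa> (frac x, y - x)"
      proof -
        have "circle_exp (frac x) = circle_exp x" "circle_exp (frac x + (y - x)) = circle_exp y"
          by (simp_all add: circle_exp_eq_iff frac_def)
        then show ?thesis by (simp add: xy \<kappa>_def F2_cover_def)
      qed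
      moreover have "half_sq_dist g (frac x, frac x + (y - x)) \<le> t"
        using p p' Fc[of "(frac x, frac x + (y - x))"] by (simp add: \<kappa>_def)
      ultimately have "(frac x, y - x) \<in> K"
        using \<open>y - x \<le> d\<close> xy(2) frac_ge_0[of x] frac_lt_1[of x] by (simp add: K_def less_imp_le)
      then show "p \<in> \<kappa> ` K" using p' by blast
    qed
    have HY: "Hausdorff_space ?Y" by (rule Hausdorff_space_subtopology[OF Hausdorff_space_F2])
    have ck: "continuous_map (prod_topology ?I (top_of_set K)) ?Y (\<lambda>(s, q). \<kappa> (fst q, (1 - s) * snd q))"
    proof -
      have "continuous_map (prod_topology ?I (top_of_set K)) euclidean
          (\<lambda>p. (fst (snd p), fst (snd p) + (1 - fst p) * snd (snd p)))"
        by (auto simp flip: subtopology_Times intro!: continuous_intros)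
      from continuous_map_compose[OF this continuous_F2_cover]
      have "continuous_map (prod_topology ?I (top_of_set K)) F2 (\<lambda>(s, q). \<kappa> (fst q, (1 - s) * snd q))"
        by (simp add: o_def \<kappa>_def case_prod_unfold)
      then show ?thesis
        using shrink by (auto simp: continuous_map_in_subtopology)
    qed
    have c0: "continuous_map (top_of_set K) ?Y \<kappa>"
    proof -
      have "continuous_map (top_of_set K) euclidean (\<lambda>q. (fst q, fst q + snd q))"
        by (auto intro!: continuous_intros)
      from continuous_map_compose[OF this continuous_F2_cover] show ?thesis
        using \<kappa>K by (auto simp: o_def \<kappa>_def continuous_map_in_subtopology)
    qed
    \<comment> \<open>The product with the interval is included, since the whole homotopy is to be
      factored; compactness and the Hausdorff property make the map a quotient map.\<close>
    have qm: "quotient_map (prod_topology ?I (top_of_set K)) (prod_topology ?I ?Y) (\<lambda>(s, q). (s, \<kappa> q))"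
    proof (rule continuous_imp_quotient_map)
      show "continuous_map (prod_topology ?I (top_of_set K)) (prod_topology ?I ?Y) (\<lambda>(s, q). (s, \<kappa> q))"
        unfolding continuous_map_pairwise o_def case_prod_unfold fst_conv snd_conv
        by (intro conjI continuous_map_fst continuous_map_compose[OF continuous_map_snd c0, unfolded o_def])
      show "compact_space (prod_topology ?I (top_of_set K))"
        unfolding compact_space_prod_topology using K by (simp add: compact_space_subtopology)
      show "Hausdorff_space (prod_topology ?I ?Y)"
        using HY by (simp add: Hausdorff_space_prod_topology Hausdorff_space_subtopology)
      show "(\<lambda>(s, q). (s, \<kappa> q)) ` topspace (prod_topology ?I (top_of_set K)) = topspace (prod_topology ?I ?Y)"
      proof -
        have "(\<lambda>(s, q). (s, \<kappa> q)) ` (A \<times> L) = A \<times> \<kappa> ` L" for A :: "real set" and L by auto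
        then show ?thesis by (simp only: topspace_prod_topology topY \<kappa>K topspace_euclidean_subtopology)
      qed
    qed
    \<comment> \<open>Both \<open>h\<close> and \<open>h'\<close> are below 1/2, so two parameters
      of one pair have the same \<open>h\<close> and congruent \<open>x\<close>; the ends can be
      exchanged only when \<open>h\<close> and \<open>h'\<close> are 0.\<close>
    have fibre: "\<kappa> (x, (1 - s) * h) = \<kappa> (x', (1 - s) * h')"
      if "(x, h) \<in> K" "(x', h') \<in> K" and eq: "\<kappa> (x, h) = \<kappa> (x', h')" for s x h x' h'
    proof -
      have hh: "0 \<le> h" "h < 1/2" "0 \<le> h'" "h' < 1/2" using that d by (auto simp: K_def)
      have xx: "x - x' \<in> \<int> \<and> h = h'"
      proof -
        consider "x - x' \<in> \<int>" "(x + h) - (x' + h') \<in> \<int>" | "x - (x' + h') \<in> \<int>" "(x + h) - x' \<in> \<int>"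
          using eq by (auto simp: \<kappa>_def F2_cover_def doubleton_eq_iff circle_exp_eq_iff)
        then show ?thesis
        proof cases
          case 1
          have "h - h' = (x + h) - (x' + h') - (x - x')" by simp
          then have "h - h' \<in> \<int>" using 1 by (metis Ints_diff)
          then have "h - h' = 0" using hh by (intro Ints_abs_less_1) auto
          then show ?thesis using 1 by simp
        next
          case 2
          have "h + h' = (x + h) - x' - (x - (x' + h'))" by simp
          then have "h + h' \<in> \<int>" using 2 by (metis Ints_diff)
          then have "h + h' = 0" using hh by (intro Ints_abs_less_1) auto
          then have "h = 0" "h' = 0" using hh by auto
          then show ?thesis using 2 by simp
        qed
      qed
      then have "circle_exp (x + c) = circle_exp (x' + c)" for c by (simp add: circle_exp_eq_iff)
      from this[of 0] this[of "(1 - s) * h"] xx show ?thesis by (simp add: \<kappa>_def F2_cover_def)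
    qed
    have wd: "(\<lambda>(s, q). \<kappa> (fst q, (1 - s) * snd q)) p = (\<lambda>(s, q). \<kappa> (fst q, (1 - s) * snd q)) p'"
      if pp: "p \<in> topspace (prod_topology ?I (top_of_set K))" "p' \<in> topspace (prod_topology ?I (top_of_set K))"
        "(\<lambda>(s, q). (s, \<kappa> q)) p = (\<lambda>(s, q). (s, \<kappa> q)) p'" for p p'
    proof -
      obtain s x h where p: "p = (s, x, h)" by (cases p) auto
      obtain s' x' h' where p': "p' = (s', x', h')" by (cases p') auto
      have "s = s'" "\<kappa> (x, h) = \<kappa> (x', h')" "(x, h) \<in> K" "(x', h') \<in> K" using pp by (simp_all add: p p')
      then show ?thesis using fibre[of x h x' h' s] by (simp add: p p')
    qed
    obtain H where Hc: "continuous_map (prod_topology ?I ?Y) ?Y H"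
      and H': "\<And>p. p \<in> topspace (prod_topology ?I (top_of_set K)) \<Longrightarrow>
        H ((\<lambda>(s, q). (s, \<kappa> q)) p) = (\<lambda>(s, q). \<kappa> (fst q, (1 - s) * snd q)) p"
    proof (rule quotient_map_lift_exists[OF qm ck])
      fix H assume "continuous_map (prod_topology ?I ?Y) ?Y H"
        and "\<And>p. p \<in> topspace (prod_topology ?I (top_of_set K)) \<Longrightarrow>
          H ((\<lambda>(s, q). (s, \<kappa> q)) p) = (\<lambda>(s, q). \<kappa> (fst q, (1 - s) * snd q)) p"
      then show thesis by (rule that)
    qed (rule wd)
    have H2: "H (s, \<kappa> q) = \<kappa> (fst q, (1 - s) * snd q)" if "s \<in> {0..1}" "q \<in> K" for s q
      using H'[of "(s, q)"] that by simp
    note H = Hc H2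
    have B: "?B = {{z} |z. z \<in> S1}" by (rule mfd_boundary_F2)
    have \<kappa>0: "\<kappa> (x, 0) \<in> ?B" for x
      unfolding B using circle_exp_in by (auto simp: \<kappa>_def F2_cover_def)
    have BK: "\<exists>x. p = \<kappa> (x, 0) \<and> (x, 0) \<in> K" if pB: "p \<in> ?B" for p
    proof -
      obtain z where z: "p = {z}" "z \<in> S1" using pB unfolding B by blast
      obtain x where "z = circle_exp x" using circle_exp_surj[OF z(2)] .
      with z have "p = \<kappa> (frac x, 0)" by (simp add: \<kappa>_def F2_cover_def circle_exp_eq_iff frac_def)
      moreover have "(frac x, 0) \<in> K"
        using t d frac_ge_0[of x] frac_lt_1[of x] by (simp add: K_def half_sq_dist_def less_imp_le)
      ultimately show ?thesis by blast
    qed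
    have fix_B: "H (s, p) = p" if "s \<in> {0..1}" "p \<in> ?B" for s p
      using BK[OF that(2)] H(2)[OF that(1)] by auto
    have BS: "?B \<subseteq> ?S" using BK \<kappa>K by blast
    define r where "r = (\<lambda>p. H (1, p))"
    have r: "r p \<in> ?B" if pS: "p \<in> ?S" for p
    proof -
      obtain x h where "(x, h) \<in> K" "p = \<kappa> (x, h)" using pS \<kappa>K by (metis imageE surj_pair)
      then show ?thesis using H(2)[of 1 "(x, h)"] \<kappa>0 by (simp add: r_def)
    qed
    have "continuous_map ?Y (prod_topology ?I ?Y) (\<lambda>p. (1, p))"
      by (auto simp: continuous_map_pairwise o_def)
    from continuous_map_compose[OF this H(1)] have cr: "continuous_map ?Y ?Y r" by (simp add: o_def r_def)
    have "retraction_maps ?Y (subtopology ?Y ?B) r id"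
      unfolding retraction_maps_def
      using cr r fix_B[of 1] BS by (auto simp: continuous_map_in_subtopology r_def
          continuous_map_from_subtopology Pi_iff)
    moreover have "homotopic_with (\<lambda>h. \<forall>x\<in>?B. h x = x) ?Y ?Y id r"
    proof (subst homotopic_with)
      show "(\<forall>x\<in>?B. h x = x) \<longleftrightarrow> (\<forall>x\<in>?B. k x = x)" if hk: "\<And>x. x \<in> topspace ?Y \<Longrightarrow> h x = k x" for h k
      proof (rule ball_cong[OF refl])
        fix x assume "x \<in> ?B"
        then have "x \<in> topspace ?Y" using BS topY by blast
        from hk[OF this] show "h x = x \<longleftrightarrow> k x = x" by simp
      qed
      have "H (0, p) = p" if pS: "p \<in> ?S" for p
      proof -
        obtain q where "q \<in> K" "p = \<kappa> q" using pS \<kappa>K by blast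
        then show ?thesis using H(2)[of 0 q] by simp
      qed
      then show "\<exists>h. continuous_map (prod_topology ?I ?Y) ?Y h \<and> (\<forall>x\<in>topspace ?Y. h (0, x) = id x) \<and>
          (\<forall>x\<in>topspace ?Y. h (1, x) = r x) \<and> (\<forall>t\<in>{0..1}. \<forall>x\<in>?B. h (t, x) = x)"
        using H(1) fix_B by (intro exI[of _ H]) (auto simp: r_def)
    qed
    ultimately show ?thesis unfolding deformation_retract_of_def using BS topY by blast
  qed
  then show ?thesis using a(1) by auto
qed

lemma F2_atlas_box:
  assumes "0 < y - x" "y - x \<le> 1/2"
  obtains D where "(D, F2_cover) \<in> F2_atlas" "(x, y) \<in> interior D"
proof
  define r where "r = min (1/16) ((y - x) / 3)"
  have r: "0 < r" "r \<le> 1/16" "2 * r < y - x" using assms by (auto simp: r_def min_def)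
  let ?D = "ball x r \<times> ball y r"
  have sub: "?D \<subseteq> strip"
  proof clarify
    fix a b assume "a \<in> ball x r" "b \<in> ball y r"
    then have "\<bar>a - x\<bar> < r" "\<bar>b - y\<bar> < r" by (auto simp: dist_real_def abs_minus_commute)
    then show "(a, b) \<in> strip" using r assms by (auto simp: strip_def abs_less_iff)
  qed
  have op: "open ?D" by (intro open_Times) auto
  have "inj_on F2_cover (strip \<inter> (cball x r \<times> cball y r))" using inj_on_F2_cover_box assms r by simp
  moreover have "?D \<subseteq> strip \<inter> (cball x r \<times> cball y r)" using sub ball_subset_cball by blast
  ultimately have "inj_on F2_cover ?D" by (rule inj_on_subset)
  then show "(?D, F2_cover) \<in> F2_atlas" unfolding F2_atlas_def
    using sub op by (auto simp: openin_open_eq open_subset)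
  show "(x, y) \<in> interior ?D" using op r by (simp add: interior_open)
qed

lemma interior_strip:
  assumes "(D, \<phi>) \<in> F2_atlas" "(x, y) \<in> interior D"
  shows "\<phi> = F2_cover" "0 < y - x" "y - x < 1"
proof -
  have D: "D \<subseteq> strip" "\<phi> = F2_cover" using assms(1) by (auto simp: F2_atlas_def dest: openin_imp_subset)
  then show "\<phi> = F2_cover" by simp
  obtain e where e: "e > 0" "ball (x, y) e \<subseteq> D" using assms(2) by (auto simp: mem_interior)
  have "(x + e/2, y) \<in> ball (x, y) e" "(x - e/2, y) \<in> ball (x, y) e"
    using e by (auto simp: dist_prod_def dist_real_def)
  then have "(x + e/2, y) \<in> strip" "(x - e/2, y) \<in> strip" using e D by blast+
  then show "0 < y - x" "y - x < 1" using e by (auto simp: strip_def)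
qed

lemma half_sq_dist_critical_iff:
  assumes "Ck_open k UNIV g" "k \<ge> 2"
  shows "(half_sq_dist g has_derivative (\<lambda>_. 0)) (at (x, y)) \<longleftrightarrow> chord_fst g x y = 0 \<and> chord_snd g x y = 0"
proof
  assume "(half_sq_dist g has_derivative (\<lambda>_. 0)) (at (x, y))"
  from has_derivative_unique[OF this has_derivative_half_sq_dist[OF assms]]
  have eq: "0 = chord_fst g x y * fst v - chord_snd g x y * snd v" for v by (metis fst_conv snd_conv)
  show "chord_fst g x y = 0 \<and> chord_snd g x y = 0" using eq[of "(1, 0)"] eq[of "(0, 1)"] by simp
qed (use has_derivative_half_sq_dist[OF assms, of "(x, y)"] in simp)

text \<open>The boundary and deformation clauses hold for every embedded curve. Finiteness follows
  from nondegeneracy, because critical chords are then isolated and all have representatives in the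
  compact set \<open>long_chords d\<close>.\<close>

theorem Morse_supported_iff:
  fixes \<gamma> :: "complex \<Rightarrow> 'v::real_inner"
  assumes "embedded_closed_curve k (\<gamma> \<circ> circle_exp)"
  shows "Morse_supported k F2 F2_atlas (half_sq_chord \<gamma>) \<longleftrightarrow>
    (\<forall>x y. 0 < y - x \<longrightarrow> y - x < 1 \<longrightarrow> nondegenerate_chord (\<gamma> \<circ> circle_exp) x y)"
proof -
  define g where "g = \<gamma> \<circ> circle_exp"
  let ?f = "half_sq_chord \<gamma>"
  interpret embedded_closed_curve k g using assms by (simp add: g_def)
  have F: "?f \<circ> F2_cover = half_sq_dist g" by (simp add: half_sq_chord_cover g_def)
  have Fc: "?f (F2_cover q) = half_sq_dist g q" for q using fun_cong[OF F, of q] by simp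
  have crit: "interior_critical_points F2_atlas ?f =
      {p. \<exists>D x y. (D, F2_cover) \<in> F2_atlas \<and> (x, y) \<in> interior D \<and> F2_cover (x, y) = p \<and>
        chord_fst g x y = 0 \<and> chord_snd g x y = 0}"
    (is "_ = ?C")
  proof (intro equalityI subsetI)
    fix p assume "p \<in> interior_critical_points F2_atlas ?f"
    then obtain D \<phi> q where D: "(D, \<phi>) \<in> F2_atlas" "q \<in> interior D" "\<phi> q = p"
      "((?f \<circ> \<phi>) has_derivative (\<lambda>_. 0)) (at q)" unfolding interior_critical_points_def by blast
    obtain x y where q: "q = (x, y)" by (cases q)
    have \<phi>: "\<phi> = F2_cover" using interior_strip(1) D(1,2) q by blast
    show "p \<in> ?C" using D half_sq_dist_critical_iff[OF Ck k2, of x y] unfolding \<phi> q F by blast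
  next
    fix p assume "p \<in> ?C"
    then obtain D x y where D: "(D, F2_cover) \<in> F2_atlas" "(x, y) \<in> interior D" "F2_cover (x, y) = p"
      "((?f \<circ> F2_cover) has_derivative (\<lambda>_. 0)) (at (x, y))"
      unfolding F half_sq_dist_critical_iff[OF Ck k2] by blast
    then show "p \<in> interior_critical_points F2_atlas ?f" unfolding interior_critical_points_def by blast
  qed
  have nondeg: "nondegenerate_at F2_atlas ?f p \<longleftrightarrow>
      (\<forall>D x y. (D, F2_cover) \<in> F2_atlas \<longrightarrow> (x, y) \<in> interior D \<longrightarrow> F2_cover (x, y) = p \<longrightarrow> hess_det g x y \<noteq> 0)" for p
  proof -
    have eqv: "(\<forall>u. (\<forall>v. hessian (half_sq_dist g) (x, y) u v = 0) \<longrightarrow> u = 0) \<longleftrightarrow> hess_det g x y \<noteq> 0" for x y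
      unfolding hessian_half_sq_dist[OF Ck k2] symmetric_form_nondegenerate hess_det_def ..
    show ?thesis
    proof (intro iffI allI impI)
      fix D x y assume L: "nondegenerate_at F2_atlas ?f p"
        and D: "(D, F2_cover) \<in> F2_atlas" "(x, y) \<in> interior D" "F2_cover (x, y) = p"
      from bspec[OF L[unfolded nondegenerate_at_def] D(1)] D(2,3)
      have "\<forall>u. (\<forall>v. hessian (half_sq_dist g) (x, y) u v = 0) \<longrightarrow> u = 0" unfolding prod.case F by blast
      then show "hess_det g x y \<noteq> 0" unfolding eqv .
    next
      assume R: "\<forall>D x y. (D, F2_cover) \<in> F2_atlas \<longrightarrow> (x, y) \<in> interior D \<longrightarrow> F2_cover (x, y) = p \<longrightarrow> hess_det g x y \<noteq> 0"
      have "\<forall>q\<in>interior D. \<phi> q = p \<longrightarrow> (\<forall>u. (\<forall>v. hessian (?f \<circ> \<phi>) q u v = 0) \<longrightarrow> u = 0)"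
        if D: "(D, \<phi>) \<in> F2_atlas" for D \<phi>
      proof (intro ballI impI)
        fix q assume q: "q \<in> interior D" "\<phi> q = p"
        obtain x y where xy: "q = (x, y)" by (cases q)
        have \<phi>: "\<phi> = F2_cover" using interior_strip(1) D q(1) xy by blast
        have "hess_det g x y \<noteq> 0" using R D q unfolding \<phi> xy by blast
        then show "\<forall>u. (\<forall>v. hessian (?f \<circ> \<phi>) q u v = 0) \<longrightarrow> u = 0" unfolding \<phi> xy F eqv .
      qed
      then show "nondegenerate_at F2_atlas ?f p" unfolding nondegenerate_at_def by blast
    qed
  qed
  have zero: "{p \<in> topspace F2. ?f p = 0} = mfd_boundary F2 F2_atlas"
  proof (intro equalityI subsetI)
    fix p assume p: "p \<in> {p \<in> topspace F2. ?f p = 0}"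
    then obtain x y where xy: "p = F2_cover (x, y)" using F2_cover_half_strip topspace_F2 by blast
    then have "g x = g y" using p Fc by (simp add: half_sq_dist_def)
    then have "circle_exp x = circle_exp y" using injective circle_exp_eq_iff by blast
    then show "p \<in> mfd_boundary F2 F2_atlas" unfolding mfd_boundary_F2
      using circle_exp_in by (auto simp: xy F2_cover_def)
  next
    fix p assume "p \<in> mfd_boundary F2 F2_atlas"
    then obtain z where z: "p = {z, z}" "z \<in> S1" unfolding mfd_boundary_F2 by auto
    then show "p \<in> {p \<in> topspace F2. ?f p = 0}"
      using chord_pair[of \<gamma> z z] F2_setI[of z z] by (simp add: half_sq_chord_def topspace_F2)
  qed
  have "(\<forall>p\<in>interior_critical_points F2_atlas ?f. nondegenerate_at F2_atlas ?f p) \<longleftrightarrow>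
      (\<forall>x y. 0 < y - x \<longrightarrow> y - x < 1 \<longrightarrow> nondegenerate_chord g x y)" (is "?L \<longleftrightarrow> ?R")
  proof
    assume L: ?L
    \<comment> \<open>The chart of \<open>F2_atlas_box\<close> reaches the half strip; the remaining
      chords follow by exchanging the ends.\<close>
    have half: "nondegenerate_chord g x y" if xy: "0 < y - x" "y - x \<le> 1/2" for x y
    proof -
      obtain D where D: "(D, F2_cover) \<in> F2_atlas" "(x, y) \<in> interior D" using F2_atlas_box[OF xy] .
      then show ?thesis using L unfolding crit nondeg nondegenerate_chord_def by blast
    qed
    show ?R
    proof (intro allI impI)
      fix x y :: real assume xy: "0 < y - x" "y - x < 1"
      show "nondegenerate_chord g x y"
      proof (cases "y - x \<le> 1/2")
        case False
        then have "nondegenerate_chord g y (x + 1)" using xy by (intro half) auto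
        then show ?thesis using nondegenerate_chord_swap[OF Ck k2 periodic] by simp
      qed (use half xy in blast)
    qed
  next
    assume R: ?R
    show ?L
    proof
      fix p assume "p \<in> interior_critical_points F2_atlas ?f"
      then obtain x' y' where c: "F2_cover (x', y') = p" "chord_fst g x' y' = 0" "chord_snd g x' y' = 0"
        unfolding crit by blast
      show "nondegenerate_at F2_atlas ?f p" unfolding nondeg
      \<comment> \<open>Nondegeneracy is tested in every chart through \<open>p\<close>, while
        criticality is known for one representative only; representatives differ by integers and an
        exchange of ends.\<close>
      proof (intro allI impI)
        fix D x y assume D: "(D, F2_cover) \<in> F2_atlas" "(x, y) \<in> interior D" "F2_cover (x, y) = p"
        have "F2_cover (x, y) = F2_cover (x', y')" using D(3) c(1) by simp
        then consider "x - x' \<in> \<int>" "y - y' \<in> \<int>" | "x - y' \<in> \<int>" "y - x' \<in> \<int>"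
          by (auto simp: F2_cover_def doubleton_eq_iff circle_exp_eq_iff)
        then have "chord_fst g x y = 0 \<and> chord_snd g x y = 0"
        proof cases
          case 1
          then obtain n m where "x - x' = of_int n" "y - y' = of_int m" by (auto elim!: Ints_cases)
          then have "x = x' + of_int n" "y = y' + of_int m" by auto
          then show ?thesis using nondegenerate_chord_shift(1,2)[OF Ck k2 periodic] c by simp
        next
          case 2
          then obtain n m where "x - y' = of_int n" "y - x' = of_int m" by (auto elim!: Ints_cases)
          then have "x = y' + of_int n" "y = x' + of_int m" by auto
          moreover have "chord_fst g y' x' = - chord_snd g x' y'" "chord_snd g y' x' = - chord_fst g x' y'"
            by (simp_all add: chord_fst_def chord_snd_def inner_diff_left)
          ultimately show ?thesis using nondegenerate_chord_shift(1,2)[OF Ck k2 periodic] c by simp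
        qed
        then show "hess_det g x y \<noteq> 0"
          using R interior_strip(2,3)[OF D(1,2)] by (auto simp: nondegenerate_chord_def)
      qed
    qed
  qed
  moreover have "finite (interior_critical_points F2_atlas ?f)" if R: "\<forall>x y. 0 < y - x \<longrightarrow> y - x < 1 \<longrightarrow> nondegenerate_chord g x y"
  proof -
    obtain d e where d: "0 < d" "d < 1/2" and e: "0 < e"
      and short_all: "\<And>l f x h. Ck_open l UNIV f \<Longrightarrow> l \<ge> 2 \<Longrightarrow> Ck_close 2 e f g \<Longrightarrow> 0 < h \<Longrightarrow> h \<le> d \<Longrightarrow>
        inner (f (x + h) - f x) (D1 f x) > 0 \<and> inner (f (x + h) - f x) (D1 f (x + h)) > 0"
      by (rule short_chords) blast
    note short = short_all[OF Ck k2 Ck_close_refl[OF e]]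
    let ?Z = "{q. chord_fst g (fst q) (snd q) = 0 \<and> chord_snd g (fst q) (snd q) = 0}"
    have "finite (long_chords d \<inter> ?Z)"
      by (rule finite_critical_chords[OF Ck k2 _ compact_long_chords])
        (use R d in \<open>auto simp: long_chords_def\<close>)
    moreover have "interior_critical_points F2_atlas ?f \<subseteq> F2_cover ` (long_chords d \<inter> ?Z)"
    proof
      fix p assume "p \<in> interior_critical_points F2_atlas ?f"
      then obtain D x y where D: "(D, F2_cover) \<in> F2_atlas" "(x, y) \<in> interior D" "F2_cover (x, y) = p"
        and c: "chord_fst g x y = 0" "chord_snd g x y = 0" unfolding crit by blast
      note xy = interior_strip(2,3)[OF D(1,2)]
      let ?q = "(x + of_int (- \<lfloor>x\<rfloor>), y + of_int (- \<lfloor>x\<rfloor>))"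
      have "?q \<in> long_chords d"
        using critical_chord_long[OF Ck k2 periodic short xy c(1)] by (simp add: frac_def)
      moreover have "?q \<in> ?Z"
        by (simp only: mem_Collect_eq fst_conv snd_conv nondegenerate_chord_shift(1,2)[OF Ck k2 periodic] c)
      moreover have "F2_cover ?q = p"
      proof -
        have "circle_exp (a + of_int (- \<lfloor>x\<rfloor>)) = circle_exp a" for a unfolding circle_exp_eq_iff by simp
        then show ?thesis using D(3) by (simp add: F2_cover_def)
      qed
      ultimately show "p \<in> F2_cover ` (long_chords d \<inter> ?Z)" by blast
    qed
    ultimately show ?thesis by (meson finite_imageI finite_subset)
  qed
  moreover have "Ck_function k F2_atlas ?f"
    unfolding Ck_function_def F2_atlas_def
    using Ck_open_imp_Ck_on[OF Ck_open_half_sq_dist[OF Ck]] by (auto simp: F)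
  moreover have "0 \<le> ?f p" for p by (simp add: half_sq_chord_def)
  ultimately show ?thesis
    unfolding Morse_supported_def using zero boundary_deformation_retract[OF assms] by (auto simp: g_def)
qed

section \<open>Stability under \<open>C\<^sup>2\<close>-small perturbations\<close>

text \<open>Joint convergence of curves and points, the tool of all compactness arguments below. The
  subsequence \<open>r\<close> comes from extracting convergent points.\<close>

lemma close_evaluations_tendsto:
  fixes f :: "nat \<Rightarrow> real \<Rightarrow> 'v::real_normed_vector"
  assumes g: "Ck_open k UNIV g" "j \<le> k" and cl: "\<And>n. Ck_close j (1 / real (Suc n)) (f n) g"
    and t: "t \<longlonglongrightarrow> t0" and r: "strict_mono (r :: nat \<Rightarrow> nat)"
  shows "(\<lambda>n. iterated_derivative j (f (r n)) (t n)) \<longlonglongrightarrow> iterated_derivative j g t0"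
proof -
  have "isCont (iterated_derivative j g) t0"
    using continuous_iterated_derivative[OF g, of UNIV] by (simp add: continuous_on_eq_continuous_at)
  then have 1: "(\<lambda>n. iterated_derivative j g (t n)) \<longlonglongrightarrow> iterated_derivative j g t0"
    using t isCont_tendsto_compose by blast
  have "(\<lambda>n. inverse (real (Suc (r n)))) \<longlonglongrightarrow> 0"
    using LIMSEQ_subseq_LIMSEQ[OF LIMSEQ_inverse_real_of_nat r] by (simp add: o_def)
  then have "(\<lambda>n. iterated_derivative j (f (r n)) (t n) - iterated_derivative j g (t n)) \<longlonglongrightarrow> 0"
    by (rule Lim_null_comparison[rotated])
      (use Ck_closeD[OF cl order_refl] in \<open>auto intro!: always_eventually less_imp_le simp: inverse_eq_divide\<close>)
  from tendsto_add[OF this 1] show ?thesis by simp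
qed

text \<open>Otherwise degenerate critical chords of ever closer curves accumulate in
  \<open>B\<close>; the three equations pass to the limit and give a degenerate critical chord of
  \<open>g\<close>.\<close>

lemma nondegenerate_chord_stable:
  fixes g :: "real \<Rightarrow> 'v::real_inner"
  assumes g: "Ck_open k UNIV g" "k \<ge> 2" and B: "compact B"
    and nd: "\<And>x y. (x, y) \<in> B \<Longrightarrow> nondegenerate_chord g x y"
  shows "\<exists>e>0. \<forall>f. Ck_close 2 e f g \<longrightarrow> (\<forall>x y. (x, y) \<in> B \<longrightarrow> nondegenerate_chord f x y)"
proof (rule ccontr)
  assume neg: "\<not> ?thesis"
  have "\<exists>f x y. Ck_close 2 (1 / real (Suc n)) f g \<and> (x, y) \<in> B \<and> \<not> nondegenerate_chord f x y" for n
  proof -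
    have "1 / real (Suc n) > 0" by simp
    then show ?thesis using neg by blast
  qed
  then obtain f x y where f: "\<And>n. Ck_close 2 (1 / real (Suc n)) (f n) g" "\<And>n. (x n, y n) \<in> B"
    "\<And>n. \<not> nondegenerate_chord (f n) (x n) (y n)" by metis
  obtain z r where z: "z \<in> B" "strict_mono r" "((\<lambda>n. (x n, y n)) \<circ> r) \<longlonglongrightarrow> z"
    using compact_imp_seq_compact[OF B] f(2) by (meson seq_compactE)
  have xz: "(\<lambda>n. x (r n)) \<longlonglongrightarrow> fst z" and yz: "(\<lambda>n. y (r n)) \<longlonglongrightarrow> snd z"
    using tendsto_fst[OF z(3)] tendsto_snd[OF z(3)] by (auto simp: o_def)
  have lim: "(\<lambda>n. iterated_derivative j (f (r n)) (x (r n))) \<longlonglongrightarrow> iterated_derivative j g (fst z)"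
    "(\<lambda>n. iterated_derivative j (f (r n)) (y (r n))) \<longlonglongrightarrow> iterated_derivative j g (snd z)" if "j \<le> 2" for j
    using close_evaluations_tendsto[OF g(1) _ _ xz z(2), of j f] close_evaluations_tendsto[OF g(1) _ _ yz z(2), of j f]
      Ck_close_mono[OF f(1) that] that g(2) by auto
  note l0 = lim[of 0, simplified] note l1 = lim[of 1, OF one_le_numeral] note l2 = lim[of 2, OF order_refl]
  have "(\<lambda>n. chord_fst (f (r n)) (x (r n)) (y (r n))) \<longlonglongrightarrow> chord_fst g (fst z) (snd z)"
    "(\<lambda>n. chord_snd (f (r n)) (x (r n)) (y (r n))) \<longlonglongrightarrow> chord_snd g (fst z) (snd z)"
    "(\<lambda>n. hess_det (f (r n)) (x (r n)) (y (r n))) \<longlonglongrightarrow> hess_det g (fst z) (snd z)"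
    unfolding chord_fst_def chord_snd_def hess_det_def hess_xx_def hess_yy_def hess_xy_def
    by (intro tendsto_intros l0 l1 l2)+
  moreover have "chord_fst (f (r n)) (x (r n)) (y (r n)) = 0" "chord_snd (f (r n)) (x (r n)) (y (r n)) = 0"
    "hess_det (f (r n)) (x (r n)) (y (r n)) = 0" for n
    using f(3)[of "r n"] by (auto simp: nondegenerate_chord_def)
  ultimately have "chord_fst g (fst z) (snd z) = 0" "chord_snd g (fst z) (snd z) = 0" "hess_det g (fst z) (snd z) = 0"
    by (simp_all add: LIMSEQ_const_iff)
  then show False using nd[of "fst z" "snd z"] z(1) by (simp add: nondegenerate_chord_def)
qed

text \<open>Near the diagonal, injectivity is preserved by the uniform estimate for short chords;
  away from it, by the positive minimum distance \<open>c\<close> on a compact set.\<close>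

lemma (in embedded_closed_curve) embedding_stable:
  "\<exists>e>0. \<forall>f. Ck_open k UNIV f \<longrightarrow> (\<forall>t. f (t + 1) = f t) \<longrightarrow> Ck_close 2 e f g \<longrightarrow> embedded_closed_curve k f"
proof -
  obtain d e1 where d: "0 < d" "d < 1/2" and e1: "e1 > 0"
    and short: "\<And>l f x h. Ck_open l UNIV f \<Longrightarrow> l \<ge> 2 \<Longrightarrow> Ck_close 2 e1 f g \<Longrightarrow> 0 < h \<Longrightarrow> h \<le> d \<Longrightarrow>
      inner (f (x + h) - f x) (D1 f x) > 0 \<and> inner (f (x + h) - f x) (D1 f (x + h)) > 0"
    and imm: "\<And>l f t. Ck_open l UNIV f \<Longrightarrow> l \<ge> 2 \<Longrightarrow> Ck_close 2 e1 f g \<Longrightarrow> D1 f t \<noteq> 0"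
    by (rule short_chords) (rule that; assumption)
  have cont: "continuous_on (long_chords d) (\<lambda>q. norm (g (fst q) - g (snd q)))"
  proof -
    have cg: "continuous_on UNIV g" using continuous_iterated_derivative[OF Ck, of 0 UNIV] by simp
    have "continuous_on (long_chords d) (\<lambda>q. g (fst q))"
      by (rule continuous_on_compose2[OF cg], rule continuous_on_fst, rule continuous_on_id, simp)
    moreover have "continuous_on (long_chords d) (\<lambda>q. g (snd q))"
      by (rule continuous_on_compose2[OF cg], rule continuous_on_snd, rule continuous_on_id, simp)
    ultimately show ?thesis by (intro continuous_on_norm continuous_on_diff)
  qed
  have "(0, d) \<in> long_chords d" using d by (simp add: long_chords_def)
  then obtain q where q: "q \<in> long_chords d"
    "\<And>p. p \<in> long_chords d \<Longrightarrow> norm (g (fst q) - g (snd q)) \<le> norm (g (fst p) - g (snd p))"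
    using continuous_attains_inf[OF compact_long_chords _ cont] by blast
  define c where "c = norm (g (fst q) - g (snd q))"
  have c: "c > 0"
  proof -
    have "g (fst q) \<noteq> g (snd q)"
    proof
      assume "g (fst q) = g (snd q)"
      then have "fst q - snd q = 0" using q(1) d by (intro Ints_abs_less_1 injective) (auto simp: long_chords_def)
      then show False using q(1) d by (auto simp: long_chords_def)
    qed
    then show ?thesis by (simp add: c_def)
  qed
  have "embedded_closed_curve k f" if f: "Ck_open k UNIV f" "\<forall>t. f (t + 1) = f t" and cl: "Ck_close 2 (min e1 (c / 2)) f g" for f
  proof
    have cl1: "Ck_close 2 e1 f g" by (rule Ck_close_mono[OF cl]) auto
    note sh = short[OF f(1) k2 cl1] imm[OF f(1) k2 cl1]
    show "Ck_open k UNIV f" "k \<ge> 2" "f (t + 1) = f t" "D1 f t \<noteq> 0" for t using f k2 sh by auto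
    have per: "f (t + 1) = f t" for t using f(2) by blast
    fix x y assume eq: "f x = f y"
    show "x - y \<in> \<int>"
    proof (rule ccontr)
      assume ni: "x - y \<notin> \<int>"
      define y' where "y' = x + frac (y - x)"
      have "y - x \<notin> \<int>" using ni Ints_minus[of "y - x"] by auto
      then have fr: "0 < y' - x" "y' - x < 1" by (simp_all add: y'_def frac_lt_1)
      have "y' = y + of_int (- \<lfloor>y - x\<rfloor>)" by (simp add: y'_def frac_def)
      then have "f y' = f x" using periodic_int[of f y "- \<lfloor>y - x\<rfloor>", OF per] eq by simp
      \<comment> \<open>The chord vector itself vanishes, so the double point satisfies the equation
        that excludes short chords.\<close>
      then have z0: "chord_fst f x y' = 0" by (simp add: chord_fst_def)
      have L: "(frac x, y' - of_int \<lfloor>x\<rfloor>) \<in> long_chords d"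
        by (rule critical_chord_long[OF f(1) k2 per sh(1) fr z0])
      have "f (frac x) = f x" "f (y' - of_int \<lfloor>x\<rfloor>) = f y'"
        using periodic_int[of f x "- \<lfloor>x\<rfloor>", OF per] periodic_int[of f y' "- \<lfloor>x\<rfloor>", OF per] by (auto simp: frac_def)
      then have z: "f (frac x) = f (y' - of_int \<lfloor>x\<rfloor>)" using \<open>f y' = f x\<close> by simp
      \<comment> \<open>The double point of \<open>f\<close> must close a gap of at least
        \<open>c\<close> in \<open>g\<close>, yet each end moves by less than
        \<open>c / 2\<close>.\<close>
      have "c \<le> norm (g (frac x) - g (y' - of_int \<lfloor>x\<rfloor>))" using q(2)[OF L] by (simp add: c_def)
      also have "\<dots> = norm ((f (y' - of_int \<lfloor>x\<rfloor>) - g (y' - of_int \<lfloor>x\<rfloor>)) - (f (frac x) - g (frac x)))" using z by simp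
      also have "\<dots> \<le> norm (f (y' - of_int \<lfloor>x\<rfloor>) - g (y' - of_int \<lfloor>x\<rfloor>)) + norm (f (frac x) - g (frac x))"
        by (rule norm_triangle_ineq4)
      also have "\<dots> < c / 2 + c / 2"
        using Ck_closeD[OF cl, of 0] by (intro add_strict_mono) (auto simp: less_le_trans)
      finally show False by simp
    qed
  qed
  then show ?thesis using e1 c by (intro exI[of _ "min e1 (c / 2)"]) auto
qed

lemma nondegenerate_of_long_chords:
  assumes f: "Ck_open k UNIV f" "k \<ge> 2" "\<And>t. f (t + 1) = f t"
    and short: "\<And>x h. 0 < h \<Longrightarrow> h \<le> d \<Longrightarrow>
       inner (f (x + h) - f x) (D1 f x) > 0 \<and> inner (f (x + h) - f x) (D1 f (x + h)) > 0"
    and nd: "\<And>x y. (x, y) \<in> long_chords d \<Longrightarrow> nondegenerate_chord f x y"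
    and xy: "0 < y - x" "y - x < 1"
  shows "nondegenerate_chord f x y"
proof (cases "chord_fst f x y = 0")
  case True
  from nd[OF critical_chord_long[OF f short xy True]] show ?thesis
    using nondegenerate_chord_shift(3)[OF f, of x "- \<lfloor>x\<rfloor>" y "- \<lfloor>x\<rfloor>"] by (simp add: frac_def)
qed (simp add: nondegenerate_chord_def)

lemma (in embedded_closed_curve) Morse_stable:
  assumes nd: "\<And>x y. 0 < y - x \<Longrightarrow> y - x < 1 \<Longrightarrow> nondegenerate_chord g x y"
  shows "\<exists>e>0. \<forall>f. Ck_open k UNIV f \<longrightarrow> (\<forall>t. f (t + 1) = f t) \<longrightarrow> Ck_close 2 e f g \<longrightarrow>
    (\<forall>x y. 0 < y - x \<longrightarrow> y - x < 1 \<longrightarrow> nondegenerate_chord f x y)"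
proof -
  obtain d e1 where d: "0 < d" "d < 1/2" and e1: "e1 > 0"
    and short: "\<And>l f x h. Ck_open l UNIV f \<Longrightarrow> l \<ge> 2 \<Longrightarrow> Ck_close 2 e1 f g \<Longrightarrow> 0 < h \<Longrightarrow> h \<le> d \<Longrightarrow>
      inner (f (x + h) - f x) (D1 f x) > 0 \<and> inner (f (x + h) - f x) (D1 f (x + h)) > 0"
    by (rule short_chords) (rule that; assumption)
  have "nondegenerate_chord g x y" if "(x, y) \<in> long_chords d" for x y
    using that d by (intro nd) (auto simp: long_chords_def)
  then obtain e2 where e2: "e2 > 0"
    "\<And>f x y. Ck_close 2 e2 f g \<Longrightarrow> (x, y) \<in> long_chords d \<Longrightarrow> nondegenerate_chord f x y"
    using nondegenerate_chord_stable[OF Ck k2 compact_long_chords] by metis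
  have "nondegenerate_chord f x y"
    if f: "Ck_open k UNIV f" "\<forall>t. f (t + 1) = f t" and cl: "Ck_close 2 (min e1 e2) f g"
      and xy: "0 < y - x" "y - x < 1" for f x y
  proof -
    have cl': "Ck_close 2 e1 f g" "Ck_close 2 e2 f g" by (rule Ck_close_mono[OF cl]; simp)+
    have per: "f (t + 1) = f t" for t using f(2) by blast
    show ?thesis
      by (rule nondegenerate_of_long_chords[OF f(1) k2 per short[OF f(1) k2 cl'(1)] e2(2)[OF cl'(2)] xy])
  qed
  then show ?thesis using e1 e2(1) by (intro exI[of _ "min e1 e2"]) auto
qed

section \<open>The Whitney topology\<close>

lemma Ck_curves_periodic: "(\<gamma> \<circ> circle_exp) (t + 1) = (\<gamma> \<circ> circle_exp) t"
  by (simp add: circle_exp_add_1)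

lemma Ck_curves_open: "\<gamma> \<in> Ck_curves k \<Longrightarrow> Ck_open k UNIV (\<gamma> \<circ> circle_exp)"
  by (simp add: Ck_curves_def)

text \<open>The derivatives of \<open>\<gamma>\<close> are continuous functions \<open>G j\<close>
  on the circle, so the tube of radius \<open>e\<close> around them is open in the jet
  space.\<close>

lemma Whitney_ball:
  fixes \<gamma> :: "complex \<Rightarrow> real ^ 'd"
  assumes \<gamma>: "\<gamma> \<in> Ck_curves k" and e: "e > 0"
  shows "\<exists>N. openin (Whitney_topology k) N \<and> \<gamma> \<in> N \<and>
    (\<forall>\<gamma>'\<in>N. \<gamma>' \<in> Ck_curves k \<and> Ck_close k e (\<gamma>' \<circ> circle_exp) (\<gamma> \<circ> circle_exp))"
proof -
  let ?g = "\<gamma> \<circ> circle_exp"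
  have g: "Ck_open k UNIV ?g" using \<gamma> by (rule Ck_curves_open)
  \<comment> \<open>The choice of angle does not matter, since the derivatives are periodic.\<close>
  define G where "G = (\<lambda>j z. iterated_derivative j ?g (SOME t. circle_exp t = z))"
  have Ge: "G j (circle_exp t) = iterated_derivative j ?g t" if "j \<le> k" for j t
  proof -
    define s where "s = (SOME s. circle_exp s = circle_exp t)"
    have "circle_exp s = circle_exp t" unfolding s_def by (rule someI[of _ t]) simp
    then obtain n where "s - t = of_int n" unfolding circle_exp_eq_iff by (auto elim!: Ints_cases)
    then have "s = t + of_int n" by simp
    then show ?thesis
      using periodic_iterated(1)[OF g that Ck_curves_periodic, of t n]
      unfolding G_def s_def[symmetric] o_def by simp
  qed
  have cG: "continuous_on S1 (G j)" if "j \<le> k" for j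
  proof (rule continuous_on_S1)
    have "G j \<circ> circle_exp = iterated_derivative j ?g" using Ge[OF that] by auto
    then show "continuous_on UNIV (G j \<circ> circle_exp)" using continuous_iterated_derivative[OF g that] by simp
  qed
  define A where "A = (\<lambda>j. {v \<in> topspace (jet_space k). norm (snd v j - G j (fst v)) \<in> {..<e}})"
  have oA: "openin (jet_space k) (A j)" if j: "j \<le> k" for j
    unfolding A_def
  proof (rule openin_continuous_map_preimage)
    have "continuous_map (jet_space k) euclidean ((\<lambda>p. p j) \<circ> snd)"
      unfolding jet_space_def using j
      by (intro continuous_map_compose[OF continuous_map_snd] continuous_map_product_projection) auto
    moreover have "continuous_map (jet_space k) euclidean (G j \<circ> fst)"
      unfolding jet_space_def using cG[OF j]
      by (intro continuous_map_compose[OF continuous_map_fst]) auto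
    ultimately have "continuous_map (jet_space k) euclidean (\<lambda>v. snd v j - G j (fst v))"
      unfolding o_def by (rule continuous_map_diff)
    then show "continuous_map (jet_space k) euclideanreal (\<lambda>v. norm (snd v j - G j (fst v)))"
      by (rule continuous_map_norm)
  qed simp
  have oU: "openin (jet_space k) (\<Inter>j\<in>{..k}. A j)"
    by (rule openin_Inter) (auto simp: oA)
  define N where "N = {\<gamma>' \<in> Ck_curves k. range (jet k \<gamma>') \<subseteq> (\<Inter>j\<in>{..k}. A j)}"
  have jet: "jet k \<gamma>' t \<in> A j \<longleftrightarrow> norm (iterated_derivative j (\<gamma>' \<circ> circle_exp) t - iterated_derivative j ?g t) < e"
    if "j \<le> k" for \<gamma>' :: "complex \<Rightarrow> real ^ 'd" and t j
  proof -
    have "jet k \<gamma>' t \<in> topspace (jet_space k)"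
      using circle_exp_in[of t] unfolding jet_def jet_space_def by simp
    then show ?thesis using that by (simp add: A_def jet_def Ge)
  qed
  have "openin (Whitney_topology k) N"
    unfolding Whitney_topology_def N_def using oU by (intro topology_generated_by_Basis) blast
  moreover have "\<gamma> \<in> N" using \<gamma> e jet by (auto simp: N_def)
  moreover have "\<forall>\<gamma>'\<in>N. \<gamma>' \<in> Ck_curves k \<and> Ck_close k e (\<gamma>' \<circ> circle_exp) ?g"
    using jet unfolding N_def Ck_close_def by blast
  ultimately show ?thesis by blast
qed

lemma jet_frac:
  assumes "\<gamma> \<in> Ck_curves k"
  shows "jet k \<gamma> (frac t) = jet k \<gamma> t"
proof -
  have "circle_exp (frac t) = circle_exp t" by (simp add: circle_exp_eq_iff frac_def)
  moreover have "iterated_derivative j (\<gamma> \<circ> circle_exp) (frac t) = iterated_derivative j (\<gamma> \<circ> circle_exp) t" if "j \<le> k" for j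
    using periodic_iterated(4)[OF Ck_curves_open[OF assms] that Ck_curves_periodic] .
  ultimately show ?thesis by (auto simp: jet_def restrict_def fun_eq_iff)
qed

text \<open>Escaping jets would occur at angles in [0, 1] for ever closer curves; along a convergent
  subsequence of angles these jets tend to a jet of \<open>\<gamma>\<close>, which lies in the open
  set \<open>U\<close>.\<close>

lemma Whitney_basis_contains_ball:
  fixes \<gamma> :: "complex \<Rightarrow> real ^ 'd"
  assumes \<gamma>: "\<gamma> \<in> Ck_curves k" "range (jet k \<gamma>) \<subseteq> U" and U: "openin (jet_space k) U"
  shows "\<exists>e>0. \<forall>\<gamma>'\<in>Ck_curves k. Ck_close k e (\<gamma>' \<circ> circle_exp) (\<gamma> \<circ> circle_exp) \<longrightarrow> range (jet k \<gamma>') \<subseteq> U"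
proof (rule ccontr)
  let ?g = "\<gamma> \<circ> circle_exp"
  assume neg: "\<not> ?thesis"
  have "\<exists>\<gamma>' t. \<gamma>' \<in> Ck_curves k \<and> Ck_close k (1 / real (Suc n)) (\<gamma>' \<circ> circle_exp) ?g \<and> t \<in> {0..1} \<and> jet k \<gamma>' t \<notin> U" for n
  proof -
    have "1 / real (Suc n) > 0" by simp
    then obtain \<gamma>' where c: "\<gamma>' \<in> Ck_curves k" "Ck_close k (1 / real (Suc n)) (\<gamma>' \<circ> circle_exp) ?g"
      and "\<not> range (jet k \<gamma>') \<subseteq> U" using neg by blast
    then obtain s where "jet k \<gamma>' s \<notin> U" by blast
    then have "jet k \<gamma>' (frac s) \<notin> U" using jet_frac[OF c(1)] by simp
    then show ?thesis using c frac_ge_0[of s] frac_lt_1[of s] by (metis atLeastAtMost_iff less_imp_le)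
  qed
  then obtain \<delta> t where \<delta>: "\<And>n. \<delta> n \<in> Ck_curves k"
    "\<And>n. Ck_close k (1 / real (Suc n)) (\<delta> n \<circ> circle_exp) ?g" "\<And>n. t n \<in> {0..1}" "\<And>n. jet k (\<delta> n) (t n) \<notin> U"
    by metis
  obtain t0 r where r: "strict_mono r" "(t \<circ> r) \<longlonglongrightarrow> t0"
    using compact_imp_seq_compact[OF compact_Icc[of 0 1]] \<delta>(3) by (meson seq_compactE)
  have "jet k \<gamma> t0 \<in> U" using \<gamma>(2) by blast
  then have "(circle_exp t0, \<lambda>j\<in>{..k}. iterated_derivative j ?g t0) \<in> U" by (simp only: jet_def)
  from U[unfolded jet_space_def openin_prod_topology_alt, rule_format, OF this]
  obtain V W where VW: "openin (top_of_set S1) V" "openin (product_topology (\<lambda>_. euclidean) {..k}) W"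
    "circle_exp t0 \<in> V" "(\<lambda>j\<in>{..k}. iterated_derivative j ?g t0) \<in> W" "V \<times> W \<subseteq> U"
    by (elim exE conjE)
  from product_topology_open_contains_basis[OF VW(2,4)]
  obtain X where X: "(\<lambda>j\<in>{..k}. iterated_derivative j ?g t0) \<in> Pi\<^sub>E {..k} X" "\<And>j. openin euclidean (X j)" "Pi\<^sub>E {..k} X \<subseteq> W"
    by (elim exE conjE) (rule that, auto)
  obtain V' where V': "open V'" "V = S1 \<inter> V'" using VW(1) by (auto simp: openin_open)
  have "isCont circle_exp t0" using continuous_circle_exp[of UNIV] by (simp add: continuous_on_eq_continuous_at)
  then have "(\<lambda>n. circle_exp (t (r n))) \<longlonglongrightarrow> circle_exp t0"
    using r(2) isCont_tendsto_compose by (fastforce simp: o_def)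
  then have ev1: "\<forall>\<^sub>F n in sequentially. circle_exp (t (r n)) \<in> V'"
    using V' VW(3) topological_tendstoD by blast
  have ev2: "\<forall>\<^sub>F n in sequentially. iterated_derivative j (\<delta> (r n) \<circ> circle_exp) (t (r n)) \<in> X j" if j: "j \<le> k" for j
  proof -
    have lim: "(\<lambda>n. iterated_derivative j (\<delta> (r n) \<circ> circle_exp) (t (r n))) \<longlonglongrightarrow> iterated_derivative j ?g t0"
      using close_evaluations_tendsto[OF Ck_curves_open[OF \<gamma>(1)] j, of "\<lambda>n. \<delta> n \<circ> circle_exp" "\<lambda>n. t (r n)" t0 r]
        Ck_close_mono[OF \<delta>(2) j order_refl] r by (simp add: o_def)
    have mem: "iterated_derivative j ?g t0 \<in> X j" using PiE_mem[OF X(1), of j] j by simp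
    have "open (X j)" using X(2)[of j] by (simp only: open_openin)
    then show ?thesis by (rule topological_tendstoD[OF lim _ mem])
  qed
  have "\<forall>\<^sub>F n in sequentially. \<forall>j\<in>{..k}. iterated_derivative j (\<delta> (r n) \<circ> circle_exp) (t (r n)) \<in> X j"
    using ev2 by (intro eventually_ball_finite) auto
  with ev1 have "\<forall>\<^sub>F n in sequentially. jet k (\<delta> (r n)) (t (r n)) \<in> U"
  proof eventually_elim
    case (elim n)
    have "circle_exp (t (r n)) \<in> V" using elim(1) V' circle_exp_in by blast
    moreover have "(\<lambda>j\<in>{..k}. iterated_derivative j (\<delta> (r n) \<circ> circle_exp) (t (r n))) \<in> Pi\<^sub>E {..k} X"
      using elim(2) by auto
    ultimately show ?case unfolding jet_def using X(3) VW(5) by blast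
  qed
  then obtain n where "jet k (\<delta> (r n)) (t (r n)) \<in> U" by (auto simp: eventually_sequentially)
  then show False using \<delta>(4) by blast
qed

lemma Whitney_open_contains_ball:
  fixes \<gamma> :: "complex \<Rightarrow> real ^ 'd"
  assumes "openin (Whitney_topology k) N" "\<gamma> \<in> N"
  shows "\<exists>e>0. \<forall>\<gamma>'\<in>Ck_curves k. Ck_close k e (\<gamma>' \<circ> circle_exp) (\<gamma> \<circ> circle_exp) \<longrightarrow> \<gamma>' \<in> N"
proof -
  let ?S = "{{\<gamma> \<in> Ck_curves k. range (jet k \<gamma>) \<subseteq> U} |U. openin (jet_space k) U} :: (complex \<Rightarrow> real ^ 'd) set set"
  have "generate_topology_on ?S N"
    using assms(1) unfolding Whitney_topology_def openin_topology_generated_by_iff .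
  then show ?thesis using assms(2)
  proof (induction arbitrary: \<gamma> rule: generate_topology_on.induct)
    case (Int a b)
    then obtain e e' where "e > 0" "\<forall>\<gamma>'\<in>Ck_curves k. Ck_close k e (\<gamma>' \<circ> circle_exp) (\<gamma> \<circ> circle_exp) \<longrightarrow> \<gamma>' \<in> a"
      "e' > 0" "\<forall>\<gamma>'\<in>Ck_curves k. Ck_close k e' (\<gamma>' \<circ> circle_exp) (\<gamma> \<circ> circle_exp) \<longrightarrow> \<gamma>' \<in> b" by blast
    then show ?case
      by (intro exI[of _ "min e e'"]) (meson Ck_close_mono IntI min.cobounded1 min.cobounded2 min_less_iff_conj order_refl)
  next
    case (UN K)
    then show ?case by (meson Union_iff)
  next
    case (Basis s)
    then obtain U where U: "openin (jet_space k) U" "s = {\<gamma> \<in> Ck_curves k. range (jet k \<gamma>) \<subseteq> U}" by blast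
    then show ?case using Whitney_basis_contains_ball[of \<gamma> k U] Basis.prems by blast
  qed simp
qed

section \<open>Openness of the Morse-supported embeddings\<close>

lemma openin_Morse_embeddings:
  assumes k: "k \<ge> 2"
  shows "openin (Embedding_space k) (Morse_embeddings k :: (complex \<Rightarrow> real ^ 'd) set)"
proof -
  have "\<exists>N. openin (Embedding_space k) N \<and> \<gamma> \<in> N \<and> N \<subseteq> Morse_embeddings k"
    if \<gamma>: "\<gamma> \<in> Morse_embeddings k" for \<gamma> :: "complex \<Rightarrow> real ^ 'd"
  proof -
    have emb: "\<gamma> \<in> Ck_embeddings k" using \<gamma> by (simp add: Morse_embeddings_def)
    interpret embedded_closed_curve k "\<gamma> \<circ> circle_exp" by (rule embedded_closed_curve_of_embedding[OF emb k])
    have "\<And>x y. 0 < y - x \<Longrightarrow> y - x < 1 \<Longrightarrow> nondegenerate_chord (\<gamma> \<circ> circle_exp) x y"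
      using \<gamma> Morse_supported_iff[OF embedded_closed_curve_axioms] by (auto simp: Morse_embeddings_def)
    from Morse_stable[OF this] obtain e where e: "e > 0"
      "\<And>f. Ck_open k UNIV f \<Longrightarrow> \<forall>t. f (t + 1) = f t \<Longrightarrow> Ck_close 2 e f (\<gamma> \<circ> circle_exp) \<Longrightarrow>
        \<forall>x y. 0 < y - x \<longrightarrow> y - x < 1 \<longrightarrow> nondegenerate_chord f x y" by blast
    obtain N where N: "openin (Whitney_topology k) N" "\<gamma> \<in> N"
      "\<And>\<gamma>'. \<gamma>' \<in> N \<Longrightarrow> \<gamma>' \<in> Ck_curves k \<and> Ck_close k e (\<gamma>' \<circ> circle_exp) (\<gamma> \<circ> circle_exp)"
      using Whitney_ball[of \<gamma> k e] emb e(1) by (auto simp: Ck_embeddings_def)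
    have "N \<inter> Ck_embeddings k \<subseteq> Morse_embeddings k"
    proof
      fix \<gamma>' assume "\<gamma>' \<in> N \<inter> Ck_embeddings k"
      then have n: "\<gamma>' \<in> Ck_curves k" "Ck_close k e (\<gamma>' \<circ> circle_exp) (\<gamma> \<circ> circle_exp)" "\<gamma>' \<in> Ck_embeddings k"
        using N(3) by auto
      have "\<forall>x y. 0 < y - x \<longrightarrow> y - x < 1 \<longrightarrow> nondegenerate_chord (\<gamma>' \<circ> circle_exp) x y"
        using e(2)[OF Ck_curves_open[OF n(1)] _ Ck_close_mono[OF n(2) k order_refl]] Ck_curves_periodic by blast
      then show "\<gamma>' \<in> Morse_embeddings k"
        using n(3) Morse_supported_iff[OF embedded_closed_curve_of_embedding[OF n(3) k]]
        by (simp add: Morse_embeddings_def)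
    qed
    moreover have "openin (Embedding_space k) (N \<inter> Ck_embeddings k)"
      unfolding Embedding_space_def openin_subtopology using N(1) by blast
    ultimately show ?thesis using N(2) emb by blast
  qed
  then show ?thesis by (subst openin_subopen) blast
qed

section \<open>Density: a finite-dimensional family of perturbations\<close>

definition perturb ::
    "(real \<Rightarrow> real) \<Rightarrow> (real \<Rightarrow> real) \<Rightarrow> 'v \<Rightarrow> (real \<Rightarrow> 'v::real_vector) \<Rightarrow> real \<Rightarrow> real \<Rightarrow> real \<Rightarrow> 'v" where
  "perturb \<alpha> \<beta> D f a b = (\<lambda>t. f t + (a * \<alpha> t + b * \<beta> t) *\<^sub>R D)"

lemma perturb_alt: "perturb \<alpha> \<beta> D f a b = (\<lambda>t. (f t + a *\<^sub>R (\<alpha> t *\<^sub>R D)) + b *\<^sub>R (\<beta> t *\<^sub>R D))"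
  by (simp add: perturb_def scaleR_add_left add.assoc)

lemma Ck_open_scaleR_const: "Ck_open k UNIV \<alpha> \<Longrightarrow> Ck_open k UNIV (\<lambda>t. \<alpha> t *\<^sub>R D)"
  by (rule Ck_open_bilinear[OF bounded_bilinear_scaleR _ Ck_open_const])

lemma Ck_open_add_scaled: "Ck_open k UNIV f \<Longrightarrow> Ck_open k UNIV h \<Longrightarrow> Ck_open k UNIV (\<lambda>t. f t + a *\<^sub>R h t)"
  by (rule Ck_open_add[OF _ Ck_open_bilinear[OF bounded_bilinear_scaleR Ck_open_const]])

lemma Ck_open_perturb:
  assumes "Ck_open k UNIV f" "Ck_open k UNIV \<alpha>" "Ck_open k UNIV \<beta>"
  shows "Ck_open k UNIV (perturb \<alpha> \<beta> D f a b)"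
  unfolding perturb_alt
  by (rule Ck_open_add_scaled[OF Ck_open_add_scaled[OF assms(1) Ck_open_scaleR_const[OF assms(2)]]
        Ck_open_scaleR_const[OF assms(3)]])

lemma iterated_derivative_scaleR_const:
  fixes \<alpha> :: "real \<Rightarrow> real" and D :: "'v::real_normed_vector"
  assumes "Ck_open k UNIV \<alpha>" "j \<le> k"
  shows "iterated_derivative j (\<lambda>t. \<alpha> t *\<^sub>R D) t = iterated_derivative j \<alpha> t *\<^sub>R D"
  using assms(2)
proof (induction j arbitrary: t)
  case (Suc j)
  have eq: "iterated_derivative j (\<lambda>t. \<alpha> t *\<^sub>R D) = (\<lambda>t. iterated_derivative j \<alpha> t *\<^sub>R D)"
    using Suc by auto
  have "((\<lambda>t. iterated_derivative j \<alpha> t *\<^sub>R D) has_vector_derivative iterated_derivative (Suc j) \<alpha> t *\<^sub>R D) (at t)"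
    using has_vector_derivative_iterated[OF assms(1)] Suc.prems
    by (intro bounded_linear.has_vector_derivative[OF bounded_linear_scaleR_left]) simp
  then show ?case unfolding iterated_derivative_Suc[of j "\<lambda>t. \<alpha> t *\<^sub>R D"] eq by (rule vector_derivative_at)
qed simp

lemma iterated_derivative_perturb:
  assumes "Ck_open k UNIV f" "Ck_open k UNIV \<alpha>" "Ck_open k UNIV \<beta>" "j \<le> k"
  shows "iterated_derivative j (perturb \<alpha> \<beta> D f a b) t =
    iterated_derivative j f t + (a * iterated_derivative j \<alpha> t + b * iterated_derivative j \<beta> t) *\<^sub>R D"
proof -
  note fa = Ck_open_add_scaled[OF assms(1) Ck_open_scaleR_const[OF assms(2)], of a D]
  have "iterated_derivative j (perturb \<alpha> \<beta> D f a b) t =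
      (iterated_derivative j f t + a *\<^sub>R iterated_derivative j (\<lambda>t. \<alpha> t *\<^sub>R D) t) +
      b *\<^sub>R iterated_derivative j (\<lambda>t. \<beta> t *\<^sub>R D) t"
    unfolding perturb_alt
      iterated_derivative_add_scaled[OF fa Ck_open_scaleR_const[OF assms(3)] assms(4)]
      iterated_derivative_add_scaled[OF assms(1) Ck_open_scaleR_const[OF assms(2)] assms(4)] ..
  then show ?thesis
    unfolding iterated_derivative_scaleR_const[OF assms(2,4)] iterated_derivative_scaleR_const[OF assms(3,4)]
    by (simp add: scaleR_add_left add.assoc)
qed

text \<open>Common form of the two gradient equations, so that the parameter dependence is computed
  once for both ends.\<close>

definition chord_at :: "(real \<Rightarrow> 'v::real_inner) \<Rightarrow> real \<Rightarrow> real \<Rightarrow> real \<Rightarrow> real" where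
  "chord_at f x y z = inner (f x - f y) (D1 f z)"

lemma chord_at_simps: "chord_at f x y x = chord_fst f x y" "chord_at f x y y = chord_snd f x y"
  by (simp_all add: chord_at_def chord_fst_def chord_snd_def)

text \<open>
  The left-hand side of \<open>chord_at_perturb\<close> below is quadratic in \<open>(a, b)\<close>, so its secants are its partial
  derivatives at the midpoint; \<open>\<gamma>\<close> is \<open>\<alpha>\<close> for the derivative in \<open>a\<close> and \<open>\<beta>\<close> for that in \<open>b\<close>.
\<close>

definition secant ::
    "(real \<Rightarrow> real) \<Rightarrow> (real \<Rightarrow> real) \<Rightarrow> 'v::real_inner \<Rightarrow> (real \<Rightarrow> 'v) \<Rightarrow> (real \<Rightarrow> real) \<Rightarrow>
     real \<Rightarrow> real \<Rightarrow> real \<Rightarrow> real \<Rightarrow> real \<Rightarrow> real" where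
  "secant \<alpha> \<beta> D f \<gamma> x y z a b =
     D1 \<gamma> z * (inner (f x - f y) D + inner D D * (a * (\<alpha> x - \<alpha> y) + b * (\<beta> x - \<beta> y))) +
     (\<gamma> x - \<gamma> y) * (inner D (D1 f z) + inner D D * (a * D1 \<alpha> z + b * D1 \<beta> z))"

lemma chord_at_perturb:
  assumes "Ck_open k UNIV f" "Ck_open k UNIV \<alpha>" "Ck_open k UNIV \<beta>" "k \<ge> 2"
  shows "chord_at (perturb \<alpha> \<beta> D f a b) x y z =
    inner (f x - f y) (D1 f z) + (a * D1 \<alpha> z + b * D1 \<beta> z) * inner (f x - f y) D +
    (a * (\<alpha> x - \<alpha> y) + b * (\<beta> x - \<beta> y)) * inner D (D1 f z) +
    (a * (\<alpha> x - \<alpha> y) + b * (\<beta> x - \<beta> y)) * (a * D1 \<alpha> z + b * D1 \<beta> z) * inner D D"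
proof -
  have 1: "D1 (perturb \<alpha> \<beta> D f a b) z = D1 f z + (a * D1 \<alpha> z + b * D1 \<beta> z) *\<^sub>R D"
    using iterated_derivative_perturb[OF assms(1-3), of 1] assms(4) by simp
  have 2: "perturb \<alpha> \<beta> D f a b x - perturb \<alpha> \<beta> D f a b y =
      (f x - f y) + (a * (\<alpha> x - \<alpha> y) + b * (\<beta> x - \<beta> y)) *\<^sub>R D"
    by (simp add: perturb_def algebra_simps)
  show ?thesis unfolding chord_at_def 1 2
    by (simp add: inner_add_left inner_add_right algebra_simps)
qed

lemma chord_at_secant:
  assumes "Ck_open k UNIV f" "Ck_open k UNIV \<alpha>" "Ck_open k UNIV \<beta>" "k \<ge> 2"
  shows "chord_at (perturb \<alpha> \<beta> D f a' b') x y z - chord_at (perturb \<alpha> \<beta> D f a b) x y z =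
    secant \<alpha> \<beta> D f \<alpha> x y z ((a + a') / 2) ((b + b') / 2) * (a' - a) +
    secant \<alpha> \<beta> D f \<beta> x y z ((a + a') / 2) ((b + b') / 2) * (b' - b)"
  unfolding chord_at_perturb[OF assms] secant_def by (simp add: field_simps)

text \<open>A product rule in which the factor \<open>c\<close> merely has a limit, because the
  other factor vanishes at \<open>q\<close>. It breaks a circle: the coefficients of the formula for
  \<open>G\<close> below involve \<open>G\<close>, which at that stage is known only to be
  continuous at the point.\<close>

lemma has_derivative_mult_vanishing:
  fixes c \<psi> :: "'a::real_normed_vector \<Rightarrow> real"
  assumes \<psi>: "(\<psi> has_derivative L) (at q within S)" and 0: "\<psi> q = 0"
    and c: "(c \<longlongrightarrow> c0) (at q within S)"
  shows "((\<lambda>p. c p * \<psi> p) has_derivative (\<lambda>v. c0 * L v)) (at q within S)"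
proof -
  have lin: "bounded_linear L" using \<psi> by (rule has_derivative_bounded_linear)
  obtain K where K: "K > 0" "\<And>v. norm (L v) \<le> norm v * K" using bounded_linear.pos_bounded[OF lin] by blast
  have rem: "((\<lambda>p. (\<psi> p - L (p - q)) / norm (p - q)) \<longlongrightarrow> 0) (at q within S)"
    using \<psi> 0 unfolding has_derivative_within by (simp add: divide_inverse mult.commute)
  have cz: "((\<lambda>p. c p - c0) \<longlongrightarrow> 0) (at q within S)" using tendsto_diff[OF c tendsto_const[of c0]] by simp
  have "((\<lambda>p. (c p - c0) * (L (p - q) / norm (p - q))) \<longlongrightarrow> 0) (at q within S)"
  proof (rule Lim_null_comparison)
    have "norm ((c p - c0) * (L (p - q) / norm (p - q))) \<le> K * \<bar>c p - c0\<bar>" for p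
    proof (cases "p = q")
      case False
      then have "\<bar>L (p - q)\<bar> / norm (p - q) \<le> K" using K(2)[of "p - q"] by (simp add: field_simps)
      then have "\<bar>c p - c0\<bar> * (\<bar>L (p - q)\<bar> / norm (p - q)) \<le> \<bar>c p - c0\<bar> * K" by (rule mult_left_mono) simp
      then show ?thesis by (simp add: abs_mult mult.commute)
    qed (use K(1) in simp)
    then show "\<forall>\<^sub>F p in at q within S. norm ((c p - c0) * (L (p - q) / norm (p - q))) \<le> K * \<bar>c p - c0\<bar>"
      by simp
    show "((\<lambda>p. K * \<bar>c p - c0\<bar>) \<longlongrightarrow> 0) (at q within S)"
      using tendsto_mult_left[OF tendsto_rabs[OF cz], of K] by simp
  qed
  from tendsto_add[OF tendsto_mult[OF c rem] this]
  have "((\<lambda>p. c p * ((\<psi> p - L (p - q)) / norm (p - q)) + (c p - c0) * (L (p - q) / norm (p - q))) \<longlongrightarrow> 0) (at q within S)"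
    by simp
  moreover have "(\<lambda>p. c p * ((\<psi> p - L (p - q)) / norm (p - q)) + (c p - c0) * (L (p - q) / norm (p - q))) =
      (\<lambda>p. (1 / norm (p - q)) *\<^sub>R (c p * \<psi> p - (c q * \<psi> q + c0 * L (p - q))))"
    by (rule ext) (simp add: 0 divide_inverse algebra_simps)
  ultimately have "((\<lambda>p. (1 / norm (p - q)) *\<^sub>R (c p * \<psi> p - (c q * \<psi> q + c0 * L (p - q)))) \<longlongrightarrow> 0) (at q within S)"
    by (simp only:)
  then show ?thesis
    unfolding has_derivative_within using bounded_linear_const_mult[OF lin] by blast
qed

text \<open>Adding the lower bounds of the two rows leaves 3/4 - 1/4 = 1/2 of \<open>s\<close>; for
  the determinant 9/16 exceeds 1/16.\<close>

lemma diagonally_dominant_bound: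
  fixes s :: real
  assumes M: "\<bar>m11 - s\<bar> < s / 4" "\<bar>m22 - s\<bar> < s / 4" "\<bar>m12\<bar> < s / 4" "\<bar>m21\<bar> < s / 4" and s: "s > 0"
  shows "s / 2 * \<bar>h\<bar> \<le> \<bar>m11 * h + m12 * k\<bar> + \<bar>m21 * h + m22 * k\<bar>"
    "s / 2 * \<bar>k\<bar> \<le> \<bar>m11 * h + m12 * k\<bar> + \<bar>m21 * h + m22 * k\<bar>"
    "m11 * m22 - m12 * m21 > 0"
proof -
  have a: "m11 \<ge> 3 * s / 4" "m22 \<ge> 3 * s / 4" using M(1,2) by (auto simp: abs_if split: if_splits)
  have 1: "\<bar>m11 * h + m12 * k\<bar> \<ge> 3 * s / 4 * \<bar>h\<bar> - s / 4 * \<bar>k\<bar>"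
  proof -
    have "\<bar>m11 * h\<bar> \<ge> 3 * s / 4 * \<bar>h\<bar>" unfolding abs_mult using a s by (intro mult_right_mono) auto
    moreover have "\<bar>m12 * k\<bar> \<le> s / 4 * \<bar>k\<bar>" unfolding abs_mult using M(3) by (intro mult_right_mono) auto
    ultimately show ?thesis by linarith
  qed
  have 2: "\<bar>m21 * h + m22 * k\<bar> \<ge> 3 * s / 4 * \<bar>k\<bar> - s / 4 * \<bar>h\<bar>"
  proof -
    have "\<bar>m22 * k\<bar> \<ge> 3 * s / 4 * \<bar>k\<bar>" unfolding abs_mult using a s by (intro mult_right_mono) auto
    moreover have "\<bar>m21 * h\<bar> \<le> s / 4 * \<bar>h\<bar>" unfolding abs_mult using M(4) by (intro mult_right_mono) auto
    ultimately show ?thesis by linarith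
  qed
  have nn: "s * \<bar>h\<bar> \<ge> 0" "s * \<bar>k\<bar> \<ge> 0" using s by auto
  show "s / 2 * \<bar>h\<bar> \<le> \<bar>m11 * h + m12 * k\<bar> + \<bar>m21 * h + m22 * k\<bar>"
    "s / 2 * \<bar>k\<bar> \<le> \<bar>m11 * h + m12 * k\<bar> + \<bar>m21 * h + m22 * k\<bar>"
    using 1 2 nn by (auto simp: field_simps)
  have "m11 * m22 \<ge> (3 * s / 4) * (3 * s / 4)" using a s by (intro mult_mono) auto
  moreover have "\<bar>m12 * m21\<bar> \<le> (s / 4) * (s / 4)" unfolding abs_mult using M s by (intro mult_mono) auto
  moreover have "(3 * s / 4) * (3 * s / 4) > (s / 4) * (s / 4)" using s by (intro mult_strict_mono) auto
  ultimately show "m11 * m22 - m12 * m21 > 0" by linarith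
qed

lemma cramer:
  fixes m11 :: real
  assumes e: "m11 * (g1 - p1) + m12 * (g2 - p2) = - u" "m21 * (g1 - p1) + m22 * (g2 - p2) = - w"
    and d: "d = m11 * m22 - m12 * m21" "d > 0"
  shows "g1 - p1 = m12 / d * w - m22 / d * u" "g2 - p2 = m21 / d * u - m11 / d * w"
proof -
  have uw: "u = - (m11 * (g1 - p1) + m12 * (g2 - p2))" "w = - (m21 * (g1 - p1) + m22 * (g2 - p2))" using e by simp_all
  have "d * (g1 - p1) = m12 * w - m22 * u" "d * (g2 - p2) = m21 * u - m11 * w"
    unfolding uw d(1) by (simp_all add: algebra_simps)
  then show "g1 - p1 = m12 / d * w - m22 / d * u" "g2 - p2 = m21 / d * u - m11 / d * w"
    using d(2) by (simp_all add: field_simps)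
qed

text \<open>
  A critical point \<open>(x, y)\<close> of the perturbed curve determines the parameter \<open>(a, b)\<close>, and this partial
  function \<open>G\<close> is differentiable with derivative \<open>- M\<^sup>-\<^sup>1 L\<close>, where \<open>M\<close> is the invertible derivative in
  the parameters and \<open>L\<close> the Hessian up to sign. Degenerate critical points therefore only occur for
  critical values of \<open>G\<close>, which form a null set by Sard's theorem.
\<close>

lemma perturb_nondegenerate:
  fixes f :: "real \<Rightarrow> 'v::real_inner"
  assumes f: "Ck_open k UNIV f" and ab: "Ck_open k UNIV \<alpha>" "Ck_open k UNIV \<beta>" and k: "k \<ge> 2"
    and s: "s > 0" and r: "0 < r" "r \<le> \<rho>"
    and M: "\<And>x y a b. \<bar>x - x0\<bar> < \<rho> \<Longrightarrow> \<bar>y - y0\<bar> < \<rho> \<Longrightarrow> \<bar>a\<bar> < \<rho> \<Longrightarrow> \<bar>b\<bar> < \<rho> \<Longrightarrow>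
      \<bar>secant \<alpha> \<beta> D f \<alpha> x y x a b - s\<bar> < s / 4 \<and> \<bar>secant \<alpha> \<beta> D f \<beta> x y y a b - s\<bar> < s / 4 \<and>
      \<bar>secant \<alpha> \<beta> D f \<beta> x y x a b\<bar> < s / 4 \<and> \<bar>secant \<alpha> \<beta> D f \<alpha> x y y a b\<bar> < s / 4"
  shows "\<exists>a b. \<bar>a\<bar> < r \<and> \<bar>b\<bar> < r \<and>
    (\<forall>x y. \<bar>x - x0\<bar> < \<rho> \<longrightarrow> \<bar>y - y0\<bar> < \<rho> \<longrightarrow> nondegenerate_chord (perturb \<alpha> \<beta> D f a b) x y)"
proof -
  define F where "F = (\<lambda>p::real^2. perturb \<alpha> \<beta> D f (p $ 1) (p $ 2))"
  define P where "P = {p::real^2. \<bar>p $ 1\<bar> < r \<and> \<bar>p $ 2\<bar> < r}"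
  define Q where "Q = {q::real^2. \<bar>q $ 1 - x0\<bar> < \<rho> \<and> \<bar>q $ 2 - y0\<bar> < \<rho>}"
  define bad where "bad = (\<lambda>(q::real^2) (p::real^2). p \<in> P \<and> \<not> nondegenerate_chord (F p) (q $ 1) (q $ 2))"
  \<comment> \<open>The chords of the box that become degenerate for some parameter in
    \<open>P\<close>; \<open>G\<close> selects that parameter, which \<open>uniq\<close> shows to be
    determined by the chord.\<close>
  define S where "S = {q\<in>Q. \<exists>p. bad q p}"
  define G where "G = (\<lambda>q. SOME p. bad q p)"
  have G: "bad q (G q)" if "q \<in> S" for q
    using that someI_ex[of "bad q"] unfolding S_def G_def by blast
  have FCk: "Ck_open k UNIV (F p)" for p unfolding F_def by (rule Ck_open_perturb[OF f ab])
  have zero: "chord_at (F p) (q $ 1) (q $ 2) (q $ 1) = 0" "chord_at (F p) (q $ 1) (q $ 2) (q $ 2) = 0"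
    "hess_det (F p) (q $ 1) (q $ 2) = 0" if "bad q p" for q p
    using that by (auto simp: bad_def nondegenerate_chord_def chord_at_simps)
  define m where "m = (\<lambda>\<gamma> z (q::real^2) (p::real^2) (p'::real^2).
    secant \<alpha> \<beta> D f \<gamma> (q $ 1) (q $ 2) (q $ z) ((p $ 1 + p' $ 1) / 2) ((p $ 2 + p' $ 2) / 2))"
  have sec: "chord_at (F p') (q $ 1) (q $ 2) (q $ z) - chord_at (F p) (q $ 1) (q $ 2) (q $ z) =
      m \<alpha> z q p p' * (p' $ 1 - p $ 1) + m \<beta> z q p p' * (p' $ 2 - p $ 2)" for p p' q z
    unfolding F_def m_def by (rule chord_at_secant[OF f ab k])
  have dom: "\<bar>m \<alpha> 1 q p p' - s\<bar> < s / 4" "\<bar>m \<beta> 2 q p p' - s\<bar> < s / 4" "\<bar>m \<beta> 1 q p p'\<bar> < s / 4" "\<bar>m \<alpha> 2 q p p'\<bar> < s / 4"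
    if "q \<in> Q" "p \<in> P" "p' \<in> P" for q p p'
  proof -
    have "\<bar>(p $ i + p' $ i) / 2\<bar> < \<rho>" if "\<bar>p $ i\<bar> < r" "\<bar>p' $ i\<bar> < r" for i
    proof -
      have "\<bar>p $ i + p' $ i\<bar> < 2 * \<rho>" using abs_triangle_ineq[of "p $ i" "p' $ i"] that r by linarith
      then show ?thesis by simp
    qed
    then show "\<bar>m \<alpha> 1 q p p' - s\<bar> < s / 4" "\<bar>m \<beta> 2 q p p' - s\<bar> < s / 4" "\<bar>m \<beta> 1 q p p'\<bar> < s / 4" "\<bar>m \<alpha> 2 q p p'\<bar> < s / 4"
      using M[of "q $ 1" "q $ 2" "(p $ 1 + p' $ 1) / 2" "(p $ 2 + p' $ 2) / 2"] that
      by (auto simp: m_def Q_def P_def)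
  qed
  have bound: "s / 2 * \<bar>h\<bar> \<le> \<bar>m \<alpha> 1 q p p' * h + m \<beta> 1 q p p' * l\<bar> + \<bar>m \<alpha> 2 q p p' * h + m \<beta> 2 q p p' * l\<bar>"
    "s / 2 * \<bar>l\<bar> \<le> \<bar>m \<alpha> 1 q p p' * h + m \<beta> 1 q p p' * l\<bar> + \<bar>m \<alpha> 2 q p p' * h + m \<beta> 2 q p p' * l\<bar>"
    "m \<alpha> 1 q p p' * m \<beta> 2 q p p' - m \<beta> 1 q p p' * m \<alpha> 2 q p p' > 0"
    if "q \<in> Q" "p \<in> P" "p' \<in> P" for q p p' h l
    by (rule diagonally_dominant_bound[OF dom[OF that] s])+
  have uniq: "p = p'" if "bad q p" "bad q p'" "q \<in> Q" for q p p'
  proof -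
    have PP: "p \<in> P" "p' \<in> P" using that by (auto simp: bad_def)
    have e: "m \<alpha> 1 q p p' * (p' $ 1 - p $ 1) + m \<beta> 1 q p p' * (p' $ 2 - p $ 2) = 0"
      "m \<alpha> 2 q p p' * (p' $ 1 - p $ 1) + m \<beta> 2 q p p' * (p' $ 2 - p $ 2) = 0"
      using sec[of p' q 1 p] sec[of p' q 2 p] zero[OF that(1)] zero[OF that(2)] by simp_all
    have "s / 2 * \<bar>p' $ 1 - p $ 1\<bar> \<le> 0" "s / 2 * \<bar>p' $ 2 - p $ 2\<bar> \<le> 0"
      using bound(1,2)[OF that(3) PP, where h = "p' $ 1 - p $ 1" and l = "p' $ 2 - p $ 2"] unfolding e by simp_all
    then have "p' $ 1 - p $ 1 = 0" "p' $ 2 - p $ 2 = 0" using s by (simp_all add: mult_le_0_iff)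
    then show ?thesis by (simp add: vec_eq_iff forall_2)
  qed
  \<comment> \<open>Nothing is known about the shape of \<open>S\<close>, so derivatives are taken
    within \<open>S\<close>. The secant bound first gives continuity of \<open>G\<close> at
    \<open>q\<close>; then the secant equations are solved for \<open>G\<close>, and the solution is
    differentiated.\<close>
  have der: "\<exists>L. (G has_derivative L) (at q within S) \<and> rank (matrix L) < CARD(2)" if q: "q \<in> S" for q
  proof -
    define p where "p = G q"
    have bq: "bad q p" using G[OF q] by (simp add: p_def)
    have pP: "p \<in> P" using bq by (simp add: bad_def)
    have qQ: "q \<in> Q" using q by (simp add: S_def)
    let ?x = "q $ 1" and ?y = "q $ 2"
    let ?a = "hess_xx (F p) ?x ?y" and ?b = "hess_xy (F p) ?x ?y" and ?c = "hess_yy (F p) ?x ?y"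
    define \<psi>1 where "\<psi>1 = (\<lambda>q'::real^2. chord_fst (F p) (q' $ 1) (q' $ 2))"
    define \<psi>2 where "\<psi>2 = (\<lambda>q'::real^2. chord_snd (F p) (q' $ 1) (q' $ 2))"
    define L1 where "L1 = (\<lambda>v::real^2. ?a * v $ 1 + ?b * v $ 2)"
    define L2 where "L2 = (\<lambda>v::real^2. - ?b * v $ 1 - ?c * v $ 2)"
    have pair: "((\<lambda>q'::real^2. (q' $ 1, q' $ 2)) has_derivative (\<lambda>v. (v $ 1, v $ 2))) (at q within S)"
      by (intro has_derivative_Pair bounded_linear_imp_has_derivative bounded_linear_vec_nth)
    have d1: "(\<psi>1 has_derivative L1) (at q within S)"
      using has_derivative_compose[OF pair has_derivative_chord_fst[OF FCk k]] by (simp add: \<psi>1_def L1_def)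
    have d2: "(\<psi>2 has_derivative L2) (at q within S)"
      using has_derivative_compose[OF pair has_derivative_chord_snd[OF FCk k]] by (simp add: \<psi>2_def L2_def)
    have z: "\<psi>1 q = 0" "\<psi>2 q = 0" using zero[OF bq] by (simp_all add: \<psi>1_def \<psi>2_def chord_at_simps)
    have eqs: "m \<alpha> 1 q' p (G q') * (G q' $ 1 - p $ 1) + m \<beta> 1 q' p (G q') * (G q' $ 2 - p $ 2) = - \<psi>1 q'"
      "m \<alpha> 2 q' p (G q') * (G q' $ 1 - p $ 1) + m \<beta> 2 q' p (G q') * (G q' $ 2 - p $ 2) = - \<psi>2 q'"
      if "q' \<in> S" for q'
      using sec[of "G q'" q' 1 p] sec[of "G q'" q' 2 p] zero[OF G[OF that]]
      by (simp_all add: \<psi>1_def \<psi>2_def chord_at_simps)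
    have GP: "G q' \<in> P" "q' \<in> Q" if "q' \<in> S" for q' using G[OF that] that by (auto simp: bad_def S_def)
    have \<psi>0: "(\<psi>1 \<longlongrightarrow> 0) (at q within S)" "(\<psi>2 \<longlongrightarrow> 0) (at q within S)"
      using has_derivative_continuous[OF d1] has_derivative_continuous[OF d2] z
      by (simp_all add: continuous_within)
    have Glim: "((\<lambda>q'. G q' $ i) \<longlongrightarrow> p $ i) (at q within S)" if "i = 1 \<or> i = 2" for i
    proof (rule Lim_transform2)
      show "((\<lambda>q'. p $ i) \<longlongrightarrow> p $ i) (at q within S)" by simp
      show "((\<lambda>q'. p $ i - G q' $ i) \<longlongrightarrow> 0) (at q within S)"
      proof (rule Lim_null_comparison)
        have "norm (p $ i - G q' $ i) \<le> 2 / s * (\<bar>\<psi>1 q'\<bar> + \<bar>\<psi>2 q'\<bar>)" if "q' \<in> S" for q'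
        proof -
          have "s / 2 * \<bar>G q' $ i - p $ i\<bar> \<le> \<bar>\<psi>1 q'\<bar> + \<bar>\<psi>2 q'\<bar>"
            using bound(1,2)[OF GP(2)[OF that] pP GP(1)[OF that], where h = "G q' $ 1 - p $ 1" and l = "G q' $ 2 - p $ 2"]
              eqs[OF that] \<open>i = 1 \<or> i = 2\<close> by auto
          then show ?thesis using s by (simp add: field_simps abs_minus_commute)
        qed
        then show "\<forall>\<^sub>F q' in at q within S. norm (p $ i - G q' $ i) \<le> 2 / s * (\<bar>\<psi>1 q'\<bar> + \<bar>\<psi>2 q'\<bar>)"
          by (simp add: eventually_at_filter)
        show "((\<lambda>q'. 2 / s * (\<bar>\<psi>1 q'\<bar> + \<bar>\<psi>2 q'\<bar>)) \<longlongrightarrow> 0) (at q within S)"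
          using tendsto_mult_left[OF tendsto_add[OF tendsto_rabs[OF \<psi>0(1)] tendsto_rabs[OF \<psi>0(2)]], of "2 / s"] by simp
      qed
    qed
    have ev: "((\<lambda>q'. h (q' $ i)) \<longlongrightarrow> h (q $ i)) (at q within S)" if "continuous_on UNIV h"
      for h :: "real \<Rightarrow> 'w::topological_space" and i
      by (rule continuous_on_tendsto_compose[OF that tendsto_vec_nth[OF tendsto_ident_at]]) auto
    have c0: "continuous_on UNIV f" "continuous_on UNIV \<alpha>" "continuous_on UNIV \<beta>"
      "continuous_on UNIV (D1 f)" "continuous_on UNIV (D1 \<alpha>)" "continuous_on UNIV (D1 \<beta>)"
      using continuous_iterated_derivative[OF f, of 0] continuous_iterated_derivative[OF f, of 1]
        continuous_iterated_derivative[OF ab(1), of 0] continuous_iterated_derivative[OF ab(1), of 1]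
        continuous_iterated_derivative[OF ab(2), of 0] continuous_iterated_derivative[OF ab(2), of 1] k by auto
    have mlim: "((\<lambda>q'. m \<gamma> z q' p (G q')) \<longlongrightarrow> m \<gamma> z q p p) (at q within S)" if "\<gamma> = \<alpha> \<or> \<gamma> = \<beta>" for \<gamma> z
    proof -
      have "continuous_on UNIV \<gamma>" "continuous_on UNIV (D1 \<gamma>)" using that c0 by auto
      then show ?thesis unfolding m_def secant_def
        by (intro tendsto_intros ev[OF c0(1)] ev[OF c0(2)] ev[OF c0(3)] ev[OF c0(4)] ev[OF c0(5)] ev[OF c0(6)]
            ev[OF \<open>continuous_on UNIV \<gamma>\<close>] ev[OF \<open>continuous_on UNIV (D1 \<gamma>)\<close>] Glim[of 1] Glim[of 2]) simp_all
    qed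
    define det where "det = (\<lambda>q'. m \<alpha> 1 q' p (G q') * m \<beta> 2 q' p (G q') - m \<beta> 1 q' p (G q') * m \<alpha> 2 q' p (G q'))"
    define det0 where "det0 = m \<alpha> 1 q p p * m \<beta> 2 q p p - m \<beta> 1 q p p * m \<alpha> 2 q p p"
    have detpos: "det q' > 0" if "q' \<in> S" for q'
      unfolding det_def using bound(3)[OF GP(2)[OF that] pP GP(1)[OF that]] .
    have det0pos: "det0 > 0" unfolding det0_def using bound(3)[OF qQ pP pP] .
    have detlim: "(det \<longlongrightarrow> det0) (at q within S)"
      unfolding det_def det0_def by (rule tendsto_diff[OF tendsto_mult[OF mlim mlim] tendsto_mult[OF mlim mlim]]) simp_all
    have quot: "((\<lambda>q'. m \<gamma> z q' p (G q') / det q') \<longlongrightarrow> m \<gamma> z q p p / det0) (at q within S)" if "\<gamma> = \<alpha> \<or> \<gamma> = \<beta>" for \<gamma> z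
      by (rule tendsto_divide[OF mlim[OF that] detlim]) (use det0pos in simp)
    have Gsol: "G q' $ 1 = p $ 1 + (m \<beta> 1 q' p (G q') / det q' * \<psi>2 q' - m \<beta> 2 q' p (G q') / det q' * \<psi>1 q')"
      "G q' $ 2 = p $ 2 + (m \<alpha> 2 q' p (G q') / det q' * \<psi>1 q' - m \<alpha> 1 q' p (G q') / det q' * \<psi>2 q')" if "q' \<in> S" for q'
    proof -
      note c = cramer[OF eqs[OF that] det_def[THEN fun_cong] detpos[OF that]]
      show "G q' $ 1 = p $ 1 + (m \<beta> 1 q' p (G q') / det q' * \<psi>2 q' - m \<beta> 2 q' p (G q') / det q' * \<psi>1 q')"
        using c(1) by linarith
      show "G q' $ 2 = p $ 2 + (m \<alpha> 2 q' p (G q') / det q' * \<psi>1 q' - m \<alpha> 1 q' p (G q') / det q' * \<psi>2 q')"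
        using c(2) by linarith
    qed
    have t1: "((\<lambda>q'. m \<gamma> z q' p (G q') / det q' * \<psi>1 q') has_derivative (\<lambda>v. m \<gamma> z q p p / det0 * L1 v)) (at q within S)"
      if "\<gamma> = \<alpha> \<or> \<gamma> = \<beta>" for \<gamma> z
      by (rule has_derivative_mult_vanishing[OF d1 z(1) quot[OF that]])
    have t2: "((\<lambda>q'. m \<gamma> z q' p (G q') / det q' * \<psi>2 q') has_derivative (\<lambda>v. m \<gamma> z q p p / det0 * L2 v)) (at q within S)"
      if "\<gamma> = \<alpha> \<or> \<gamma> = \<beta>" for \<gamma> z
      by (rule has_derivative_mult_vanishing[OF d2 z(2) quot[OF that]])
    define K1 where "K1 = (\<lambda>v. m \<beta> 1 q p p / det0 * L2 v - m \<beta> 2 q p p / det0 * L1 v)"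
    define K2 where "K2 = (\<lambda>v. m \<alpha> 2 q p p / det0 * L1 v - m \<alpha> 1 q p p / det0 * L2 v)"
    have D1': "((\<lambda>q'. G q' $ 1) has_derivative K1) (at q within S)"
    proof (rule has_derivative_transform[OF q])
      show "((\<lambda>q'. p $ 1 + (m \<beta> 1 q' p (G q') / det q' * \<psi>2 q' - m \<beta> 2 q' p (G q') / det q' * \<psi>1 q')) has_derivative K1) (at q within S)"
        unfolding K1_def using has_derivative_add[OF has_derivative_const[of "p $ 1"] has_derivative_diff[OF t2[of \<beta> 1, OF disjI2[OF refl]] t1[of \<beta> 2, OF disjI2[OF refl]]]]
        by (simp only: add_0)
    qed (use Gsol in auto)
    have D2': "((\<lambda>q'. G q' $ 2) has_derivative K2) (at q within S)"
    proof (rule has_derivative_transform[OF q])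
      show "((\<lambda>q'. p $ 2 + (m \<alpha> 2 q' p (G q') / det q' * \<psi>1 q' - m \<alpha> 1 q' p (G q') / det q' * \<psi>2 q')) has_derivative K2) (at q within S)"
        unfolding K2_def using has_derivative_add[OF has_derivative_const[of "p $ 2"] has_derivative_diff[OF t1[of \<alpha> 2, OF disjI1[OF refl]] t2[of \<alpha> 1, OF disjI1[OF refl]]]]
        by (simp only: add_0)
    qed (use Gsol in auto)
    define K :: "real^2 \<Rightarrow> real^2" where "K = (\<lambda>v. vector [K1 v, K2 v])"
    have dK: "(G has_derivative K) (at q within S)"
    proof (subst has_derivative_componentwise_within, intro ballI)
      fix i :: "real^2" assume "i \<in> Basis"
      then consider "i = axis 1 1" | "i = axis 2 1" by (auto simp: Basis_vec_def UNIV_2)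
      then show "((\<lambda>x. G x \<bullet> i) has_derivative (\<lambda>x. K x \<bullet> i)) (at q within S)"
        by cases (use D1' D2' in \<open>simp_all add: inner_axis K_def\<close>)
    qed
    \<comment> \<open>A kernel vector of the degenerate Hessian: orthogonal to its first row if that
      is nonzero, else \<open>(1, 0)\<close>. The derivative of \<open>G\<close> factors through the
      Hessian and kills it too.\<close>
    have "\<exists>v. v \<noteq> 0 \<and> L1 v = 0 \<and> L2 v = 0"
    proof (cases "?a = 0 \<and> ?b = 0")
      case True
      moreover have "(vector [1, 0] :: real^2) \<noteq> 0" by (auto simp: vec_eq_iff forall_2)
      ultimately show ?thesis by (intro exI[of _ "vector [1, 0]"]) (simp add: L1_def L2_def)
    next
      case False
      then have "(vector [?b, - ?a] :: real^2) \<noteq> 0" by (auto simp: vec_eq_iff forall_2)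
      moreover have "?a * ?c = ?b * ?b" using zero(3)[OF bq] by (simp add: hess_det_def power2_eq_square)
      ultimately show ?thesis by (intro exI[of _ "vector [?b, - ?a]"]) (simp add: L1_def L2_def mult.commute)
    qed
    then obtain v where v: "v \<noteq> 0" "L1 v = 0" "L2 v = 0" by blast
    have linK: "linear K" by (rule has_derivative_linear[OF dK])
    have "K v = 0" using v by (simp add: K_def K1_def K2_def vec_eq_iff forall_2)
    then have "\<not> inj K" using v(1) linear_injective_0[OF linK] by auto
    then have "rank (matrix K) < CARD(2)"
      using less_rank_noninjective[of "matrix K"] matrix_vector_mul(2)[OF linK] by simp
    with dK show ?thesis by blast
  qed
  then obtain G' where G': "\<And>q. q \<in> S \<Longrightarrow> (G has_derivative G' q) (at q within S)"
    "\<And>q. q \<in> S \<Longrightarrow> rank (matrix (G' q)) < CARD(2)" by metis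
  \<comment> \<open>Sard's theorem in equal dimensions, for a map differentiable within an arbitrary
    set. The parameter square \<open>P\<close> is open and nonempty, so it contains a point outside
    this null set.\<close>
  have neg: "negligible (G ` S)"
    by (rule baby_Sard[OF _ G'(1) G'(2)]) simp_all
  have "open P"
  proof -
    have "P = {p. \<bar>p $ 1\<bar> < r} \<inter> {p. \<bar>p $ 2\<bar> < r}" by (auto simp: P_def)
    then show ?thesis by (auto intro!: open_Int open_Collect_less continuous_intros)
  qed
  moreover have "0 \<in> P" using r by (simp add: P_def)
  ultimately have "\<not> negligible P" using open_not_negligible by blast
  then obtain p where p: "p \<in> P" "p \<notin> G ` S" using negligible_subset[OF neg] by blast
  have "nondegenerate_chord (F p) x y" if "\<bar>x - x0\<bar> < \<rho>" "\<bar>y - y0\<bar> < \<rho>" for x y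
  proof (rule ccontr)
    assume neg: "\<not> nondegenerate_chord (F p) x y"
    let ?q = "vector [x, y] :: real^2"
    have "bad ?q p" using p(1) neg by (simp add: bad_def)
    moreover have qQ: "?q \<in> Q" using that by (simp add: Q_def)
    ultimately have "?q \<in> S" by (auto simp: S_def)
    then have "G ?q = p" using uniq[OF G \<open>bad ?q p\<close> qQ] by blast
    then show False using p(2) \<open>?q \<in> S\<close> by blast
  qed
  then show ?thesis using p(1) by (auto simp: P_def F_def)
qed

section \<open>Trigonometric bump functions\<close>

lemma Ck_open_sin: "Ck_open k UNIV (\<lambda>t::real. c * sin (w * t + \<phi>))"
proof (induction k arbitrary: c \<phi>)
  case 0
  show ?case by (simp, intro continuous_intros)
next
  case (Suc k)
  \<comment> \<open>Differentiation shifts the phase by \<open>pi / 2\<close> and rescales; the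
    induction therefore ranges over all \<open>c\<close> and \<open>\<phi>\<close>.\<close>
  have "((\<lambda>t::real. c * sin (w * t + \<phi>)) has_real_derivative (c * w) * sin (w * t + (\<phi> + pi / 2))) (at t)" for t
  proof -
    have "sin (w * t + (\<phi> + pi / 2)) = cos (w * t + \<phi>)" by (simp add: sin_add add.assoc[symmetric])
    then show ?thesis by (auto intro!: derivative_eq_intros)
  qed
  then have d: "((\<lambda>t::real. c * sin (w * t + \<phi>)) has_vector_derivative (c * w) * sin (w * t + (\<phi> + pi / 2))) (at t)" for t
    by (simp add: has_real_derivative_iff_has_vector_derivative)
  show ?case unfolding Ck_open_real_Suc
  proof
    show "\<forall>t. (\<lambda>t::real. c * sin (w * t + \<phi>)) differentiable (at t)"
      using d by (blast intro: differentiableI_vector)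
    have "(\<lambda>t. vector_derivative (\<lambda>t::real. c * sin (w * t + \<phi>)) (at t)) = (\<lambda>t. (c * w) * sin (w * t + (\<phi> + pi / 2)))"
      using d by (intro ext vector_derivative_at)
    then show "Ck_open k UNIV (\<lambda>t. vector_derivative (\<lambda>t::real. c * sin (w * t + \<phi>)) (at t))"
      using Suc.IH by simp
  qed
qed

text \<open>A function of period 1 with a zero of slope 1 at \<open>a\<close> and a double zero at
  \<open>b\<close>: the sine gives the former, 1 - cos the latter, and the constant normalises the
  slope. Only these 1-jets matter, so no compact support is sought.\<close>

definition bump :: "real \<Rightarrow> real \<Rightarrow> real \<Rightarrow> real" where
  "bump a b t = (1 / (2 * pi * (1 - cos (2 * pi * (a - b))))) *
     (sin (2 * pi * (t - a)) * (1 - cos (2 * pi * (t - b))))"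

lemma Ck_open_bump: "Ck_open k UNIV (bump a b)"
proof -
  define c where "c = 1 / (2 * pi * (1 - cos (2 * pi * (a - b))))"
  have eq: "bump a b = (\<lambda>t. (c * sin (2 * pi * t + - (2 * pi * a))) * (1 + (- 1) * sin (2 * pi * t + (pi / 2 - 2 * pi * b))))"
  proof
    fix t
    have 1: "sin (2 * pi * t + - (2 * pi * a)) = sin (2 * pi * (t - a))" by (simp add: algebra_simps)
    have 2: "sin (2 * pi * t + (pi / 2 - 2 * pi * b)) = cos (2 * pi * (t - b))"
      using sin_add[of "2 * pi * (t - b)" "pi / 2"] by (simp add: algebra_simps)
    show "bump a b t = (c * sin (2 * pi * t + - (2 * pi * a))) * (1 + (- 1) * sin (2 * pi * t + (pi / 2 - 2 * pi * b)))"
      unfolding bump_def c_def[symmetric] 1 2 by simp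
  qed
  show ?thesis unfolding eq
    by (rule Ck_open_bilinear[OF bounded_bilinear_mult Ck_open_sin Ck_open_add[OF Ck_open_const Ck_open_sin]])
qed

lemma bump_periodic: "bump a b (t + 1) = bump a b t"
proof -
  have "2 * pi * (t + 1 - c) = 2 * pi * (t - c) + 2 * pi" for c by (simp add: algebra_simps)
  then show ?thesis by (simp add: bump_def)
qed

lemma bump_values:
  assumes "a - b \<notin> \<int>"
  shows "bump a b a = 0" "bump a b b = 0" "D1 (bump a b) a = 1" "D1 (bump a b) b = 0"
proof -
  let ?c = "1 / (2 * pi * (1 - cos (2 * pi * (a - b))))"
  have ne: "cos (2 * pi * (a - b)) \<noteq> 1"
  proof
    assume "cos (2 * pi * (a - b)) = 1"
    then obtain n :: int where "2 * pi * (a - b) = of_int n * 2 * pi" using cos_one_2pi_int by auto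
    then have "a - b = of_int n" by simp
    then show False using assms by simp
  qed
  have "(bump a b has_real_derivative ?c * (2 * pi * cos (2 * pi * (t - a)) * (1 - cos (2 * pi * (t - b))) +
      sin (2 * pi * (t - a)) * (2 * pi * sin (2 * pi * (t - b))))) (at t)" for t
    unfolding bump_def[abs_def] by (rule DERIV_cmult) (auto intro!: derivative_eq_intros)
  then have d: "D1 (bump a b) t = ?c * (2 * pi * cos (2 * pi * (t - a)) * (1 - cos (2 * pi * (t - b))) +
      sin (2 * pi * (t - a)) * (2 * pi * sin (2 * pi * (t - b))))" for t
    by (simp add: iterated_derivative_Suc has_real_derivative_iff_has_vector_derivative vector_derivative_at)
  show "bump a b a = 0" "bump a b b = 0" by (simp_all add: bump_def)
  show "D1 (bump a b) a = 1" "D1 (bump a b) b = 0" unfolding d using ne by simp_all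
qed

text \<open>In the limit the parameters vanish and \<open>\<gamma>\<close> is zero at both ends, so
  that every term but the one with the slope of \<open>\<gamma>\<close> disappears.\<close>

lemma secant_tendsto:
  fixes f :: "nat \<Rightarrow> real \<Rightarrow> 'v::real_inner"
  assumes g: "Ck_open k UNIV g" and ab: "Ck_open k UNIV \<alpha>" "Ck_open k UNIV \<beta>" "Ck_open k UNIV \<gamma>" and k: "k \<ge> 2"
    and cl: "\<And>n. Ck_close 1 (1 / real (Suc n)) (f n) g"
    and lim: "x \<longlonglongrightarrow> x0" "y \<longlonglongrightarrow> y0" "z \<longlonglongrightarrow> z0" "a \<longlonglongrightarrow> 0" "b \<longlonglongrightarrow> 0"
    and \<gamma>: "\<gamma> x0 = 0" "\<gamma> y0 = 0" and D: "D = g x0 - g y0"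
  shows "(\<lambda>n. secant \<alpha> \<beta> D (f n) \<gamma> (x n) (y n) (z n) (a n) (b n)) \<longlonglongrightarrow> D1 \<gamma> z0 * inner D D"
proof -
  have cont: "(\<lambda>n. iterated_derivative j h (t n)) \<longlonglongrightarrow> iterated_derivative j h t0"
    if "Ck_open k UNIV h" "j \<le> 1" "t \<longlonglongrightarrow> t0" for h :: "real \<Rightarrow> real" and j t t0
  proof -
    have "continuous_on UNIV (iterated_derivative j h)"
      by (rule continuous_iterated_derivative[OF that(1)]) (use that(2) k in simp)
    then show ?thesis by (rule continuous_on_tendsto_compose[OF _ that(3)]) auto
  qed
  have fl: "(\<lambda>n. iterated_derivative j (f n) (t n)) \<longlonglongrightarrow> iterated_derivative j g t0"
    if "j \<le> 1" "t \<longlonglongrightarrow> t0" for j t t0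
    using close_evaluations_tendsto[OF g _ Ck_close_mono[OF cl that(1) order_refl] that(2) strict_mono_id] that(1) k by simp
  note c = cont[of _ 0, simplified] cont[of _ 1, OF _ order_refl]
  note fl' = fl[of 0, simplified] fl[of 1, OF order_refl]
  have "(\<lambda>n. secant \<alpha> \<beta> D (f n) \<gamma> (x n) (y n) (z n) (a n) (b n)) \<longlonglongrightarrow>
    D1 \<gamma> z0 * (inner (g x0 - g y0) D + inner D D * (0 * (\<alpha> x0 - \<alpha> y0) + 0 * (\<beta> x0 - \<beta> y0))) +
     (\<gamma> x0 - \<gamma> y0) * (inner D (D1 g z0) + inner D D * (0 * D1 \<alpha> z0 + 0 * D1 \<beta> z0))"
    unfolding secant_def
    by (intro tendsto_add tendsto_mult tendsto_diff tendsto_inner tendsto_const lim fl'(1)[OF lim(1)] fl'(1)[OF lim(2)]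
        fl'(2)[OF lim(3)] c(1)[OF ab(1) lim(1)] c(1)[OF ab(1) lim(2)] c(1)[OF ab(2) lim(1)] c(1)[OF ab(2) lim(2)]
        c(1)[OF ab(3) lim(1)] c(1)[OF ab(3) lim(2)] c(2)[OF ab(1) lim(3)] c(2)[OF ab(2) lim(3)] c(2)[OF ab(3) lim(3)])
  then show ?thesis by (simp add: \<gamma> D)
qed

text \<open>The slopes of the two bumps at the ends form the identity matrix, so the secant matrix
  is close to |D|^2 times the identity. Arguing by sequences makes this uniform in the curve
  \<open>f\<close> too.\<close>

lemma secant_estimate:
  fixes g :: "real \<Rightarrow> 'v::real_inner"
  assumes g: "Ck_open k UNIV g" "k \<ge> 2" and xy: "x0 - y0 \<notin> \<int>" and D: "D = g x0 - g y0" "D \<noteq> 0"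
  defines "\<alpha> \<equiv> bump x0 y0" and "\<beta> \<equiv> bump y0 x0" and "s \<equiv> inner D D"
  shows "\<exists>\<rho>>0. \<forall>f. Ck_close 1 \<rho> f g \<longrightarrow> (\<forall>x y a b. \<bar>x - x0\<bar> < \<rho> \<longrightarrow> \<bar>y - y0\<bar> < \<rho> \<longrightarrow> \<bar>a\<bar> < \<rho> \<longrightarrow> \<bar>b\<bar> < \<rho> \<longrightarrow>
      \<bar>secant \<alpha> \<beta> D f \<alpha> x y x a b - s\<bar> < s / 4 \<and> \<bar>secant \<alpha> \<beta> D f \<beta> x y y a b - s\<bar> < s / 4 \<and>
      \<bar>secant \<alpha> \<beta> D f \<beta> x y x a b\<bar> < s / 4 \<and> \<bar>secant \<alpha> \<beta> D f \<alpha> x y y a b\<bar> < s / 4)"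
proof (rule ccontr)
  let ?E = "\<lambda>f x y a b. \<bar>secant \<alpha> \<beta> D f \<alpha> x y x a b - s\<bar> < s / 4 \<and> \<bar>secant \<alpha> \<beta> D f \<beta> x y y a b - s\<bar> < s / 4 \<and>
      \<bar>secant \<alpha> \<beta> D f \<beta> x y x a b\<bar> < s / 4 \<and> \<bar>secant \<alpha> \<beta> D f \<alpha> x y y a b\<bar> < s / 4"
  assume neg: "\<not> ?thesis"
  have "\<exists>f x y a b. Ck_close 1 (1 / real (Suc n)) f g \<and> \<bar>x - x0\<bar> < 1 / real (Suc n) \<and> \<bar>y - y0\<bar> < 1 / real (Suc n) \<and>
      \<bar>a\<bar> < 1 / real (Suc n) \<and> \<bar>b\<bar> < 1 / real (Suc n) \<and> \<not> ?E f x y a b" for n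
  proof -
    have "1 / real (Suc n) > 0" by simp
    then show ?thesis using neg by meson
  qed
  then obtain f x y a b where seq: "\<And>n. Ck_close 1 (1 / real (Suc n)) (f n) g"
    "\<And>n. \<bar>x n - x0\<bar> < 1 / real (Suc n)" "\<And>n. \<bar>y n - y0\<bar> < 1 / real (Suc n)"
    "\<And>n. \<bar>a n\<bar> < 1 / real (Suc n)" "\<And>n. \<bar>b n\<bar> < 1 / real (Suc n)" "\<And>n. \<not> ?E (f n) (x n) (y n) (a n) (b n)"
    by metis
  have lim: "u \<longlonglongrightarrow> u0" if "\<And>n. \<bar>u n - u0\<bar> < 1 / real (Suc n)" for u and u0 :: real
  proof -
    have "(\<lambda>n. u n - u0) \<longlonglongrightarrow> 0"
      by (rule Lim_null_comparison[OF _ LIMSEQ_inverse_real_of_nat])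
        (use that in \<open>auto intro!: always_eventually less_imp_le simp: inverse_eq_divide\<close>)
    then show ?thesis by (simp add: LIM_zero_iff)
  qed
  have xl: "x \<longlonglongrightarrow> x0" by (rule lim[OF seq(2)])
  have yl: "y \<longlonglongrightarrow> y0" by (rule lim[OF seq(3)])
  have al: "a \<longlonglongrightarrow> 0" by (rule lim) (use seq(4) in simp)
  have bl: "b \<longlonglongrightarrow> 0" by (rule lim) (use seq(5) in simp)
  have Ck: "Ck_open k UNIV \<alpha>" "Ck_open k UNIV \<beta>" by (simp_all add: \<alpha>_def \<beta>_def Ck_open_bump)
  have yx: "y0 - x0 \<notin> \<int>" using xy Ints_minus[of "y0 - x0"] by auto
  note va = bump_values[OF xy, folded \<alpha>_def] and vb = bump_values[OF yx, folded \<beta>_def]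
  have s: "s > 0" using D(2) by (simp add: s_def)
  have T: "(\<lambda>n. secant \<alpha> \<beta> D (f n) \<gamma> (x n) (y n) (z n) (a n) (b n)) \<longlonglongrightarrow> D1 \<gamma> z0 * s"
    if "\<gamma> = \<alpha> \<or> \<gamma> = \<beta>" "z \<longlonglongrightarrow> z0" for \<gamma> z z0
    unfolding s_def
    by (rule secant_tendsto[OF g(1) Ck _ g(2) seq(1) xl yl that(2) al bl _ _ D(1)])
      (use that(1) va(1,2) vb(1,2) Ck in auto)
  have t1: "(\<lambda>n. secant \<alpha> \<beta> D (f n) \<alpha> (x n) (y n) (x n) (a n) (b n)) \<longlonglongrightarrow> s" using T[OF disjI1[OF refl] xl] va(3) by simp
  have e1: "\<forall>\<^sub>F n in sequentially. \<bar>secant \<alpha> \<beta> D (f n) \<alpha> (x n) (y n) (x n) (a n) (b n) - s\<bar> < s / 4"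
    using tendstoD[OF t1, of "s / 4"] s by (simp add: dist_real_def)
  have t2: "(\<lambda>n. secant \<alpha> \<beta> D (f n) \<beta> (x n) (y n) (y n) (a n) (b n)) \<longlonglongrightarrow> s" using T[OF disjI2[OF refl] yl] vb(3) by simp
  have e2: "\<forall>\<^sub>F n in sequentially. \<bar>secant \<alpha> \<beta> D (f n) \<beta> (x n) (y n) (y n) (a n) (b n) - s\<bar> < s / 4"
    using tendstoD[OF t2, of "s / 4"] s by (simp add: dist_real_def)
  have t3: "(\<lambda>n. secant \<alpha> \<beta> D (f n) \<beta> (x n) (y n) (x n) (a n) (b n)) \<longlonglongrightarrow> 0" using T[OF disjI2[OF refl] xl] vb(4) by simp
  have e3: "\<forall>\<^sub>F n in sequentially. \<bar>secant \<alpha> \<beta> D (f n) \<beta> (x n) (y n) (x n) (a n) (b n)\<bar> < s / 4"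
    using tendstoD[OF t3, of "s / 4"] s by (simp add: dist_real_def)
  have t4: "(\<lambda>n. secant \<alpha> \<beta> D (f n) \<alpha> (x n) (y n) (y n) (a n) (b n)) \<longlonglongrightarrow> 0" using T[OF disjI1[OF refl] yl] va(4) by simp
  have e4: "\<forall>\<^sub>F n in sequentially. \<bar>secant \<alpha> \<beta> D (f n) \<alpha> (x n) (y n) (y n) (a n) (b n)\<bar> < s / 4"
    using tendstoD[OF t4, of "s / 4"] s by (simp add: dist_real_def)
  have "\<forall>\<^sub>F n in sequentially. ?E (f n) (x n) (y n) (a n) (b n)"
    using e1 e2 e3 e4 by (intro eventually_conj)
  then obtain n where "?E (f n) (x n) (y n) (a n) (b n)" by (rule eventually_happens'[OF sequentially_bot, THEN exE])
  then show False using seq(6)[of n] by contradiction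
qed

text \<open>The radius \<open>\<rho>\<close> depends on \<open>g\<close> and the chord only, not on
  the curve \<open>f\<close> to be perturbed or on \<open>\<epsilon>\<close>. A finite cover can
  therefore be fixed before any perturbation is made.\<close>

lemma local_perturbation:
  fixes g :: "real \<Rightarrow> 'v::real_inner"
  assumes g: "Ck_open k UNIV g" "k \<ge> 2" and xy: "x0 - y0 \<notin> \<int>" and ne: "g x0 \<noteq> g y0"
  shows "\<exists>\<rho>>0. \<forall>f. Ck_open k UNIV f \<longrightarrow> (\<forall>t. f (t + 1) = f t) \<longrightarrow> Ck_close 1 \<rho> f g \<longrightarrow>
    (\<forall>\<epsilon>>0. \<exists>h. Ck_open k UNIV h \<and> (\<forall>t. h (t + 1) = h t) \<and> Ck_close k \<epsilon> h f \<and>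
      (\<forall>x y. \<bar>x - x0\<bar> < \<rho> \<longrightarrow> \<bar>y - y0\<bar> < \<rho> \<longrightarrow> nondegenerate_chord h x y))"
proof -
  define D where "D = g x0 - g y0"
  have D0: "D \<noteq> 0" using ne by (simp add: D_def)
  define \<alpha> where "\<alpha> = bump x0 y0"
  define \<beta> where "\<beta> = bump y0 x0"
  have Ck: "Ck_open k UNIV \<alpha>" "Ck_open k UNIV \<beta>" by (simp_all add: \<alpha>_def \<beta>_def Ck_open_bump)
  have per: "\<alpha> (t + 1) = \<alpha> t" "\<beta> (t + 1) = \<beta> t" for t by (simp_all add: \<alpha>_def \<beta>_def bump_periodic)
  obtain A where A: "A > 0" "\<And>j t. j \<le> k \<Longrightarrow> \<bar>iterated_derivative j \<alpha> t\<bar> \<le> A"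
    using iterated_derivative_bounded[OF Ck(1) per(1)] by auto
  obtain B where B: "B > 0" "\<And>j t. j \<le> k \<Longrightarrow> \<bar>iterated_derivative j \<beta> t\<bar> \<le> B"
    using iterated_derivative_bounded[OF Ck(2) per(2)] by auto
  obtain \<rho> where \<rho>: "\<rho> > 0" "\<And>f x y a b. Ck_close 1 \<rho> f g \<Longrightarrow> \<bar>x - x0\<bar> < \<rho> \<Longrightarrow> \<bar>y - y0\<bar> < \<rho> \<Longrightarrow> \<bar>a\<bar> < \<rho> \<Longrightarrow> \<bar>b\<bar> < \<rho> \<Longrightarrow>
      \<bar>secant \<alpha> \<beta> D f \<alpha> x y x a b - inner D D\<bar> < inner D D / 4 \<and> \<bar>secant \<alpha> \<beta> D f \<beta> x y y a b - inner D D\<bar> < inner D D / 4 \<and>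
      \<bar>secant \<alpha> \<beta> D f \<beta> x y x a b\<bar> < inner D D / 4 \<and> \<bar>secant \<alpha> \<beta> D f \<alpha> x y y a b\<bar> < inner D D / 4"
    using secant_estimate[OF g xy D_def D0, folded \<alpha>_def \<beta>_def] by (elim exE conjE) (rule that, assumption, simp)
  have "\<exists>h. Ck_open k UNIV h \<and> (\<forall>t. h (t + 1) = h t) \<and> Ck_close k \<epsilon> h f \<and>
      (\<forall>x y. \<bar>x - x0\<bar> < \<rho> \<longrightarrow> \<bar>y - y0\<bar> < \<rho> \<longrightarrow> nondegenerate_chord h x y)"
    if f: "Ck_open k UNIV f" "\<forall>t. f (t + 1) = f t" "Ck_close 1 \<rho> f g" and \<epsilon>: "\<epsilon> > 0" for f \<epsilon>
  proof -
    \<comment> \<open>Bounds the change of every derivative up to order \<open>k\<close> per unit of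
      the parameters, whence the choice of \<open>r\<close>.\<close>
    define C where "C = (A + B) * norm D"
    have C: "C > 0" using A(1) B(1) D0 by (simp add: C_def)
    define r where "r = min \<rho> (\<epsilon> / C)"
    have r: "0 < r" "r \<le> \<rho>" "r * C \<le> \<epsilon>" using \<rho>(1) \<epsilon> C by (auto simp: r_def min_def field_simps)
    have s: "inner D D > 0" using D0 by simp
    have "\<exists>a b. \<bar>a\<bar> < r \<and> \<bar>b\<bar> < r \<and>
      (\<forall>x y. \<bar>x - x0\<bar> < \<rho> \<longrightarrow> \<bar>y - y0\<bar> < \<rho> \<longrightarrow> nondegenerate_chord (perturb \<alpha> \<beta> D f a b) x y)"
      by (rule perturb_nondegenerate[OF f(1) Ck g(2) s r(1,2)]) (rule \<rho>(2)[OF f(3)]; assumption)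
    then obtain a b where ab: "\<bar>a\<bar> < r" "\<bar>b\<bar> < r"
      "\<And>x y. \<bar>x - x0\<bar> < \<rho> \<Longrightarrow> \<bar>y - y0\<bar> < \<rho> \<Longrightarrow> nondegenerate_chord (perturb \<alpha> \<beta> D f a b) x y"
      by blast
    have "norm (iterated_derivative j (perturb \<alpha> \<beta> D f a b) t - iterated_derivative j f t) < \<epsilon>" if j: "j \<le> k" for j t
    proof -
      have "\<bar>a\<bar> * \<bar>iterated_derivative j \<alpha> t\<bar> \<le> \<bar>a\<bar> * A" "\<bar>b\<bar> * \<bar>iterated_derivative j \<beta> t\<bar> \<le> \<bar>b\<bar> * B"
        using A(2)[OF j] B(2)[OF j] by (simp_all add: mult_left_mono)
      moreover have "\<bar>a\<bar> * A < r * A" "\<bar>b\<bar> * B < r * B" using ab(1,2) A(1) B(1) by simp_all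
      ultimately have "\<bar>a * iterated_derivative j \<alpha> t + b * iterated_derivative j \<beta> t\<bar> < r * (A + B)"
        using abs_triangle_ineq[of "a * iterated_derivative j \<alpha> t" "b * iterated_derivative j \<beta> t"]
        by (simp add: abs_mult distrib_left)
      then have "\<bar>a * iterated_derivative j \<alpha> t + b * iterated_derivative j \<beta> t\<bar> * norm D < r * (A + B) * norm D"
        using D0 by simp
      also have "\<dots> \<le> \<epsilon>" using r(3) by (simp add: C_def mult.assoc)
      finally show ?thesis unfolding iterated_derivative_perturb[OF f(1) Ck j] by simp
    qed
    then have "Ck_close k \<epsilon> (perturb \<alpha> \<beta> D f a b) f" by (simp add: Ck_close_def)
    moreover have "perturb \<alpha> \<beta> D f a b (t + 1) = perturb \<alpha> \<beta> D f a b t" for t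
      using f(2) per by (simp add: perturb_def)
    ultimately show ?thesis using Ck_open_perturb[OF f(1) Ck] ab(3) by blast
  qed
  then show ?thesis using \<rho>(1) by blast
qed

lemma (in embedded_closed_curve) nondegenerate_approximation:
  assumes e: "e > 0"
  shows "\<exists>f. Ck_open k UNIV f \<and> (\<forall>t. f (t + 1) = f t) \<and> Ck_close k e f g \<and>
    (\<forall>x y. 0 < y - x \<longrightarrow> y - x < 1 \<longrightarrow> nondegenerate_chord f x y)"
proof -
  obtain d e1 where d: "0 < d" "d < 1/2" and e1: "e1 > 0"
    and short: "\<And>l f x h. Ck_open l UNIV f \<Longrightarrow> l \<ge> 2 \<Longrightarrow> Ck_close 2 e1 f g \<Longrightarrow> 0 < h \<Longrightarrow> h \<le> d \<Longrightarrow>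
      inner (f (x + h) - f x) (D1 f x) > 0 \<and> inner (f (x + h) - f x) (D1 f (x + h)) > 0"
    by (rule short_chords) (rule that; assumption)
  have "\<exists>\<rho>>0. \<forall>f. Ck_open k UNIV f \<longrightarrow> (\<forall>t. f (t + 1) = f t) \<longrightarrow> Ck_close 1 \<rho> f g \<longrightarrow>
    (\<forall>\<epsilon>>0. \<exists>h. Ck_open k UNIV h \<and> (\<forall>t. h (t + 1) = h t) \<and> Ck_close k \<epsilon> h f \<and>
      (\<forall>x y. \<bar>x - fst q\<bar> < \<rho> \<longrightarrow> \<bar>y - snd q\<bar> < \<rho> \<longrightarrow> nondegenerate_chord h x y))" if q: "q \<in> long_chords d" for q
  proof (rule local_perturbation[OF Ck k2])
    show ni: "fst q - snd q \<notin> \<int>"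
    proof
      assume "fst q - snd q \<in> \<int>"
      then have "fst q - snd q = 0" using q d by (intro Ints_abs_less_1) (auto simp: long_chords_def)
      then show False using q d by (auto simp: long_chords_def)
    qed
    show "g (fst q) \<noteq> g (snd q)" using ni injective by blast
  qed
  then obtain \<rho> where \<rho>: "\<And>q. q \<in> long_chords d \<Longrightarrow> \<rho> q > 0"
    and move: "\<And>q f \<epsilon>. q \<in> long_chords d \<Longrightarrow> Ck_open k UNIV f \<Longrightarrow> (\<And>t. f (t + 1) = f t) \<Longrightarrow> Ck_close 1 (\<rho> q) f g \<Longrightarrow> \<epsilon> > 0 \<Longrightarrow>
      \<exists>h. Ck_open k UNIV h \<and> (\<forall>t. h (t + 1) = h t) \<and> Ck_close k \<epsilon> h f \<and>
      (\<forall>x y. \<bar>x - fst q\<bar> < \<rho> q \<longrightarrow> \<bar>y - snd q\<bar> < \<rho> q \<longrightarrow> nondegenerate_chord h x y)"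
    by metis
  \<comment> \<open>Half the radius leaves room for the closed boxes \<open>K\<close>: they are
    compact, as stability requires, and still lie where the perturbation is effective.\<close>
  define U where "U = (\<lambda>q. ball (fst q) (\<rho> q / 2) \<times> ball (snd q) (\<rho> q / 2))"
  define K where "K = (\<lambda>q. cball (fst q) (\<rho> q / 2) \<times> cball (snd q) (\<rho> q / 2))"
  have "\<And>q. q \<in> long_chords d \<Longrightarrow> open (U q)" by (simp add: U_def open_Times)
  moreover have "long_chords d \<subseteq> (\<Union>q\<in>long_chords d. U q)"
    using \<rho> by (force simp: U_def)
  ultimately obtain Q where Q: "Q \<subseteq> long_chords d" "finite Q" "long_chords d \<subseteq> (\<Union>q\<in>Q. U q)"
    by (rule compactE_image[OF compact_long_chords])
  \<comment> \<open>The total budget: within \<open>\<eta>\<close> of \<open>g\<close>, a curve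
    meets the required accuracy, has no short critical chords, and may be perturbed near every
    chosen chord.\<close>
  define \<eta> where "\<eta> = Min (insert e (insert e1 (\<rho> ` Q)))"
  have \<eta>: "\<eta> \<le> e" "\<eta> \<le> e1" "\<And>q. q \<in> Q \<Longrightarrow> \<eta> \<le> \<rho> q"
    using Q(2) unfolding \<eta>_def by (intro Min_le; simp)+
  have \<eta>0: "\<eta> > 0" unfolding \<eta>_def using Q(1,2) \<rho> e e1 by (subst Min_gr_iff) auto
  have "\<exists>f \<delta>. \<delta> < \<eta> \<and> Ck_open k UNIV f \<and> (\<forall>t. f (t + 1) = f t) \<and> Ck_close k \<delta> f g \<and>
    (\<forall>x y. (x, y) \<in> (\<Union>q\<in>Q'. K q) \<longrightarrow> nondegenerate_chord f x y)" if "Q' \<subseteq> Q" for Q'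
    using finite_subset[OF that Q(2)] that
  proof (induction Q' rule: finite_induct)
    case empty
    show ?case using Ck periodic Ck_close_refl[of "\<eta> / 2" k g] \<eta>0 by (intro exI[of _ g] exI[of _ "\<eta> / 2"]) auto
  next
    case (insert q Q')
    then obtain f \<delta> where f: "\<delta> < \<eta>" "Ck_open k UNIV f" "\<And>t. f (t + 1) = f t" "Ck_close k \<delta> f g"
      and nd: "\<And>x y. (x, y) \<in> (\<Union>q\<in>Q'. K q) \<Longrightarrow> nondegenerate_chord f x y" by auto
    have cK: "compact (\<Union>q\<in>Q'. K q)" using insert.hyps(1) by (intro compact_UN) (auto simp: K_def intro: compact_Times)
    obtain e2 where e2: "e2 > 0" "\<And>h x y. Ck_close 2 e2 h f \<Longrightarrow> (x, y) \<in> (\<Union>q\<in>Q'. K q) \<Longrightarrow> nondegenerate_chord h x y"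
      using nondegenerate_chord_stable[OF f(2) k2 cK nd] by blast
    \<comment> \<open>\<open>e2\<close> protects the boxes already treated; half of the unspent
      budget keeps the new distance \<open>\<epsilon> + \<delta>\<close> strictly below
      \<open>\<eta>\<close>, leaving room for later steps.\<close>
    define \<epsilon> where "\<epsilon> = min e2 (\<eta> / 2 - \<delta> / 2)"
    have \<epsilon>: "\<epsilon> > 0" "\<epsilon> \<le> e2" using e2(1) f(1) by (auto simp: \<epsilon>_def)
    have "\<epsilon> \<le> \<eta> / 2 - \<delta> / 2" unfolding \<epsilon>_def by (rule min.cobounded2)
    then have \<epsilon>\<delta>: "\<epsilon> + \<delta> < \<eta>" using f(1) by linarith
    have q: "q \<in> Q" "q \<in> long_chords d" using insert.prems Q(1) by auto
    have "Ck_close 1 (\<rho> q) f g" by (rule Ck_close_mono[OF f(4)]) (use k2 f(1) \<eta>(3)[OF q(1)] in auto)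
    from move[OF q(2) f(2,3) this \<epsilon>(1)] obtain h where h: "Ck_open k UNIV h" "\<forall>t. h (t + 1) = h t" "Ck_close k \<epsilon> h f"
      "\<And>x y. \<bar>x - fst q\<bar> < \<rho> q \<Longrightarrow> \<bar>y - snd q\<bar> < \<rho> q \<Longrightarrow> nondegenerate_chord h x y" by blast
    have "nondegenerate_chord h x y" if xy: "(x, y) \<in> (\<Union>q\<in>insert q Q'. K q)" for x y
    proof (cases "(x, y) \<in> K q")
      case True
      then show ?thesis using \<rho>[OF q(2)] by (intro h(4)) (auto simp: K_def dist_real_def abs_minus_commute)
    next
      case False
      then show ?thesis using xy by (intro e2(2)[OF Ck_close_mono[OF h(3) k2 \<epsilon>(2)]]) auto
    qed
    moreover have "Ck_close k (\<epsilon> + \<delta>) h g" by (rule Ck_close_trans[OF h(3) f(4)])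
    ultimately show ?case using h(1,2) \<epsilon>\<delta> by (intro exI[of _ h] exI[of _ "\<epsilon> + \<delta>"]) blast
  qed
  then obtain f \<delta> where f: "\<delta> < \<eta>" "Ck_open k UNIV f" "\<forall>t. f (t + 1) = f t" "Ck_close k \<delta> f g"
    and nd: "\<And>x y. (x, y) \<in> (\<Union>q\<in>Q. K q) \<Longrightarrow> nondegenerate_chord f x y" by blast
  have cl: "Ck_close 2 e1 f g" by (rule Ck_close_mono[OF f(4) k2]) (use f(1) \<eta>(2) in simp)
  have UK: "U q \<subseteq> K q" for q unfolding U_def K_def by (intro Sigma_mono ball_subset_cball)
  have long: "nondegenerate_chord f x y" if "(x, y) \<in> long_chords d" for x y
    using that Q(3) UK by (intro nd) blast
  have per: "f (t + 1) = f t" for t using f(3) by blast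
  have "nondegenerate_chord f x y" if "0 < y - x" "y - x < 1" for x y
    by (rule nondegenerate_of_long_chords[OF f(2) k2 per short[OF f(2) k2 cl] long that])
  moreover have "Ck_close k e f g" by (rule Ck_close_mono[OF f(4)]) (use f(1) \<eta>(1) in simp_all)
  ultimately show ?thesis using f(2,3) by blast
qed

section \<open>Return to the circle and density\<close>

lemma periodic_curve:
  fixes f :: "real \<Rightarrow> real ^ 'd"
  assumes f: "Ck_open k UNIV f" "\<And>t. f (t + 1) = f t"
  obtains \<gamma> where "\<gamma> \<in> Ck_curves k" "\<gamma> \<circ> circle_exp = f"
proof
  \<comment> \<open>The value \<open>undefined\<close> off the circle makes the function
    extensional; periodicity of \<open>f\<close> makes the chosen angle irrelevant.\<close>
  define \<gamma> where "\<gamma> = (\<lambda>z. if z \<in> S1 then f (SOME t. circle_exp t = z) else undefined)"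
  have "\<gamma> (circle_exp t) = f t" for t
  proof -
    define s where "s = (SOME s. circle_exp s = circle_exp t)"
    have "circle_exp s = circle_exp t" unfolding s_def by (rule someI[of _ t]) simp
    then obtain n where "s - t = of_int n" unfolding circle_exp_eq_iff by (auto elim!: Ints_cases)
    then have "s = t + of_int n" by simp
    then show ?thesis using periodic_int[of f t n, OF f(2)] circle_exp_in[of t] by (simp add: \<gamma>_def flip: s_def)
  qed
  then show eq: "\<gamma> \<circ> circle_exp = f" by auto
  show "\<gamma> \<in> Ck_curves k" using f(1) eq by (simp add: Ck_curves_def \<gamma>_def extensional_def)
qed

lemma dense_Morse_embeddings:
  assumes k: "k \<ge> 2"
  shows "Embedding_space k closure_of (Morse_embeddings k :: (complex \<Rightarrow> real ^ 'd) set) =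
    topspace (Embedding_space k)"
proof
  show "topspace (Embedding_space k) \<subseteq> Embedding_space k closure_of (Morse_embeddings k :: (complex \<Rightarrow> real ^ 'd) set)"
  proof
    fix \<gamma> :: "complex \<Rightarrow> real ^ 'd" assume "\<gamma> \<in> topspace (Embedding_space k)"
    then have \<gamma>: "\<gamma> \<in> Ck_embeddings k" by (simp add: topspace_Embedding_space)
    interpret embedded_closed_curve k "\<gamma> \<circ> circle_exp" by (rule embedded_closed_curve_of_embedding[OF \<gamma> k])
    have "\<exists>\<gamma>'. \<gamma>' \<in> Morse_embeddings k \<and> \<gamma>' \<in> T" if T: "\<gamma> \<in> T" "openin (Embedding_space k) T" for T
    proof -
      obtain N where N: "openin (Whitney_topology k) N" "T = N \<inter> Ck_embeddings k"
        using T(2) unfolding Embedding_space_def openin_subtopology by blast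
      obtain e where e: "e > 0" "\<And>\<gamma>'. \<gamma>' \<in> Ck_curves k \<Longrightarrow> Ck_close k e (\<gamma>' \<circ> circle_exp) (\<gamma> \<circ> circle_exp) \<Longrightarrow> \<gamma>' \<in> N"
        using Whitney_open_contains_ball[OF N(1), of \<gamma>] T(1) N(2) by blast
      obtain e' where e': "e' > 0" "\<And>f. Ck_open k UNIV f \<Longrightarrow> \<forall>t. f (t + 1) = f t \<Longrightarrow> Ck_close 2 e' f (\<gamma> \<circ> circle_exp) \<Longrightarrow>
          embedded_closed_curve k f"
        using embedding_stable by blast
      obtain f where f: "Ck_open k UNIV f" "\<forall>t. f (t + 1) = f t" "Ck_close k (min e e') f (\<gamma> \<circ> circle_exp)"
        "\<forall>x y. 0 < y - x \<longrightarrow> y - x < 1 \<longrightarrow> nondegenerate_chord f x y"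
        using nondegenerate_approximation[of "min e e'"] e(1) e'(1) by auto
      obtain \<gamma>' where \<gamma>': "\<gamma>' \<in> Ck_curves k" "\<gamma>' \<circ> circle_exp = f"
        by (rule periodic_curve[OF f(1) f(2)[rule_format]])
      have emb: "embedded_closed_curve k (\<gamma>' \<circ> circle_exp)"
        unfolding \<gamma>'(2) by (rule e'(2)[OF f(1,2) Ck_close_mono[OF f(3) k]]) simp
      have "\<gamma>' \<in> Ck_embeddings k" by (rule embedding_of_embedded_closed_curve[OF \<gamma>'(1) emb])
      moreover have "\<gamma>' \<in> N" by (rule e(2)[OF \<gamma>'(1)]) (unfold \<gamma>'(2), rule Ck_close_mono[OF f(3)], simp_all)
      moreover have "Morse_supported k F2 F2_atlas (half_sq_chord \<gamma>')"
        unfolding Morse_supported_iff[OF emb] \<gamma>'(2) by (rule f(4))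
      ultimately show ?thesis unfolding N(2) Morse_embeddings_def by blast
    qed
    then show "\<gamma> \<in> Embedding_space k closure_of Morse_embeddings k"
      using \<gamma> by (simp add: in_closure_of topspace_Embedding_space)
  qed
qed (rule closure_of_subset_topspace)

theorem theorem4p3:
  fixes k :: nat
  assumes "k \<ge> 2"
  shows "openin (Embedding_space k) (Morse_embeddings k :: (complex \<Rightarrow> real ^ 'd) set)
    \<and> Embedding_space k closure_of (Morse_embeddings k :: (complex \<Rightarrow> real ^ 'd) set)
        = topspace (Embedding_space k)
    \<and> (\<forall>\<gamma> \<in> (Morse_embeddings k :: (complex \<Rightarrow> real ^ 'd) set). \<forall>i.
         pointwise_finite_dimensional
           (sublevel_persistence i F2 (half_sq_chord \<gamma>) ::
             ('k::field, (complex set, 'k) field_chain set) persistence_module)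
         \<and> pointwise_finite_dimensional
           (sublevel_persistence i F2 (chord \<gamma>) ::
             ('k, (complex set, 'k) field_chain set) persistence_module))"
proof (intro conjI ballI allI)
  show "openin (Embedding_space k) (Morse_embeddings k :: (complex \<Rightarrow> real ^ 'd) set)"
    by (rule openin_Morse_embeddings[OF assms])
  show "Embedding_space k closure_of (Morse_embeddings k :: (complex \<Rightarrow> real ^ 'd) set) = topspace (Embedding_space k)"
    by (rule dense_Morse_embeddings[OF assms])
  fix \<gamma> :: "complex \<Rightarrow> real ^ 'd" and i
  assume "\<gamma> \<in> Morse_embeddings k"
  then have \<gamma>: "\<gamma> \<in> Ck_embeddings k" "Morse_supported k F2 F2_atlas (half_sq_chord \<gamma>)"
    by (simp_all add: Morse_embeddings_def)
  have inj: "inj_on \<gamma> S1" and Ck: "Ck_open k UNIV (\<gamma> \<circ> circle_exp)"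
    using \<gamma>(1) by (simp_all add: Ck_embeddings_def Ck_curves_def)
  have nd: "nondegenerate_chord (\<gamma> \<circ> circle_exp) x y" if "0 < y - x" "y - x < 1" for x y
    using \<gamma>(2) that unfolding Morse_supported_iff[OF embedded_closed_curve_of_embedding[OF \<gamma>(1) assms]] by blast
  show "pointwise_finite_dimensional (sublevel_persistence i F2 (half_sq_chord \<gamma>) ::
      ('k, (complex set, 'k) field_chain set) persistence_module)"
    by (rule persistence_finite_dimensional(1)[OF Ck assms inj nd])
  show "pointwise_finite_dimensional (sublevel_persistence i F2 (chord \<gamma>) ::
      ('k, (complex set, 'k) field_chain set) persistence_module)"
    by (rule persistence_finite_dimensional(2)[OF Ck assms inj nd])
qed

end
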